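(* Let $q\in(-1,1)$, let $\{X(t):t\ge0\}$ be the $q$-Brownian motion, and let $f$ be a polynomial. Then for $t\ge0$ $$f(X(t))=f(0)+\int_0^t(\partial f)(X(s),X(s))\,\sharp\,dX(s)+\int_0^t(\Delta_{s;q}f)(X(s))\,ds,$$ where $$\Delta_{s;q}f(x)=\int_{\mathbb{R}}\left(\partial_x\frac{f(x)-f(y)}{x-y}\right)\Gamma_{s;q}(x,dy)=\int_{\mathbb{R}}(\partial_x\partial f)(x,y)\,\Gamma_{s;q}(x,dy).$$
   Context: The $q$-Brownian motion is the family of bounded self-adjoint operators $\{X(t):t\ge0\}$ generating a von Neumann algebra with faithful normal tracial state $\mathbb{E}$, whose joint moments are $\mathbb{E}[X(t_1)\cdots X(t_n)]=\sum_{\pi}q^{\mathrm{cr}(\pi)}\prod_{\{i,j\}\in\pi}\min(t_i,t_j)$, the sum over pair partitions $\pi$ of $\{1,\dots,n\}$, with $\mathrm{cr}(\pi)$ the number of crossings. $X(0)=0$. $H_n(x,t;q)$ are the monic continuous $q$-Hermite polynomials: $H_0=1$, $H_1=x$, $xH_n(x,t;q)=H_{n+1}(x,t;q)+[n]_q\,t\,H_{n-1}(x,t;q)$, $[n]_q=1+q+\dots+q^{n-1}$. For $s>0$, $\Gamma_{s;q}(x,dy)$ is the integral kernel of the operator on functions on $\left[-\frac{2\sqrt s}{\sqrt{1-q}},\frac{2\sqrt s}{\sqrt{1-q}}\right]$ determined by $\int H_n(y,s;q)\,\Gamma_{s;q}(x,dy)=q^nH_n(x,s;q)$ for all $n\ge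 0$. $\partial f(x,y)=\frac{f(x)-f(y)}{x-y}$ is the difference quotient, and $\partial_x$ acts on the first variable. For a polynomial $u(x,y)=\sum_ka_k(x)b_k(y)$, $u(X(s),X(s))$ is interpreted as $\sum_ka_k(X(s))\otimes b_k(X(s))$, and the stochastic integral (Donati-Martin) is $$\int_0^tu(X(s),X(s))\,\sharp\,dX(s)=\lim\sum_i\sum_ka_k(X(t_i))\,(X(t_{i+1})-X(t_i))\,b_k(X(t_i)),$$ the limit (in $L^2(\mathbb{E})$) over partitions $0=t_0<t_1<\dots<t_n=t$ with mesh tending to zero. *)

theory Defs
  imports
    "HOL-Analysis.Analysis"
    "HOL-Library.Disjoint_Sets"
    "HOL-Computational_Algebra.Polynomial"
begin

text \<open>The inner product is conjugate linear in the first argument. The underlying real Hilbert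
  space (norm, topology, completeness) is that of the library classes, with real inner product
  the real part of the complex one.\<close>

class complex_hilbert_space = real_inner + banach +
  fixes scaleC :: "complex \<Rightarrow> 'a \<Rightarrow> 'a" (infixr "*\<^sub>C" 75)
    and cinner :: "'a \<Rightarrow> 'a \<Rightarrow> complex"
  assumes scaleC_add_right: "c *\<^sub>C (x + y) = c *\<^sub>C x + c *\<^sub>C y"
    and scaleC_add_left: "(c + d) *\<^sub>C x = c *\<^sub>C x + d *\<^sub>C x"
    and scaleC_scaleC: "c *\<^sub>C d *\<^sub>C x = (c * d) *\<^sub>C x"
    and scaleR_scaleC: "r *\<^sub>R x = complex_of_real r *\<^sub>C x"
    and cinner_commute: "cinner x y = cnj (cinner y x)"
    and cinner_add_left: "cinner (x + y) z = cinner x z + cinner y z"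
    and cinner_scaleC_left: "cinner (c *\<^sub>C x) y = cnj c * cinner x y"
    and inner_eq_Re_cinner: "x \<bullet> y = Re (cinner x y)"
begin

lemma cinner_scaleC_right: "cinner x (c *\<^sub>C y) = c * cinner x y"
  using cinner_commute[of x "c *\<^sub>C y"] cinner_commute[of x y]
  by (simp add: cinner_scaleC_left)

lemma norm_scaleC: "norm (c *\<^sub>C x) = cmod c * norm x"
proof -
  have "(c *\<^sub>C x) \<bullet> (c *\<^sub>C x) = ((Re c)\<^sup>2 + (Im c)\<^sup>2) * (x \<bullet> x)"
    by (simp add: inner_eq_Re_cinner cinner_scaleC_left cinner_scaleC_right
        power2_eq_square algebra_simps)
  then have "(c *\<^sub>C x) \<bullet> (c *\<^sub>C x) = (cmod c)\<^sup>2 * (x \<bullet> x)"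
    by (simp only: cmod_power2)
  then show ?thesis
    by (simp add: norm_eq_sqrt_inner real_sqrt_mult)
qed

end

text \<open>Operators are elements of the library type of bounded real-linear maps, with composition
  \<open>o\<^sub>L\<close> and the operator norm; complex linearity is imposed by \<open>complex_linear_op\<close>.\<close>

definition complex_linear_op :: "('h::complex_hilbert_space \<Rightarrow>\<^sub>L 'h) \<Rightarrow> bool" where
  "complex_linear_op A \<longleftrightarrow> (\<forall>c x. A (c *\<^sub>C x) = c *\<^sub>C A x)"

definition scaleC_op :: "complex \<Rightarrow> ('h::complex_hilbert_space \<Rightarrow>\<^sub>L 'h) \<Rightarrow> ('h \<Rightarrow>\<^sub>L 'h)" where
  "scaleC_op c A = Blinfun (\<lambda>x. c *\<^sub>C A x)"

lemma scaleC_op_apply [simp]: "scaleC_op c A x = c *\<^sub>C A x"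
proof -
  have "bounded_linear (\<lambda>x. c *\<^sub>C A x)"
  proof (rule bounded_linear_intro)
    show "norm (c *\<^sub>C A x) \<le> norm x * (cmod c * norm A)" for x
      using mult_left_mono[OF norm_blinfun[of A x], of "cmod c"]
      by (simp add: norm_scaleC mult_ac)
    show "c *\<^sub>C A (x + y) = c *\<^sub>C A x + c *\<^sub>C A y" for x y
      by (simp add: blinfun.add_right scaleC_add_right)
    show "c *\<^sub>C A (r *\<^sub>R x) = r *\<^sub>R c *\<^sub>C A x" for r x
      by (simp only: blinfun.scaleR_right) (simp add: scaleR_scaleC scaleC_scaleC mult.commute)
  qed
  then show ?thesis
    by (simp add: scaleC_op_def bounded_linear_Blinfun_apply)
qed

definition is_adjoint ::
    "('h::complex_hilbert_space \<Rightarrow>\<^sub>L 'h) \<Rightarrow> ('h \<Rightarrow>\<^sub>L 'h) \<Rightarrow> bool" where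
  "is_adjoint A B \<longleftrightarrow> (\<forall>x y. cinner (A x) y = cinner x (B y))"

lemma is_adjoint_unique:
  assumes "is_adjoint A B" "is_adjoint A C"
  shows "B = C"
proof (rule blinfun_eqI)
  fix y
  have "x \<bullet> (B y - C y) = 0" for x
    using assms unfolding is_adjoint_def by (metis diff_self inner_diff_right inner_eq_Re_cinner)
  from this[of "B y - C y"] show "B y = C y"
    by simp
qed

definition adj_op :: "('h::complex_hilbert_space \<Rightarrow>\<^sub>L 'h) \<Rightarrow> ('h \<Rightarrow>\<^sub>L 'h)" where
  "adj_op A = (THE B. is_adjoint A B)"

lemma adj_op_eq: "is_adjoint A B \<Longrightarrow> adj_op A = B"
  unfolding adj_op_def by (blast intro: is_adjoint_unique)

definition selfadjoint_op :: "('h::complex_hilbert_space \<Rightarrow>\<^sub>L 'h) \<Rightarrow> bool" where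
  "selfadjoint_op A \<longleftrightarrow> is_adjoint A A"

definition positive_op :: "('h::complex_hilbert_space \<Rightarrow>\<^sub>L 'h) \<Rightarrow> bool" where
  "positive_op A \<longleftrightarrow> complex_linear_op A \<and> (\<forall>x. cinner x (A x) \<in> \<real>\<^sub>\<ge>\<^sub>0)"

definition op_le :: "('h::complex_hilbert_space \<Rightarrow>\<^sub>L 'h) \<Rightarrow> ('h \<Rightarrow>\<^sub>L 'h) \<Rightarrow> bool" where
  "op_le A B \<longleftrightarrow> positive_op (B - A)"

definition op_prod :: "('h::complex_hilbert_space \<Rightarrow>\<^sub>L 'h) list \<Rightarrow> ('h \<Rightarrow>\<^sub>L 'h)" where
  "op_prod As = foldr (o\<^sub>L) As id_blinfun"

definition op_power :: "('h::complex_hilbert_space \<Rightarrow>\<^sub>L 'h) \<Rightarrow> nat \<Rightarrow> ('h \<Rightarrow>\<^sub>L 'h)" where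
  "op_power A n = op_prod (replicate n A)"

definition poly_op :: "complex poly \<Rightarrow> ('h::complex_hilbert_space \<Rightarrow>\<^sub>L 'h) \<Rightarrow> ('h \<Rightarrow>\<^sub>L 'h)" where
  "poly_op p A = (\<Sum>i\<le>degree p. scaleC_op (coeff p i) (op_power A i))"

definition commutant ::
    "('h::complex_hilbert_space \<Rightarrow>\<^sub>L 'h) set \<Rightarrow> ('h \<Rightarrow>\<^sub>L 'h) set" where
  "commutant S = {A. complex_linear_op A \<and> (\<forall>B\<in>S. A o\<^sub>L B = B o\<^sub>L A)}"

text \<open>By the double commutant theorem this is the von Neumann algebra generated by \<open>S\<close> whenever
  \<open>S\<close> is closed under adjoints; it is only used for sets of self-adjoint operators.\<close>

definition von_neumann_generated ::
    "('h::complex_hilbert_space \<Rightarrow>\<^sub>L 'h) set \<Rightarrow> ('h \<Rightarrow>\<^sub>L 'h) set" where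
  "von_neumann_generated S = commutant (commutant S)"

definition state_on ::
    "('h::complex_hilbert_space \<Rightarrow>\<^sub>L 'h) set \<Rightarrow> (('h \<Rightarrow>\<^sub>L 'h) \<Rightarrow> complex) \<Rightarrow> bool" where
  "state_on M E \<longleftrightarrow>
     (\<forall>A\<in>M. \<forall>B\<in>M. E (A + B) = E A + E B) \<and>
     (\<forall>c. \<forall>A\<in>M. E (scaleC_op c A) = c * E A) \<and>
     (\<forall>A\<in>M. positive_op A \<longrightarrow> E A \<in> \<real>\<^sub>\<ge>\<^sub>0) \<and>
     E id_blinfun = 1"

definition faithful_on ::
    "('h::complex_hilbert_space \<Rightarrow>\<^sub>L 'h) set \<Rightarrow> (('h \<Rightarrow>\<^sub>L 'h) \<Rightarrow> complex) \<Rightarrow> bool" where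
  "faithful_on M E \<longleftrightarrow> (\<forall>A\<in>M. positive_op A \<and> E A = 0 \<longrightarrow> A = 0)"

definition tracial_on ::
    "('h::complex_hilbert_space \<Rightarrow>\<^sub>L 'h) set \<Rightarrow> (('h \<Rightarrow>\<^sub>L 'h) \<Rightarrow> complex) \<Rightarrow> bool" where
  "tracial_on M E \<longleftrightarrow> (\<forall>A\<in>M. \<forall>B\<in>M. E (A o\<^sub>L B) = E (B o\<^sub>L A))"

text \<open>Normality: suprema of increasing (upward directed) families of positive elements are
  preserved.\<close>

definition normal_on ::
    "('h::complex_hilbert_space \<Rightarrow>\<^sub>L 'h) set \<Rightarrow> (('h \<Rightarrow>\<^sub>L 'h) \<Rightarrow> complex) \<Rightarrow> bool" where
  "normal_on M E \<longleftrightarrow>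
     (\<forall>D A. D \<subseteq> M \<and> D \<noteq> {} \<and> (\<forall>B\<in>D. positive_op B) \<and>
        (\<forall>B\<in>D. \<forall>C\<in>D. \<exists>G\<in>D. op_le B G \<and> op_le C G) \<and>
        A \<in> M \<and> (\<forall>B\<in>D. op_le B A) \<and> (\<forall>C\<in>M. (\<forall>B\<in>D. op_le B C) \<longrightarrow> op_le A C)
        \<longrightarrow> Re (E A) = (SUP B\<in>D. Re (E B)))"

definition L2_norm ::
    "(('h::complex_hilbert_space \<Rightarrow>\<^sub>L 'h) \<Rightarrow> complex) \<Rightarrow> ('h \<Rightarrow>\<^sub>L 'h) \<Rightarrow> real" where
  "L2_norm E A = sqrt (Re (E (adj_op A o\<^sub>L A)))"

definition pair_partitions :: "'a set \<Rightarrow> 'a set set set" where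
  "pair_partitions A = {P. partition_on A P \<and> (\<forall>B\<in>P. card B = 2)}"

definition crossings :: "nat set set \<Rightarrow> nat" where
  "crossings P = card {(i, j, k, l). i < j \<and> j < k \<and> k < l \<and> {i, k} \<in> P \<and> {j, l} \<in> P}"

definition q_brownian_motion ::
    "real \<Rightarrow> (real \<Rightarrow> ('h::complex_hilbert_space \<Rightarrow>\<^sub>L 'h)) \<Rightarrow> (('h \<Rightarrow>\<^sub>L 'h) \<Rightarrow> complex) \<Rightarrow> bool" where
  "q_brownian_motion q X E \<longleftrightarrow>
     (\<forall>t\<ge>0. complex_linear_op (X t) \<and> selfadjoint_op (X t)) \<and>
     (let M = von_neumann_generated (X ` {0..})
      in state_on M E \<and> faithful_on M E \<and> normal_on M E \<and> tracial_on M E) \<and>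
     X 0 = 0 \<and>
     (\<forall>n t. (\<forall>i\<in>{1..n}. 0 \<le> t i) \<longrightarrow>
        E (op_prod (map (\<lambda>i. X (t i)) [1..<Suc n])) =
        complex_of_real (\<Sum>P\<in>pair_partitions {1..n}. q ^ crossings P * (\<Prod>B\<in>P. Min (t ` B))))"

definition q_int :: "real \<Rightarrow> nat \<Rightarrow> real" where
  "q_int q n = (\<Sum>i<n. q ^ i)"

fun q_hermite :: "real \<Rightarrow> nat \<Rightarrow> real \<Rightarrow> real \<Rightarrow> real" where
  "q_hermite q 0 x t = 1"
| "q_hermite q (Suc 0) x t = x"
| "q_hermite q (Suc (Suc n)) x t =
     x * q_hermite q (Suc n) x t - q_int q (Suc n) * t * q_hermite q n x t"

definition q_interval :: "real \<Rightarrow> real \<Rightarrow> real set" where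
  "q_interval q s = {- (2 * sqrt s / sqrt (1 - q)) .. 2 * sqrt s / sqrt (1 - q)}"

text \<open>\<open>\<Gamma> s x\<close> is the measure \<open>\<Gamma>\<^bsub>s;q\<^esub>(x, dy)\<close>, for \<open>s > 0\<close> and \<open>x\<close> in the interval. Since
  the interval is compact, the moment condition determines this measure uniquely.\<close>

definition q_kernel :: "real \<Rightarrow> (real \<Rightarrow> real \<Rightarrow> real measure) \<Rightarrow> bool" where
  "q_kernel q \<Gamma> \<longleftrightarrow>
     (\<forall>s>0. \<forall>x\<in>q_interval q s.
        sets (\<Gamma> s x) = sets borel \<and> finite_measure (\<Gamma> s x) \<and>
        emeasure (\<Gamma> s x) (- q_interval q s) = 0 \<and>
        (\<forall>n. (\<integral>y. q_hermite q n y s \<partial>\<Gamma> s x) = q ^ n * q_hermite q n x s))"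

text \<open>A polynomial \<open>u(x, y) = \<Sum>k. a\<^sub>k(x) y^k\<close> in two variables is represented by the element
  of \<open>complex poly poly\<close> with coefficients \<open>a\<^sub>k\<close>.\<close>

definition poly2 :: "complex poly poly \<Rightarrow> complex \<Rightarrow> complex \<Rightarrow> complex" where
  "poly2 u x y = (\<Sum>k\<le>degree u. poly (coeff u k) x * y ^ k)"

definition diff_quotient :: "complex poly \<Rightarrow> complex poly poly" where
  "diff_quotient f =
     (THE u. \<forall>x y. x \<noteq> y \<longrightarrow> poly2 u x y = (poly f x - poly f y) / (x - y))"

lemma poly2_altdef: "poly2 u x y = poly (poly u [:y:]) x"
  by (simp add: poly2_def poly_altdef[of u] poly_sum poly_power)

lemma diff_quotient_exists:
  "\<exists>u. \<forall>x y. x \<noteq> y \<longrightarrow> poly2 u x y = (poly f x - poly f y) / (x - y)"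
proof (induction f)
  case 0
  show ?case by (intro exI[of _ 0]) (simp add: poly2_altdef)
next
  case (pCons a f)
  from pCons.IH obtain u where u: "poly2 u x y = (poly f x - poly f y) / (x - y)"
    if "x \<noteq> y" for x y
    by blast
  have "poly2 ([:f:] + pCons 0 u) x y = (poly (pCons a f) x - poly (pCons a f) y) / (x - y)"
    if "x \<noteq> y" for x y
  proof -
    have fx: "poly f x = poly f y + poly2 u x y * (x - y)"
      using u[OF that] that by simp
    have "poly2 ([:f:] + pCons 0 u) x y = poly f x + y * poly2 u x y"
      by (simp add: poly2_altdef)
    then have "poly2 ([:f:] + pCons 0 u) x y * (x - y) =
        poly (pCons a f) x - poly (pCons a f) y"
      unfolding poly_pCons fx by (simp add: algebra_simps)
    then show ?thesis
      using that by (simp add: eq_divide_eq)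
  qed
  then show ?case by blast
qed

lemma poly2_eqI:
  assumes "\<And>x y. x \<noteq> y \<Longrightarrow> poly2 u x y = poly2 v x y"
  shows "u = v"
proof (rule ccontr)
  assume "u \<noteq> v"
  then have nz: "u - v \<noteq> 0" by simp
  have zero: "poly (u - v) [:y:] = 0" for y
  proof (rule ccontr)
    assume nz': "poly (u - v) [:y:] \<noteq> 0"
    have "- {y} \<subseteq> {x. poly (poly (u - v) [:y:]) x = 0}"
      using assms by (auto simp: poly2_altdef)
    moreover have "infinite (- {y} :: complex set)"
      by (simp add: infinite_UNIV_char_0)
    ultimately show False
      using poly_roots_finite[OF nz'] finite_subset by blast
  qed
  have "range (\<lambda>y::complex. [:y:]) \<subseteq> {z. poly (u - v) z = 0}"
    using zero by blast
  moreover have "infinite (range (\<lambda>y::complex. [:y:]))"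
    using finite_imageD[of "\<lambda>y::complex. [:y:]" UNIV] infinite_UNIV_char_0[where 'a = complex]
    by (auto simp: inj_def)
  ultimately show False
    using poly_roots_finite[OF nz] finite_subset by blast
qed

lemma diff_quotient:
  assumes "x \<noteq> y"
  shows "poly2 (diff_quotient f) x y = (poly f x - poly f y) / (x - y)"
proof -
  have "\<exists>!u. \<forall>x y. x \<noteq> y \<longrightarrow> poly2 u x y = (poly f x - poly f y) / (x - y)"
    using diff_quotient_exists[of f] by (auto intro!: poly2_eqI)
  from theI'[OF this] assms show ?thesis
    unfolding diff_quotient_def by blast
qed

definition q_Delta ::
    "(real \<Rightarrow> real \<Rightarrow> real measure) \<Rightarrow> real \<Rightarrow> complex poly \<Rightarrow> real \<Rightarrow> complex" where
  "q_Delta \<Gamma> s f x =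
     (\<integral>y. deriv (\<lambda>z. poly2 (diff_quotient f) z (complex_of_real y)) (complex_of_real x) \<partial>\<Gamma> s x)"

text \<open>The value \<open>g(A)\<close> for a function \<open>g\<close> on a set \<open>S\<close> (the spectrum of the self-adjoint
  operator \<open>A\<close>) that coincides on \<open>S\<close> with a polynomial. The polynomial is unique if \<open>S\<close> is
  infinite. This is how \<open>\<Delta>\<^bsub>s;q\<^esub>f\<close>, which is defined pointwise on the interval and is given there
  by a polynomial, is applied to \<open>X s\<close>.\<close>

definition apply_op ::
    "real set \<Rightarrow> (real \<Rightarrow> complex) \<Rightarrow> ('h::complex_hilbert_space \<Rightarrow>\<^sub>L 'h) \<Rightarrow> ('h \<Rightarrow>\<^sub>L 'h)" where
  "apply_op S g A = poly_op (THE p. \<forall>x\<in>S. poly p (complex_of_real x) = g x) A"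

text \<open>The summand for one subinterval: \<open>\<Sum>k. a\<^sub>k(A) D b\<^sub>k(A)\<close> with \<open>b\<^sub>k(y) = y^k\<close>.\<close>

definition sharp_op ::
    "complex poly poly \<Rightarrow> ('h::complex_hilbert_space \<Rightarrow>\<^sub>L 'h) \<Rightarrow> ('h \<Rightarrow>\<^sub>L 'h) \<Rightarrow> ('h \<Rightarrow>\<^sub>L 'h)" where
  "sharp_op u A D = (\<Sum>k\<le>degree u. poly_op (coeff u k) A o\<^sub>L D o\<^sub>L op_power A k)"

definition has_stochastic_integral ::
    "(('h::complex_hilbert_space \<Rightarrow>\<^sub>L 'h) \<Rightarrow> complex) \<Rightarrow> (real \<Rightarrow> ('h \<Rightarrow>\<^sub>L 'h)) \<Rightarrow>
     complex poly poly \<Rightarrow> real \<Rightarrow> ('h \<Rightarrow>\<^sub>L 'h) \<Rightarrow> bool" where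
  "has_stochastic_integral E X u t I \<longleftrightarrow>
     I \<in> von_neumann_generated (X ` {0..}) \<and>
     (\<forall>\<epsilon>>0. \<exists>\<delta>>0. \<forall>n \<tau>.
        \<tau> 0 = 0 \<and> \<tau> n = t \<and> (\<forall>i<n. \<tau> i < \<tau> (Suc i) \<and> \<tau> (Suc i) - \<tau> i < \<delta>) \<longrightarrow>
        L2_norm E ((\<Sum>i<n. sharp_op u (X (\<tau> i)) (X (\<tau> (Suc i)) - X (\<tau> i))) - I) < \<epsilon>)"

end

theory Submission
  imports Defs
begin

text \<open>Along a partition of \<open>{0..t}\<close>, \<open>f (X t) - f (X 0)\<close> is the sum of the increments
\<open>f (A + D) - f A\<close> with \<open>A = X (\<tau> i)\<close> and \<open>D = X (\<tau> (i+1)) - X (\<tau> i)\<close>. Expand each of them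
in powers of \<open>D\<close>, without commuting anything. The first-order terms are the Riemann sum of the
stochastic integral. The terms of order three and more are small in operator norm, because
\<open>norm D\<close> is of the order of the square root of the step. The second-order terms are sums of
products \<open>p(A) D A^k D A^l\<close>, and the point is that their conditional expectation given the past
is \<open>h p(A) \<phi>\<^sub>k(A) A^l\<close>, where \<open>h\<close> is the step and \<open>\<phi>\<^sub>k(x) = \<integral> y^k \<Gamma>(x, dy)\<close>. Added up, these
conditional expectations form a Riemann sum of the drift \<open>(\<Delta> f)(X s)\<close>, which converges in norm
because the drift is a norm-continuous function of \<open>s\<close>. The deviations from them are martingale
differences of norm \<open>O(h)\<close>: they are orthogonal, and the square of the \<open>L\<^sup>2\<close> norm of their sum is
\<open>O(mesh)\<close>. So if \<open>J\<close> is the integral of the drift, then \<open>f (X t) - f 0 - J\<close> is the stochastic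
integral.

The conditional expectation (\<open>E_sandwich\<close>) is computed on the algebraic \<open>q\<close>-Fock space. The sum over
pair partitions is the vacuum expectation of a word of field operators
(\<open>sum_pair_partitions\<close>), and the \<open>n\<close>-th \<open>q\<close>-Hermite polynomial of a field is its \<open>n\<close>-th Wick power, in
which no two factors are paired with each other (\<open>wick_field_op\<close>). In \<open>U D H\<^sub>n(A) D V\<close> with \<open>U\<close> and \<open>V\<close> in
the past, the two factors \<open>D\<close> have to be paired together. Each of the \<open>n\<close> factors of the Wick power is
paired with a factor of \<open>U\<close> or \<open>V\<close>, so it crosses that pair, which gives \<open>h q^n U H\<^sub>n(A) V\<close>
(\<open>wick_marked\<close>). This is the rule \<open>H\<^sub>n \<mapsto> q^n H\<^sub>n\<close> that determines \<open>\<Gamma>\<close>.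

The norm of an increment is obtained without any estimate of moments (\<open>norm_increment_le\<close>):
the moments of \<open>X b - X a\<close> are those of \<open>sqrt (b - a)\<close> times \<open>X 1\<close>, which is a bounded operator, and for a
faithful state the growth of the even moments bounds the norm (\<open>norm_le_of_moments\<close>).\<close>

section \<open>Word moments on the algebraic q-Fock space\<close>

definition vacuum :: "'a list \<Rightarrow> real" where
  "vacuum S = (if S = [] then 1 else 0)"

text \<open>A list of labels stands for the elementary tensor of its entries, and a real function on lists for
a linear functional on the algebraic Fock space. Letting the field operators act on functionals, by
transposition, avoids the construction of a free vector space. The labels stand for vectors with
covariance \<open>c\<close>; where linearity in a label matters, it is expressed by \<open>moment_splits\<close>.\<close>
locale fock =
  fixes q :: real and c :: "'a \<Rightarrow> 'a \<Rightarrow> real"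
begin

text \<open>Removing an entry costs a factor \<open>q\<close> for each entry above it, as made explicit in
\<open>annihilate_sum_nth\<close>.\<close>
fun annihilate :: "'a \<Rightarrow> ('a list \<Rightarrow> real) \<Rightarrow> 'a list \<Rightarrow> real" where
  "annihilate x \<psi> [] = 0"
| "annihilate x \<psi> (y # S) = c x y * \<psi> S + q * annihilate x (\<lambda>T. \<psi> (y # T)) S"

definition field_op :: "'a \<Rightarrow> ('a list \<Rightarrow> real) \<Rightarrow> 'a list \<Rightarrow> real" where
  "field_op x \<psi> S = \<psi> (x # S) + annihilate x \<psi> S"

primrec apply_word :: "'a list \<Rightarrow> ('a list \<Rightarrow> real) \<Rightarrow> 'a list \<Rightarrow> real" where
  "apply_word [] \<psi> = \<psi>"
| "apply_word (x # w) \<psi> = field_op x (apply_word w \<psi>)"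

lemma apply_word_append: "apply_word (u @ v) \<psi> = apply_word u (apply_word v \<psi>)"
  by (induction u) simp_all

text \<open>The last letter of a word acts first on the vacuum tensor \<open>[]\<close>, and in \<open>apply_word\<close> it is the head
that acts first: hence the reversal.\<close>
definition moment :: "'a list \<Rightarrow> real" where
  "moment w = apply_word (rev w) vacuum []"

lemma annihilate_linear: "annihilate x (\<lambda>T. a * \<psi> T + b * \<phi> T) S = a * annihilate x \<psi> S + b * annihilate x \<phi> S"
  by (induction S arbitrary: \<psi> \<phi>) (simp_all add: algebra_simps)

lemma annihilate_scale: "annihilate x (\<lambda>T. a * \<psi> T) S = a * annihilate x \<psi> S"
  using annihilate_linear[of x a \<psi> 0 \<psi> S] by simp

lemma apply_word_linear:
  "apply_word w (\<lambda>T. a * \<psi> T + b * \<phi> T) S = a * apply_word w \<psi> S + b * apply_word w \<phi> S"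
proof (induction w arbitrary: S)
  case (Cons x w)
  then have "apply_word w (\<lambda>T. a * \<psi> T + b * \<phi> T) =
      (\<lambda>S. a * apply_word w \<psi> S + b * apply_word w \<phi> S)"
    by (intro ext) blast
  then show ?case
    by (simp only: apply_word.simps field_op_def annihilate_linear) (simp add: Cons algebra_simps)
qed simp

lemma annihilate_cong:
  assumes "set S \<subseteq> P" "\<And>T. set T \<subseteq> P \<Longrightarrow> \<psi> T = \<phi> T"
  shows "annihilate x \<psi> S = annihilate x \<phi> S"
  using assms
proof (induction S arbitrary: \<psi> \<phi>)
  case (Cons y S)
  have "annihilate x (\<lambda>T. \<psi> (y # T)) S = annihilate x (\<lambda>T. \<phi> (y # T)) S"
    using Cons.prems by (intro Cons.IH) simp_all
  moreover have "\<psi> S = \<phi> S"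
    using Cons.prems by simp
  ultimately show ?case
    by (simp only: annihilate.simps)
qed simp

lemma apply_word_cong:
  assumes "set w \<subseteq> P" "set S \<subseteq> P" "\<And>T. set T \<subseteq> P \<Longrightarrow> \<psi> T = \<phi> T"
  shows "apply_word w \<psi> S = apply_word w \<phi> S"
  using assms(1,2)
proof (induction w arbitrary: S)
  case (Cons x w)
  then have "annihilate x (apply_word w \<psi>) S = annihilate x (apply_word w \<phi>) S"
    by (intro annihilate_cong[of _ P]) auto
  moreover have "apply_word w \<psi> (x # S) = apply_word w \<phi> (x # S)"
    using Cons by simp
  ultimately show ?case
    by (simp only: apply_word.simps field_op_def)
qed (simp add: assms(3))

lemma annihilate_orthogonal:
  assumes "\<And>y. y \<in> set S \<Longrightarrow> c x y = 0"
  shows "annihilate x \<psi> S = 0"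
  using assms
proof (induction S arbitrary: \<psi>)
  case (Cons y S)
  have "annihilate x (\<lambda>T. \<psi> (y # T)) S = 0"
    using Cons.prems by (intro Cons.IH) simp
  moreover have "c x y = 0"
    using Cons.prems by simp
  ultimately show ?case
    by simp
qed simp

text \<open>Fields orthogonal to \<open>d\<close> never remove an entry \<open>d\<close>. The vacuum expectation after such fields
therefore annuls all tensors that contain \<open>d\<close>.\<close>
definition kills :: "'a \<Rightarrow> ('a list \<Rightarrow> real) \<Rightarrow> bool" where
  "kills d \<psi> \<longleftrightarrow> (\<forall>S. d \<in> set S \<longrightarrow> \<psi> S = 0)"

lemma annihilate_kills:
  assumes "kills d \<psi>" "c x d = 0"
  shows "kills d (annihilate x \<psi>)"
  unfolding kills_def
proof (intro allI impI)
  fix S assume "d \<in> set S"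
  then show "annihilate x \<psi> S = 0"
    using assms(1)
  proof (induction S arbitrary: \<psi>)
    case (Cons y S)
    show ?case
    proof (cases "d \<in> set S")
      case True
      moreover have "kills d (\<lambda>T. \<psi> (y # T))"
        using Cons.prems(2) by (simp add: kills_def)
      ultimately show ?thesis
        using Cons by (simp add: kills_def)
    next
      case False
      then have "y = d" using Cons.prems by simp
      moreover have "annihilate x (\<lambda>T. \<psi> (d # T)) S = annihilate x (\<lambda>T. 0 * \<psi> T) S"
        using Cons.prems(2) by (intro annihilate_cong[of _ UNIV]) (auto simp: kills_def)
      ultimately show ?thesis
        using assms(2) by (simp only: annihilate.simps annihilate_scale)
    qed
  qed simp
qed

lemma apply_word_kills:
  assumes "\<And>x. x \<in> set w \<Longrightarrow> c x d = 0" "kills d \<psi>"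
  shows "kills d (apply_word w \<psi>)"
  using assms(1)
proof (induction w)
  case (Cons x w)
  then have k: "kills d (apply_word w \<psi>)" by simp
  with annihilate_kills[OF k, of x] Cons show ?case
    by (simp add: kills_def field_op_def)
qed (use assms(2) in simp)

lemma kills_vacuum: "kills d vacuum"
  by (auto simp: kills_def vacuum_def)

text \<open>The relation \<open>x = x1 - x2\<close> between vectors, as it is seen by a functional in each tensor factor.\<close>
definition splits :: "'a \<Rightarrow> 'a \<Rightarrow> 'a \<Rightarrow> ('a list \<Rightarrow> real) \<Rightarrow> bool" where
  "splits x x1 x2 \<psi> \<longleftrightarrow> (\<forall>S T. \<psi> (S @ x # T) = \<psi> (S @ x1 # T) - \<psi> (S @ x2 # T))"

context
  fixes x x1 x2 :: 'a
  assumes left: "\<And>y. c x y = c x1 y - c x2 y"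
    and right: "\<And>y. c y x = c y x1 - c y x2"
begin

lemma annihilate_splits:
  assumes "splits x x1 x2 \<psi>"
  shows "splits x x1 x2 (annihilate y \<psi>)"
  unfolding splits_def
proof (intro allI)
  fix S T
  show "annihilate y \<psi> (S @ x # T) = annihilate y \<psi> (S @ x1 # T) - annihilate y \<psi> (S @ x2 # T)"
    using assms
  proof (induction S arbitrary: \<psi>)
    case Nil
    then have "(\<lambda>T. \<psi> (x # T)) = (\<lambda>T. 1 * \<psi> (x1 # T) + (- 1) * \<psi> (x2 # T))"
      unfolding splits_def by (metis (no_types) append_Nil mult_1 mult_minus1 uminus_add_conv_diff add.commute)
    then show ?case
      by (simp only: append_Nil annihilate.simps right annihilate_linear) (simp add: algebra_simps)
  next
    case (Cons z S)
    from Cons.prems have "splits x x1 x2 (\<lambda>T. \<psi> (z # T))"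
      unfolding splits_def by (metis append_Cons)
    note IH = Cons.IH[OF this]
    have "\<psi> (S @ x # T) = \<psi> (S @ x1 # T) - \<psi> (S @ x2 # T)"
      using Cons.prems by (simp only: splits_def)
    then show ?case
      by (simp only: append_Cons annihilate.simps IH right_diff_distrib)
  qed
qed

lemma apply_word_splits:
  assumes "splits x x1 x2 \<psi>"
  shows "splits x x1 x2 (apply_word w \<psi>)"
proof (induction w)
  case (Cons y w)
  show ?case
    unfolding splits_def
  proof (intro allI)
    fix S T
    have "apply_word w \<psi> ((y # S) @ x # T) = apply_word w \<psi> ((y # S) @ x1 # T) - apply_word w \<psi> ((y # S) @ x2 # T)"
      using Cons unfolding splits_def by blast
    moreover have "annihilate y (apply_word w \<psi>) (S @ x # T) =
        annihilate y (apply_word w \<psi>) (S @ x1 # T) - annihilate y (apply_word w \<psi>) (S @ x2 # T)"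
      using annihilate_splits[OF Cons, of y] unfolding splits_def by blast
    ultimately show "apply_word (y # w) \<psi> (S @ x # T) =
        apply_word (y # w) \<psi> (S @ x1 # T) - apply_word (y # w) \<psi> (S @ x2 # T)"
      by (simp only: apply_word.simps field_op_def append_Cons)
  qed
qed (simp add: assms)

lemma annihilate_left: "annihilate x \<psi> S = annihilate x1 \<psi> S - annihilate x2 \<psi> S"
proof (induction S arbitrary: \<psi>)
  case (Cons y S)
  then show ?case
    by (simp only: annihilate.simps left left_diff_distrib right_diff_distrib)
qed simp

lemma splits_vacuum: "splits x x1 x2 vacuum"
  by (simp add: splits_def vacuum_def)

lemma moment_splits: "moment (u @ x # v) = moment (u @ x1 # v) - moment (u @ x2 # v)"
proof -
  define \<psi> where "\<psi> = apply_word (rev u) vacuum"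
  have \<psi>: "splits x x1 x2 \<psi>"
    unfolding \<psi>_def by (intro apply_word_splits splits_vacuum)
  have "field_op x \<psi> S = 1 * field_op x1 \<psi> S + (- 1) * field_op x2 \<psi> S" for S
    using spec[OF spec[OF \<psi>[unfolded splits_def], of "[]"], of S]
    by (simp add: field_op_def annihilate_left)
  then have "field_op x \<psi> = (\<lambda>S. 1 * field_op x1 \<psi> S + (- 1) * field_op x2 \<psi> S)"
    by (intro ext)
  then have "apply_word (rev v) (field_op x \<psi>) [] =
      apply_word (rev v) (\<lambda>S. 1 * field_op x1 \<psi> S + (- 1) * field_op x2 \<psi> S) []"
    by (simp only:)
  then show ?thesis
    by (simp only: apply_word_linear) (simp add: moment_def \<psi>_def apply_word_append)
qed

end

text \<open>Here \<open>n\<close> fields with label \<open>a\<close> act on the tensor \<open>a^j \<otimes> S\<close>, and none of them is contracted with another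
one or with one of the \<open>j\<close> leading factors. The creation of a factor is recorded in \<open>j\<close>, so that
later fields cannot remove it. Up to this bookkeeping it is the \<open>n\<close>-th Wick power of the field.\<close>
fun wick :: "'a \<Rightarrow> nat \<Rightarrow> ('a list \<Rightarrow> real) \<Rightarrow> nat \<Rightarrow> 'a list \<Rightarrow> real" where
  "wick a 0 \<psi> j S = \<psi> (replicate j a @ S)"
| "wick a (Suc n) \<psi> j S = wick a n \<psi> (Suc j) S + q ^ j * annihilate a (wick a n \<psi> j) S"

lemma q_int_Suc: "q_int q (Suc n) = q_int q n + q ^ n"
  by (simp add: q_int_def)

lemma q_int_Suc': "q_int q (Suc n) = 1 + q * q_int q n"
  by (simp add: q_int_def sum.lessThan_Suc_shift sum_distrib_left del: sum.lessThan_Suc)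

lemma annihilate_replicate:
  "annihilate a \<psi> (replicate j a @ S) =
     q_int q j * c a a * \<psi> (replicate (j - 1) a @ S) + q ^ j * annihilate a (\<lambda>T. \<psi> (replicate j a @ T)) S"
proof (induction j arbitrary: \<psi>)
  case (Suc j)
  have shift: "q_int q j * c a a * \<psi> (a # replicate (j - 1) a @ S) =
      q_int q j * c a a * \<psi> (replicate j a @ S)"
    by (cases j) (auto simp: q_int_def)
  have "annihilate a \<psi> (replicate (Suc j) a @ S) = c a a * \<psi> (replicate j a @ S) +
      q * (q_int q j * c a a * \<psi> (a # replicate (j - 1) a @ S) +
        q ^ j * annihilate a (\<lambda>T. \<psi> (a # replicate j a @ T)) S)"
    by (simp add: Suc[of "\<lambda>T. \<psi> (a # T)"])
  then show ?case
    unfolding shift by (simp add: q_int_Suc' algebra_simps)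
qed (simp add: q_int_def)

text \<open>One more field acts after the Wick power (on functionals, it is applied first). Either it is
not contracted with a factor \<open>a\<close>, which gives the next Wick power; or it is contracted with one of
the \<open>n\<close> fields of the power, and the number of fields passed ranges over \<open>0..n-1\<close>; or with one of the
\<open>j\<close> old factors, after passing all \<open>n\<close> fields. For \<open>j = 0\<close> this is the three-term recurrence of the
\<open>q\<close>-Hermite polynomials. General \<open>j\<close> is what the induction needs.\<close>
lemma wick_field_op:
  "wick a n (field_op a \<psi>) j S =
     wick a (Suc n) \<psi> j S + q_int q n * c a a * wick a (n - 1) \<psi> j S
     + q ^ n * q_int q j * c a a * wick a n \<psi> (j - 1) S"
proof (induction n arbitrary: j S)
  case 0
  show ?case
    by (simp add: field_op_def annihilate_replicate wick.simps(1)[abs_def]) (simp add: q_int_def)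
next
  case (Suc n)
  have ext: "wick a n (field_op a \<psi>) j =
      (\<lambda>S. 1 * (1 * wick a (Suc n) \<psi> j S + (q_int q n * c a a) * wick a (n - 1) \<psi> j S)
     + (q ^ n * q_int q j * c a a) * wick a n \<psi> (j - 1) S)"
    by (intro ext) (simp add: Suc)
  have shift: "q_int q n * (wick a (n - 1) \<psi> (Suc j) S + q ^ j * annihilate a (wick a (n - 1) \<psi> j) S)
      = q_int q n * wick a n \<psi> j S"
    by (cases n) (simp_all add: q_int_def)
  have shift': "q ^ Suc n * q_int q j * wick a (Suc n) \<psi> (j - 1) S =
      q ^ Suc n * q_int q j * wick a n \<psi> j S
      + q ^ n * q_int q j * q ^ j * annihilate a (wick a n \<psi> (j - 1)) S"
    by (cases j) (simp_all add: q_int_def algebra_simps)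
  have int: "q_int q n + q ^ n * q_int q (Suc j) - q ^ Suc n * q_int q j = q_int q (Suc n)"
    unfolding q_int_Suc'[of j] q_int_Suc[of n] by (simp add: algebra_simps)
  have "wick a (Suc n) (field_op a \<psi>) j S =
      wick a (Suc n) \<psi> (Suc j) S + q_int q n * c a a * wick a (n - 1) \<psi> (Suc j) S
     + q ^ n * q_int q (Suc j) * c a a * wick a n \<psi> j S
     + q ^ j * (annihilate a (wick a (Suc n) \<psi> j) S + q_int q n * c a a * annihilate a (wick a (n - 1) \<psi> j) S
     + q ^ n * q_int q j * c a a * annihilate a (wick a n \<psi> (j - 1)) S)"
    unfolding wick.simps(2)[of a n "field_op a \<psi>"] ext annihilate_linear
    by (simp only: Suc.IH) (simp del: wick.simps)
  also have "\<dots> = wick a (Suc (Suc n)) \<psi> j S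
     + c a a * (q_int q n * (wick a (n - 1) \<psi> (Suc j) S + q ^ j * annihilate a (wick a (n - 1) \<psi> j) S)
       + q ^ n * q_int q (Suc j) * wick a n \<psi> j S
       + q ^ n * q_int q j * q ^ j * annihilate a (wick a n \<psi> (j - 1)) S)"
    unfolding wick.simps(2)[of a "Suc n"] by (simp only: algebra_simps)
  also have "\<dots> = wick a (Suc (Suc n)) \<psi> j S
     + c a a * ((q_int q n + q ^ n * q_int q (Suc j) - q ^ Suc n * q_int q j) * wick a n \<psi> j S
       + q ^ Suc n * q_int q j * wick a (Suc n) \<psi> (j - 1) S)"
    unfolding shift shift' by (simp only: algebra_simps)
  finally show ?case
    unfolding int by (simp add: algebra_simps)
qed

lemma annihilate_past_marked:
  assumes "c d a = 0" "\<And>y. y \<in> set S \<Longrightarrow> c d y = 0"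
  shows "annihilate d \<phi> (replicate j a @ d # S) = c d d * q ^ j * \<phi> (replicate j a @ S)"
  using assms(1)
proof (induction j arbitrary: \<phi>)
  case 0
  show ?case using assms by (simp add: annihilate_orthogonal)
next
  case (Suc j)
  then show ?case by (simp add: algebra_simps)
qed

text \<open>When the field \<open>d\<close> removes the factor \<open>d\<close>, it passes every factor \<open>a\<close> created above it; and every field
\<open>a\<close> that was contracted with an entry of \<open>S\<close> has passed \<open>d\<close>. So each of the \<open>n\<close> fields contributes
one factor \<open>q\<close>.\<close>
lemma wick_marked:
  assumes d: "c d a = 0" "c a d = 0" "kills d \<phi>"
    and S: "\<And>y. y \<in> set S \<Longrightarrow> c d y = 0"
  shows "wick a n (field_op d \<phi>) j (d # S) = c d d * q ^ (n + j) * wick a n \<phi> j S"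
  using S
proof (induction n arbitrary: j S)
  case 0
  have "\<phi> (d # replicate j a @ d # S) = 0"
    using d(3) by (simp add: kills_def)
  then show ?case
    using 0 d by (simp add: field_op_def annihilate_past_marked)
next
  case (Suc n)
  have "annihilate a (\<lambda>T. wick a n (field_op d \<phi>) j (d # T)) S =
      annihilate a (\<lambda>T. c d d * q ^ (n + j) * wick a n \<phi> j T) S"
    using Suc by (intro annihilate_cong[of _ "{y. c d y = 0}"]) auto
  then show ?case
    using Suc d by (simp add: annihilate_scale algebra_simps)
qed

lemma annihilate_sum_nth:
  "annihilate x \<psi> S = (\<Sum>k<length S. q ^ k * c x (S ! k) * \<psi> (take k S @ drop (Suc k) S))"
proof (induction S arbitrary: \<psi>)
  case (Cons y S)
  show ?case
    by (simp add: Cons sum.lessThan_Suc_shift sum_distrib_left algebra_simps del: sum.lessThan_Suc)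
qed simp

end

text \<open>Each contraction uses up two labels, so a factor \<open>r\<^sup>2\<close> in the covariance amounts to a factor \<open>r\<close> for
each label. The case \<open>r = 1\<close> is a change of labels.\<close>
lemma apply_word_map:
  assumes c: "\<And>i j. c (g i) (g j) = r\<^sup>2 * cc i j"
  shows "fock.apply_word q c (map g w) vacuum (map g S) =
     r ^ (length w + length S) * fock.apply_word q cc w vacuum S"
proof -
  have annihilate: "fock.annihilate q c (g x) \<psi> (map g S) = r ^ Suc m * fock.annihilate q cc x \<phi> S"
    if "\<And>T. Suc (length T) = length S \<Longrightarrow> r * \<psi> (map g T) = r ^ m * \<phi> T" for m x S \<psi> \<phi>
    using that
  proof (induction S arbitrary: \<psi> \<phi>)
    case Nil
    show ?case by (simp add: fock.annihilate.simps)
  next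
    case (Cons y S)
    have "r\<^sup>2 * \<psi> (map g S) = r ^ Suc m * \<phi> S"
      using Cons.prems[of S] by (simp add: power2_eq_square)
    moreover have "fock.annihilate q c (g x) (\<lambda>T. \<psi> (g y # T)) (map g S) =
        r ^ Suc m * fock.annihilate q cc x (\<lambda>T. \<phi> (y # T)) S"
      using Cons.prems[of "y # _"] by (intro Cons.IH) simp
    ultimately show ?case
      by (simp add: fock.annihilate.simps c algebra_simps)
  qed
  show ?thesis
  proof (induction w arbitrary: S)
    case Nil
    show ?case by (simp add: vacuum_def fock.apply_word.simps(1))
  next
    case (Cons x w)
    have "fock.annihilate q c (g x) (fock.apply_word q c (map g w) vacuum) (map g S) =
        r ^ Suc (length w + length S) * fock.annihilate q cc x (fock.apply_word q cc w vacuum) S"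
    proof (rule annihilate)
      fix T :: "'a list" assume "Suc (length T) = length S"
      then show "r * fock.apply_word q c (map g w) vacuum (map g T) =
          r ^ (length w + length S) * fock.apply_word q cc w vacuum T"
        using Cons[of T] by (simp flip: \<open>Suc (length T) = length S\<close>)
    qed
    then show ?case
      using Cons[of "x # S"] by (simp add: fock.apply_word.simps(2) fock.field_op_def algebra_simps)
  qed
qed

section \<open>Pair partitions as vacuum expectations\<close>

lemma pair_partitions_insert:
  assumes "P \<in> pair_partitions A" "x \<notin> A" "y \<notin> A" "x \<noteq> y"
  shows "insert {x, y} P \<in> pair_partitions (insert x (insert y A))" "{x, y} \<notin> P"
proof -
  have "\<Union>P = A" "disjoint P" "{} \<notin> P" and card: "\<And>B. B \<in> P \<Longrightarrow> card B = 2"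
    using assms(1) by (auto simp: pair_partitions_def partition_on_def)
  then show "{x, y} \<notin> P"
    using assms by auto
  have "{x, y} \<inter> B = {}" if "B \<in> P" for B
    using that assms \<open>\<Union>P = A\<close> by auto
  then have "disjoint (insert {x, y} P)"
    using \<open>disjoint P\<close> by (auto simp: disjoint_def)
  then show "insert {x, y} P \<in> pair_partitions (insert x (insert y A))"
    using \<open>\<Union>P = A\<close> \<open>{} \<notin> P\<close> card assms(4) by (auto simp: pair_partitions_def partition_on_def)
qed

lemma pair_partitions_remove:
  assumes "P \<in> pair_partitions A" "B \<in> P"
  shows "P - {B} \<in> pair_partitions (A - B)"
proof -
  have P: "\<Union>P = A" "disjoint P" "{} \<notin> P"
    using assms(1) by (auto simp: pair_partitions_def partition_on_def)
  have "C \<inter> B = {}" if "C \<in> P" "C \<noteq> B" for C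
    using that assms(2) P(2) by (auto simp: disjoint_def)
  then have "\<Union>(P - {B}) = A - B"
    using P(1) by blast
  moreover have "disjoint (P - {B})"
    using P(2) by (auto simp: disjoint_def)
  ultimately show ?thesis
    using P assms(1) by (auto simp: pair_partitions_def partition_on_def)
qed

lemma pair_partitionsD:
  assumes "P \<in> pair_partitions A"
  shows "B \<in> P \<Longrightarrow> B \<subseteq> A"
    and "B \<in> P \<Longrightarrow> C \<in> P \<Longrightarrow> x \<in> B \<Longrightarrow> x \<in> C \<Longrightarrow> B = C"
    and "x \<in> A \<Longrightarrow> \<exists>y. y \<noteq> x \<and> y \<in> A \<and> {x, y} \<in> P"
proof -
  show "B \<in> P \<Longrightarrow> B \<subseteq> A" for B
    using assms by (auto simp: pair_partitions_def partition_on_def)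
  show "B \<in> P \<Longrightarrow> C \<in> P \<Longrightarrow> x \<in> B \<Longrightarrow> x \<in> C \<Longrightarrow> B = C"
    using assms by (auto simp: pair_partitions_def partition_on_def disjoint_def)
  assume "x \<in> A"
  then obtain B where B: "B \<in> P" "x \<in> B" "card B = 2"
    using assms by (auto simp: pair_partitions_def partition_on_def)
  then obtain y where "B = {x, y}" "y \<noteq> x"
    by (auto simp: card_2_iff)
  then show "\<exists>y. y \<noteq> x \<and> y \<in> A \<and> {x, y} \<in> P"
    using B assms by (auto simp: pair_partitions_def partition_on_def)
qed

lemma finite_pair_partitions: "finite A \<Longrightarrow> finite (pair_partitions A)"
  by (rule finite_subset[of _ "Pow (Pow A)"])
    (auto simp: pair_partitions_def partition_on_def)

text \<open>When a word is read from its last letter, \<open>S\<close> lists the positions read so far whose partner is still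
to come. Those are the entries of the current tensor.\<close>
definition open_pairings :: "nat \<Rightarrow> nat list \<Rightarrow> nat set set set" where
  "open_pairings m S = {P \<in> pair_partitions ({1..m} \<union> set S). \<forall>B\<in>P. \<not> B \<subseteq> set S}"

lemma open_pairings_0: "open_pairings 0 S = (if S = [] then {{}} else {})"
proof (cases "S = []")
  case True
  then show ?thesis
    by (auto simp: open_pairings_def pair_partitions_def partition_on_def)
next
  case False
  have False if "P \<in> open_pairings 0 S" for P
  proof -
    have "P \<in> pair_partitions (set S)" "\<And>B. B \<in> P \<Longrightarrow> \<not> B \<subseteq> set S"
      using that by (auto simp: open_pairings_def)
    moreover obtain x where "x \<in> set S"
      using False by (cases S) auto
    ultimately show False
      using pair_partitionsD(1,3) by metis
  qed
  with False show ?thesis by auto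
qed

lemma set_remove_nth:
  assumes "distinct S" "k < length S"
  shows "set (take k S @ drop (Suc k) S) = set S - {S ! k}"
proof -
  have "S = take k S @ S ! k # drop (Suc k) S"
    using assms(2) by (rule id_take_nth_drop)
  moreover from this have "distinct (take k S @ S ! k # drop (Suc k) S)"
    using assms(1) by simp
  ultimately show ?thesis
    by (metis Diff_insert_absorb Un_insert_right distinct.simps(2) distinct_append
        distinct_insert in_set_conv_decomp list.simps(15) not_distinct_conv_prefix set_append UnE
        disjoint_iff list.set_intros(1))
qed

text \<open>The partner of position \<open>m + 1\<close> either is smaller, and then \<open>m + 1\<close> becomes open (creation), or it is one
of the open positions, which is then closed (annihilation).\<close>
lemma open_pairings_Suc:
  assumes S: "distinct S" "\<And>s. s \<in> set S \<Longrightarrow> Suc m < s"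
  shows "open_pairings (Suc m) S = open_pairings m (Suc m # S) \<union>
     (\<Union>k<length S. insert {Suc m, S ! k} ` open_pairings m (take k S @ drop (Suc k) S))"
    (is "?L = ?R1 \<union> ?R2")
proof (intro equalityI subsetI)
  fix P assume P: "P \<in> ?L"
  then have pp: "P \<in> pair_partitions ({1..Suc m} \<union> set S)" and op: "\<And>B. B \<in> P \<Longrightarrow> \<not> B \<subseteq> set S"
    by (auto simp: open_pairings_def)
  obtain j where j: "j \<noteq> Suc m" "j \<in> {1..Suc m} \<union> set S" "{Suc m, j} \<in> P"
    using pair_partitionsD(3)[OF pp, of "Suc m"] by auto
  show "P \<in> ?R1 \<union> ?R2"
  proof (cases "j \<in> set S")
    case True
    then obtain k where k: "k < length S" "S ! k = j"
      by (auto simp: in_set_conv_nth)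
    have "{1..Suc m} \<union> set S - {Suc m, j} = {1..m} \<union> (set S - {j})"
      using S(2) True by auto force+
    moreover have "\<not> B \<subseteq> set S - {j}" if "B \<in> P" for B
      using op[OF that] by auto
    ultimately have "P - {{Suc m, j}} \<in> open_pairings m (take k S @ drop (Suc k) S)"
      using pair_partitions_remove[OF pp j(3)] set_remove_nth[OF S(1) k(1)] k(2)
      by (simp add: open_pairings_def)
    moreover have "P = insert {Suc m, S ! k} (P - {{Suc m, j}})"
      using j(3) k by auto
    ultimately show ?thesis
      using k by blast
  next
    case False
    have "\<not> B \<subseteq> insert (Suc m) (set S)" if "B \<in> P" for B
    proof
      assume B: "B \<subseteq> insert (Suc m) (set S)"
      with op[OF that] have "Suc m \<in> B" by auto
      then have "B = {Suc m, j}"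
        using pair_partitionsD(2)[OF pp that j(3)] by simp
      with B False j(1) show False by auto
    qed
    moreover have "{1..m} \<union> insert (Suc m) (set S) = {1..Suc m} \<union> set S"
      by auto
    ultimately show ?thesis
      using pp by (simp add: open_pairings_def)
  qed
next
  fix P assume "P \<in> ?R1 \<union> ?R2"
  then consider "P \<in> ?R1" | k P' where "k < length S" "P = insert {Suc m, S ! k} P'"
    "P' \<in> open_pairings m (take k S @ drop (Suc k) S)"
    by blast
  then show "P \<in> ?L"
  proof cases
    case 1
    moreover have "{1..m} \<union> insert (Suc m) (set S) = {1..Suc m} \<union> set S"
      by auto
    ultimately show ?thesis
      by (auto simp: open_pairings_def)
  next
    case (2 k P')
    define j where "j = S ! k"
    have j: "j \<in> set S" "Suc m < j"
      using 2(1) S(2) by (auto simp: j_def)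
    have P': "P' \<in> pair_partitions ({1..m} \<union> (set S - {j}))"
      and op: "\<And>B. B \<in> P' \<Longrightarrow> \<not> B \<subseteq> set S - {j}"
      using 2 set_remove_nth[OF S(1) 2(1)] by (auto simp: open_pairings_def j_def)
    have "P \<in> pair_partitions (insert (Suc m) (insert j ({1..m} \<union> (set S - {j}))))"
      unfolding 2(2) j_def[symmetric]
      using P' j S(2)[of "Suc m"] by (intro pair_partitions_insert) auto
    moreover have "insert (Suc m) (insert j ({1..m} \<union> (set S - {j}))) = {1..Suc m} \<union> set S"
      using j by auto
    moreover have "\<not> B \<subseteq> set S" if "B \<in> P'" for B
      using op[OF that] pair_partitionsD(1)[OF P' that] j by auto
    moreover have "Suc m \<notin> set S"
      using S(2) by blast
    ultimately show ?thesis
      using 2(2) by (auto simp: open_pairings_def)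
  qed
qed

text \<open>The first \<open>k\<close> entries of \<open>S\<close> lie between \<open>m + 1\<close> and \<open>S ! k\<close>, and they are paired with positions up
to \<open>m\<close> since no two entries of \<open>S\<close> are paired. These \<open>k\<close> pairs cross \<open>{m + 1, S ! k}\<close>, and no others do.\<close>
lemma crossings_insert:
  assumes S: "sorted_wrt (<) S" "\<And>s. s \<in> set S \<Longrightarrow> Suc m < s" and k: "k < length S"
    and P: "P \<in> open_pairings m (take k S @ drop (Suc k) S)"
  shows "crossings (insert {Suc m, S ! k} P) = k + crossings P"
proof -
  define b where "b = S ! k"
  have dist: "distinct S"
    using S(1) strict_sorted_iff by blast
  have b: "b \<in> set S" "Suc m < b"
    using k S(2) by (auto simp: b_def)
  have pp: "P \<in> pair_partitions ({1..m} \<union> (set S - {b}))"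
    and op: "\<And>B. B \<in> P \<Longrightarrow> \<not> B \<subseteq> set S - {b}"
    using P set_remove_nth[OF dist k] by (auto simp: open_pairings_def b_def)
  have notin: "Suc m \<notin> B" "b \<notin> B" if "B \<in> P" for B
    using pair_partitionsD(1)[OF pp that] b S(2)[of "Suc m"] by auto
  have less: "S ! k' < b" if "k' < k" for k'
    using that k S(1) by (simp add: b_def sorted_wrt_nth_less)
  have "\<exists>i. i < Suc m \<and> {i, S ! k'} \<in> P" if k': "k' < k" for k'
  proof -
    have x: "S ! k' \<in> set S - {b}"
      using k' k less[OF k'] by auto
    then obtain i where i: "i \<in> {1..m} \<union> (set S - {b})" "{S ! k', i} \<in> P"
      using pair_partitionsD(3)[OF pp] by blast
    then have "i < Suc m"
      using op[OF i(2)] x by auto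
    then show ?thesis
      using i(2) by (auto simp: insert_commute)
  qed
  then obtain p where p: "\<And>k'. k' < k \<Longrightarrow> p k' < Suc m" "\<And>k'. k' < k \<Longrightarrow> {p k', S ! k'} \<in> P"
    by metis
  \<comment> \<open>the crossing of \<open>{m + 1, S ! k}\<close> with the pair of \<open>S ! k'\<close>\<close>
  define g where "g k' = (p k', Suc m, S ! k', b)" for k'
  define C where "C Q = {(i, j, k, l). i < j \<and> j < k \<and> k < l \<and> {i, k} \<in> Q \<and> {j, l} \<in> Q}"
    for Q :: "nat set set"
  have "C (insert {Suc m, b} P) = C P \<union> g ` {..<k}"
  proof (intro equalityI subsetI)
    fix z assume "z \<in> C (insert {Suc m, b} P)"
    then obtain i j x l where z: "z = (i, j, x, l)" "i < j" "j < x" "x < l"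
      and ix: "{i, x} = {Suc m, b} \<or> {i, x} \<in> P" and jl: "{j, l} = {Suc m, b} \<or> {j, l} \<in> P"
      by (auto simp: C_def)
    have "{i, x} \<in> P"
    proof (rule ccontr)
      assume "{i, x} \<notin> P"
      then have "{i, x} = {Suc m, b}"
        using ix by blast
      then have "i = Suc m" "x = b"
        using z b by (auto simp: doubleton_eq_iff)
      then have jlP: "{j, l} \<in> P"
        using jl z by (auto simp: doubleton_eq_iff)
      then have "{j, l} \<subseteq> set S - {b}"
        using pair_partitionsD(1)[OF pp jlP] z \<open>i = Suc m\<close> by auto
      then show False
        using op[OF jlP] by blast
    qed
    show "z \<in> C P \<union> g ` {..<k}"
    proof (cases "{j, l} \<in> P")
      case True
      then show ?thesis
        using \<open>{i, x} \<in> P\<close> z by (simp add: C_def)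
    next
      case False
      then have "{j, l} = {Suc m, b}"
        using jl by blast
      then have jl: "j = Suc m" "l = b"
        using z b by (auto simp: doubleton_eq_iff)
      then have "x \<in> set S"
        using pair_partitionsD(1)[OF pp \<open>{i, x} \<in> P\<close>] z by auto
      then obtain k' where k': "k' < length S" "S ! k' = x"
        by (auto simp: in_set_conv_nth)
      have "k' < k"
      proof (rule ccontr)
        assume "\<not> k' < k"
        then have "b \<le> x"
          using k' S(1) sorted_wrt_nth_less[OF S(1), of k k'] by (cases "k = k'") (auto simp: b_def)
        then show False
          using z jl by simp
      qed
      have "{i, x} = {p k', x}"
        using pair_partitionsD(2)[OF pp \<open>{i, x} \<in> P\<close> p(2)[OF \<open>k' < k\<close>], of x] k' by simp
      then have "i = p k'"
        using z by (auto simp: doubleton_eq_iff)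
      then show ?thesis
        using \<open>k' < k\<close> k' jl z(1) by (auto simp: g_def)
    qed
  next
    fix z assume "z \<in> C P \<union> g ` {..<k}"
    then show "z \<in> C (insert {Suc m, b} P)"
    proof
      assume "z \<in> g ` {..<k}"
      then obtain k' where k': "k' < k" "z = g k'" by auto
      moreover have "Suc m < S ! k'"
        using S(2) k k'(1) by simp
      ultimately show ?thesis
        using p[OF k'(1)] less[OF k'(1)] by (auto simp: C_def g_def)
    qed (auto simp: C_def)
  qed
  moreover have "C P \<inter> g ` {..<k} = {}"
    using notin by (auto simp: C_def g_def)
  moreover have "finite (C P)"
  proof (rule finite_subset)
    have "\<Union>P \<subseteq> {1..m} \<union> set S"
      using pair_partitionsD(1)[OF pp] by blast
    then show "C P \<subseteq> ({1..m} \<union> set S) \<times> ({1..m} \<union> set S) \<times> ({1..m} \<union> set S) \<times> ({1..m} \<union> set S)"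
      unfolding C_def by blast
  qed auto
  moreover have "card (g ` {..<k}) = k"
  proof -
    have "inj_on g {..<k}"
      using dist k by (auto simp: g_def inj_on_def nth_eq_iff_index_eq)
    then show ?thesis
      by (simp add: card_image)
  qed
  ultimately show ?thesis
    unfolding crossings_def C_def[symmetric] b_def[symmetric]
    by (simp add: card_Un_disjoint)
qed

theorem sum_open_pairings:
  fixes w :: "nat set \<Rightarrow> real"
  assumes "sorted_wrt (<) S" "\<And>s. s \<in> set S \<Longrightarrow> m < s"
  shows "(\<Sum>P\<in>open_pairings m S. q ^ crossings P * (\<Prod>B\<in>P. w B)) =
     fock.apply_word q (\<lambda>i j. w {i, j}) (rev [1..<Suc m]) vacuum S"
  using assms
proof (induction m arbitrary: S)
  case 0
  have "crossings {} = 0"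
    unfolding crossings_def by (simp add: case_prod_unfold)
  then show ?case
    by (simp add: open_pairings_0 fock.apply_word.simps vacuum_def)
next
  case (Suc m)
  interpret fock q "\<lambda>i j. w {i, j}" .
  define F where "F P = q ^ crossings P * (\<Prod>B\<in>P. w B)" for P
  let ?rem = "\<lambda>k. take k S @ drop (Suc k) S"
  define N where "N k = insert {Suc m, S ! k} ` open_pairings m (?rem k)" for k
  have dist: "distinct S"
    using Suc.prems(1) strict_sorted_iff by blast
  have fin: "finite (open_pairings m T)" for m T
    unfolding open_pairings_def by (intro finite_subset[OF _ finite_pair_partitions]) auto
  have notin: "Suc m \<notin> B" "S ! k \<notin> B"
    if k: "k < length S" and P: "P \<in> open_pairings m (?rem k)" and "B \<in> P" for P B k
  proof -
    have pp: "P \<in> pair_partitions ({1..m} \<union> (set S - {S ! k}))"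
      using P set_remove_nth[OF dist k] by (simp add: open_pairings_def)
    show "Suc m \<notin> B" "S ! k \<notin> B"
      using pair_partitionsD(1)[OF pp \<open>B \<in> P\<close>] Suc.prems(2)[of "Suc m"]
        Suc.prems(2)[OF nth_mem[OF k]] by auto
  qed
  have sumN: "sum F (N k) =
      q ^ k * w {Suc m, S ! k} * apply_word (rev [1..<Suc m]) vacuum (?rem k)" if k: "k < length S" for k
  proof -
    have "inj_on (insert {Suc m, S ! k}) (open_pairings m (?rem k))"
    proof (rule inj_onI)
      fix P P' assume P: "P \<in> open_pairings m (?rem k)" "P' \<in> open_pairings m (?rem k)"
        "insert {Suc m, S ! k} P = insert {Suc m, S ! k} P'"
      then have "{Suc m, S ! k} \<notin> P" "{Suc m, S ! k} \<notin> P'"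
        using notin[OF k] by blast+
      then show "P = P'"
        using P(3) by (metis insert_ident)
    qed
    then have "sum F (N k) = (\<Sum>P\<in>open_pairings m (?rem k). F (insert {Suc m, S ! k} P))"
      unfolding N_def by (subst sum.reindex) auto
    also have "\<dots> = (\<Sum>P\<in>open_pairings m (?rem k). q ^ k * w {Suc m, S ! k} * F P)"
    proof (rule sum.cong)
      fix P assume P: "P \<in> open_pairings m (?rem k)"
      have "{Suc m, S ! k} \<notin> P"
        using notin[OF k P] by blast
      moreover have "finite P"
      proof (rule finite_elements)
        show "partition_on ({1..m} \<union> set (?rem k)) P"
          using P unfolding open_pairings_def pair_partitions_def by blast
      qed simp
      moreover have "crossings (insert {Suc m, S ! k} P) = k + crossings P"
        using Suc.prems k P by (intro crossings_insert) auto
      ultimately show "F (insert {Suc m, S ! k} P) = q ^ k * w {Suc m, S ! k} * F P"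
        by (simp add: F_def power_add algebra_simps)
    qed simp
    also have "\<dots> = q ^ k * w {Suc m, S ! k} * apply_word (rev [1..<Suc m]) vacuum (?rem k)"
    proof -
      have "sorted_wrt (<) (take k S @ S ! k # drop (Suc k) S)"
        using Suc.prems(1) by (subst (asm) id_take_nth_drop[OF k])
      then have "sorted_wrt (<) (?rem k)"
        by (auto simp: sorted_wrt_append)
      moreover have "m < s" if "s \<in> set (?rem k)" for s
        using that Suc.prems(2) set_remove_nth[OF dist k] by force
      ultimately show ?thesis
        using Suc.IH[of "?rem k"] by (simp add: F_def flip: sum_distrib_left)
    qed
    finally show ?thesis .
  qed
  have "sum F (open_pairings (Suc m) S) = sum F (open_pairings m (Suc m # S)) + sum F (\<Union>k<length S. N k)"
  proof -
    have "P \<notin> open_pairings m (Suc m # S)" if "P \<in> N k" "k < length S" for P k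
    proof -
      have "{Suc m, S ! k} \<in> P"
        using that(1) by (auto simp: N_def)
      moreover have "{Suc m, S ! k} \<subseteq> set (Suc m # S)"
        using that(2) by simp
      ultimately show ?thesis
        unfolding open_pairings_def by blast
    qed
    then have "open_pairings m (Suc m # S) \<inter> (\<Union>k<length S. N k) = {}"
      by blast
    moreover have "finite (\<Union>k<length S. N k)"
      using fin by (simp add: N_def)
    ultimately show ?thesis
      using fin unfolding open_pairings_Suc[OF dist Suc.prems(2), simplified] N_def
      by (intro sum.union_disjoint) simp_all
  qed
  also have "sum F (\<Union>k<length S. N k) = (\<Sum>k<length S. sum F (N k))"
  proof (rule sum.UNION_disjoint)
    show "\<forall>i\<in>{..<length S}. \<forall>j\<in>{..<length S}. i \<noteq> j \<longrightarrow> N i \<inter> N j = {}"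
    proof (intro ballI impI)
      fix i j assume ij: "i \<in> {..<length S}" "j \<in> {..<length S}" "i \<noteq> j"
      have False if P: "P \<in> N i" "P \<in> N j" for P
      proof -
        obtain P' where P': "P = insert {Suc m, S ! i} P'" "P' \<in> open_pairings m (?rem i)"
          using P(1) by (auto simp: N_def)
        have "{Suc m, S ! j} \<in> P"
          using P(2) by (auto simp: N_def)
        moreover have "{Suc m, S ! j} \<noteq> {Suc m, S ! i}"
          using ij dist by (auto simp: doubleton_eq_iff nth_eq_iff_index_eq)
        ultimately have "{Suc m, S ! j} \<in> P'"
          using P'(1) by auto
        then show False
          using notin(1)[OF _ P'(2)] ij by blast
      qed
      then show "N i \<inter> N j = {}" by blast
    qed
  qed (use fin in \<open>auto simp: N_def\<close>)
  also have "\<dots> = (\<Sum>k<length S. q ^ k * w {Suc m, S ! k} * apply_word (rev [1..<Suc m]) vacuum (?rem k))"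
    using sumN by (intro sum.cong) auto
  also have "\<dots> = annihilate (Suc m) (apply_word (rev [1..<Suc m]) vacuum) S"
    by (simp only: annihilate_sum_nth)
  also have "sum F (open_pairings m (Suc m # S)) = apply_word (rev [1..<Suc m]) vacuum (Suc m # S)"
    unfolding F_def using Suc.prems by (intro Suc.IH) force+
  also have "apply_word (rev [1..<Suc m]) vacuum (Suc m # S) + annihilate (Suc m) (apply_word (rev [1..<Suc m]) vacuum) S =
      apply_word (rev [1..<Suc (Suc m)]) vacuum S"
    by (simp add: field_op_def del: upt_Suc) (simp add: upt_Suc field_op_def)
  finally show ?case
    unfolding F_def .
qed

corollary sum_pair_partitions:
  fixes q :: real and c :: "'a \<Rightarrow> 'a \<Rightarrow> real"
  assumes "\<And>i j. w {i, j} = c (g i) (g j)"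
  shows "(\<Sum>P\<in>pair_partitions {1..n}. q ^ crossings P * (\<Prod>B\<in>P. w B)) =
     fock.moment q c (map g [1..<Suc n])"
proof -
  have "open_pairings n [] = pair_partitions {1..n}"
    by (auto simp: open_pairings_def pair_partitions_def partition_on_def)
  then have "(\<Sum>P\<in>pair_partitions {1..n}. q ^ crossings P * (\<Prod>B\<in>P. w B)) =
      fock.apply_word q (\<lambda>i j. w {i, j}) (rev [1..<Suc n]) vacuum []"
    using sum_open_pairings[of "[]" n q w] by simp
  also have "\<dots> = fock.apply_word q c (map g (rev [1..<Suc n])) vacuum (map g [])"
    by (subst apply_word_map[where r = 1 and cc = "\<lambda>i j. w {i, j}"]) (simp_all add: assms)
  finally show ?thesis
    by (simp add: fock.moment_def rev_map)
qed

section \<open>Bounded operators on a complex Hilbert space\<close>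

lemma cinner_eq_Complex: "cinner x y = Complex (x \<bullet> y) ((\<i> *\<^sub>C x) \<bullet> y)"
  by (simp add: complex_eq_iff inner_eq_Re_cinner cinner_scaleC_left)

lemma cinner_eq_norm: "cinner x x = complex_of_real ((norm x)\<^sup>2)"
proof -
  have "Im (cinner x x) = 0"
    using cinner_commute[of x x] by (metis add.inverse_neutral cnj.simps(2) equation_minus_iff neg_equal_zero)
  then show ?thesis
    by (simp add: complex_eq_iff power2_norm_eq_inner inner_eq_Re_cinner)
qed

text \<open>For complex-linear operators, adjoints can be checked with the real inner product, since that one
determines the complex one.\<close>
lemma is_adjointI:
  fixes A B :: "'h::complex_hilbert_space \<Rightarrow>\<^sub>L 'h"
  assumes "complex_linear_op A" "\<And>x y. A x \<bullet> y = x \<bullet> B y"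
  shows "is_adjoint A B"
  using assms by (metis is_adjoint_def complex_linear_op_def cinner_eq_Complex)

lemma is_adjoint_inner: "is_adjoint A B \<Longrightarrow> A x \<bullet> y = x \<bullet> B y"
  by (simp add: is_adjoint_def inner_eq_Re_cinner)

lemma is_adjoint_sym: "is_adjoint A B \<Longrightarrow> is_adjoint B A"
  unfolding is_adjoint_def by (metis cinner_commute)

lemma norm_adjoint_le: 
  assumes "is_adjoint A B" shows "norm A \<le> norm B"
proof (rule norm_blinfun_bound)
  fix x
  have "norm (A x) * norm (A x) = x \<bullet> B (A x)"
    using is_adjoint_inner[OF assms, of x "A x"] by (simp flip: power2_eq_square power2_norm_eq_inner)
  also have "\<dots> \<le> norm x * (norm B * norm (A x))"
    by (intro order_trans[OF norm_cauchy_schwarz] mult_left_mono norm_blinfun) simp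
  finally have "norm (A x) * norm (A x) \<le> (norm B * norm x) * norm (A x)"
    by (simp add: mult_ac)
  then show "norm (A x) \<le> norm B * norm x"
    by (cases "norm (A x) = 0") (auto simp: mult_le_cancel_right)
qed simp

lemma norm_adjoint: "is_adjoint A B \<Longrightarrow> norm A = norm B"
  by (metis norm_adjoint_le is_adjoint_sym order_antisym)

lemmas comp_add_left = bounded_bilinear.add_left[OF bounded_bilinear_blinfun_compose]
  and comp_add_right = bounded_bilinear.add_right[OF bounded_bilinear_blinfun_compose]
  and comp_diff_left = bounded_bilinear.diff_left[OF bounded_bilinear_blinfun_compose]
  and comp_diff_right = bounded_bilinear.diff_right[OF bounded_bilinear_blinfun_compose]
  and comp_scaleR_left = bounded_bilinear.scaleR_left[OF bounded_bilinear_blinfun_compose]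
  and comp_scaleR_right = bounded_bilinear.scaleR_right[OF bounded_bilinear_blinfun_compose]
  and comp_sum_left = bounded_bilinear.sum_left[OF bounded_bilinear_blinfun_compose]
  and comp_sum_right = bounded_bilinear.sum_right[OF bounded_bilinear_blinfun_compose]

lemma comp_assoc: "(A o\<^sub>L B) o\<^sub>L C = A o\<^sub>L (B o\<^sub>L C)"
  by (rule blinfun_eqI) simp

lemma comp_id [simp]: "A o\<^sub>L id_blinfun = A" "id_blinfun o\<^sub>L A = A"
  by (rule blinfun_eqI, simp)+

lemma scaleC_scaleR: "scaleC_op (complex_of_real r) A = r *\<^sub>R A"
  by (rule blinfun_eqI) (simp add: blinfun.scaleR_left scaleR_scaleC)

lemma scaleC_op_0 [simp]:
  fixes A :: "'a::complex_hilbert_space \<Rightarrow>\<^sub>L 'a"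
  shows "scaleC_op 0 A = 0" "scaleC_op c (0 :: 'a \<Rightarrow>\<^sub>L 'a) = 0"
proof -
  show "scaleC_op 0 A = 0"
    using scaleC_scaleR[of 0 A] by simp
  have "c *\<^sub>C (0::'a) = 0"
    using norm_scaleC[of c "0::'a"] by simp
  then show "scaleC_op c (0 :: 'a \<Rightarrow>\<^sub>L 'a) = 0"
    by (intro blinfun_eqI) simp
qed

lemma scaleC_op_1 [simp]: "scaleC_op 1 A = A"
  using scaleC_scaleR[of 1 A] by simp

lemma scaleC_op_add_right: "scaleC_op c (A + B) = scaleC_op c A + scaleC_op c B"
  by (rule blinfun_eqI) (simp add: blinfun.add_left scaleC_add_right)

lemma scaleC_op_add_left: "scaleC_op (c + d) A = scaleC_op c A + scaleC_op d A"
  by (rule blinfun_eqI) (simp add: blinfun.add_left scaleC_add_left)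

lemma scaleC_op_scaleC: "scaleC_op c (scaleC_op d A) = scaleC_op (c * d) A"
  by (rule blinfun_eqI) (simp add: scaleC_scaleC)

lemma scaleC_op_sum: "scaleC_op c (\<Sum>i\<in>I. A i) = (\<Sum>i\<in>I. scaleC_op c (A i))"
  by (induction I rule: infinite_finite_induct) (simp_all add: scaleC_op_add_right)

lemma norm_scaleC_op: "norm (scaleC_op c A) \<le> cmod c * norm A"
proof (rule norm_blinfun_bound)
  show "norm (scaleC_op c A x) \<le> cmod c * norm A * norm x" for x
    using mult_left_mono[OF norm_blinfun[of A x], of "cmod c"]
    by (simp add: norm_scaleC mult_ac)
qed simp

lemma scaleC_comp_left: "scaleC_op c A o\<^sub>L B = scaleC_op c (A o\<^sub>L B)"
  by (rule blinfun_eqI) simp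

lemma scaleC_comp_right: "complex_linear_op A \<Longrightarrow> A o\<^sub>L scaleC_op c B = scaleC_op c (A o\<^sub>L B)"
  by (rule blinfun_eqI) (simp add: complex_linear_op_def)

lemma complex_linear_id [simp]: "complex_linear_op id_blinfun"
  and complex_linear_comp: "complex_linear_op A \<Longrightarrow> complex_linear_op B \<Longrightarrow> complex_linear_op (A o\<^sub>L B)"
  by (simp_all add: complex_linear_op_def)

lemma complex_linear_add: "complex_linear_op A \<Longrightarrow> complex_linear_op B \<Longrightarrow> complex_linear_op (A + B)"
  by (simp add: complex_linear_op_def blinfun.add_left scaleC_add_right)

lemma complex_linear_scaleC: "complex_linear_op A \<Longrightarrow> complex_linear_op (scaleC_op c A)"
  by (simp add: complex_linear_op_def scaleC_scaleC mult.commute)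

lemma closed_complex_linear: "closed {A. complex_linear_op A}"
proof -
  have "bounded_linear (\<lambda>x::'a. c *\<^sub>C x)" for c :: complex
    using blinfun.bounded_linear_right[of "scaleC_op c id_blinfun"] by simp
  then show ?thesis
    unfolding complex_linear_op_def Collect_all_eq
    by (intro closed_INT ballI closed_Collect_eq continuous_intros
        bounded_linear.continuous_on[OF \<open>bounded_linear ((*\<^sub>C) _)\<close>])
qed

lemma commutant_id: "id_blinfun \<in> commutant C"
  by (simp add: commutant_def)

lemma commutant_comp: "A \<in> commutant C \<Longrightarrow> B \<in> commutant C \<Longrightarrow> A o\<^sub>L B \<in> commutant C"
  unfolding commutant_def
proof (intro CollectI conjI ballI)
  fix D
  assume A: "A \<in> {A. complex_linear_op A \<and> (\<forall>B\<in>C. A o\<^sub>L B = B o\<^sub>L A)}"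
    and B: "B \<in> {A. complex_linear_op A \<and> (\<forall>B\<in>C. A o\<^sub>L B = B o\<^sub>L A)}" and "D \<in> C"
  have "(A o\<^sub>L B) o\<^sub>L D = (A o\<^sub>L D) o\<^sub>L B"
    using B \<open>D \<in> C\<close> by (simp add: comp_assoc)
  also have "\<dots> = D o\<^sub>L (A o\<^sub>L B)"
    using A \<open>D \<in> C\<close> by (simp add: comp_assoc)
  finally show "(A o\<^sub>L B) o\<^sub>L D = D o\<^sub>L (A o\<^sub>L B)" .
qed (simp add: complex_linear_comp)

lemma commutant_add: "A \<in> commutant C \<Longrightarrow> B \<in> commutant C \<Longrightarrow> A + B \<in> commutant C"
  by (simp add: commutant_def complex_linear_add comp_add_left comp_add_right)

lemma commutant_scaleC:
  "A \<in> commutant C \<Longrightarrow> \<forall>B\<in>C. complex_linear_op B \<Longrightarrow> scaleC_op c A \<in> commutant C"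
  by (simp add: commutant_def complex_linear_scaleC scaleC_comp_left scaleC_comp_right)

lemma closed_commutant: "closed (commutant C)"
proof -
  have "commutant C = {A. complex_linear_op A} \<inter> (\<Inter>B\<in>C. {A. A o\<^sub>L B = B o\<^sub>L A})"
    by (auto simp: commutant_def)
  moreover have "closed {A. A o\<^sub>L B = B o\<^sub>L A}" for B :: "'a \<Rightarrow>\<^sub>L 'a"
    by (intro closed_Collect_eq continuous_intros)
  ultimately show ?thesis
    by (simp add: closed_complex_linear closed_INT closed_Int)
qed

lemma is_adjoint_id: "is_adjoint id_blinfun id_blinfun"
  by (simp add: is_adjoint_def)

lemma is_adjoint_comp: "is_adjoint A A' \<Longrightarrow> is_adjoint B B' \<Longrightarrow> is_adjoint (A o\<^sub>L B) (B' o\<^sub>L A')"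
  by (simp add: is_adjoint_def)

lemma cinner_add_right: "cinner x (y + z) = cinner x y + cinner x z"
  by (metis cinner_add_left cinner_commute complex_cnj_add)

lemma is_adjoint_add: "is_adjoint A A' \<Longrightarrow> is_adjoint B B' \<Longrightarrow> is_adjoint (A + B) (A' + B')"
  by (simp add: is_adjoint_def blinfun.add_left cinner_add_left cinner_add_right)

lemma is_adjoint_scaleC: "is_adjoint A A' \<Longrightarrow> is_adjoint (scaleC_op c A) (scaleC_op (cnj c) A')"
  by (simp add: is_adjoint_def cinner_scaleC_left cinner_scaleC_right)

lemma positive_adjoint_comp:
  assumes "is_adjoint A B" "complex_linear_op A" "complex_linear_op B"
  shows "positive_op (B o\<^sub>L A)"
proof -
  have "cinner x (B (A x)) = complex_of_real ((norm (A x))\<^sup>2)" for x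
    using assms(1) by (metis cinner_eq_norm is_adjoint_def)
  then show ?thesis
    using assms by (simp add: positive_op_def complex_linear_comp)
qed

text \<open>For a self-adjoint operator the quadratic form is real, so only its sign is at stake.\<close>
lemma positive_opI:
  fixes A :: "'h::complex_hilbert_space \<Rightarrow>\<^sub>L 'h"
  assumes "complex_linear_op A" "is_adjoint A A" "\<And>x. 0 \<le> x \<bullet> A x"
  shows "positive_op A"
proof -
  have "cinner x (A x) \<in> \<real>\<^sub>\<ge>\<^sub>0" for x
  proof -
    have "cinner x (A x) = cnj (cinner x (A x))"
      using assms(2) by (metis cinner_commute is_adjoint_def)
    then have "Im (cinner x (A x)) = 0"
      by (metis Reals_cnj_iff complex_is_Real_iff)
    then show ?thesis
      using assms(3)[of x] by (simp add: complex_nonneg_Reals_iff inner_eq_Re_cinner)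
  qed
  with assms(1) show ?thesis
    by (simp add: positive_op_def)
qed

section \<open>Polynomials of an operator\<close>

lemma op_power_0 [simp]: "op_power A 0 = id_blinfun"
  and op_power_Suc: "op_power A (Suc n) = A o\<^sub>L op_power A n"
  by (simp_all add: op_power_def op_prod_def)

lemma op_prod_append: "op_prod (As @ Bs) = op_prod As o\<^sub>L op_prod Bs"
  by (induction As) (simp_all add: op_prod_def comp_assoc)

lemma op_power_add: "op_power A (m + n) = op_power A m o\<^sub>L op_power A n"
  by (simp add: op_power_def replicate_add op_prod_append)

lemma op_power_Suc2: "op_power A (Suc n) = op_power A n o\<^sub>L A"
  using op_power_add[of A n 1] by (simp add: op_power_Suc)

lemma poly_op_le: "degree p \<le> n \<Longrightarrow> poly_op p A = (\<Sum>i\<le>n. scaleC_op (coeff p i) (op_power A i))"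
  unfolding poly_op_def
  by (intro sum.mono_neutral_left) (auto simp: coeff_eq_0)

lemma poly_op_0 [simp]: "poly_op 0 A = 0"
  by (simp add: poly_op_def)

lemma poly_op_add: "poly_op (p + r) A = poly_op p A + poly_op r A"
proof -
  define n where "n = max (degree p) (degree r)"
  have "degree p \<le> n" "degree r \<le> n" "degree (p + r) \<le> n"
    by (auto simp: n_def intro: degree_add_le)
  then show ?thesis
    by (simp add: poly_op_le scaleC_op_add_left sum.distrib)
qed

lemma poly_op_smult: "poly_op (smult c p) A = scaleC_op c (poly_op p A)"
  using poly_op_le[OF degree_smult_le[of c p], of A]
  by (simp add: poly_op_def scaleC_op_sum scaleC_op_scaleC)

lemma poly_op_pCons:
  assumes "complex_linear_op A"
  shows "poly_op (pCons a p) A = scaleC_op a id_blinfun + (A o\<^sub>L poly_op p A)"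
proof -
  have "poly_op (pCons a p) A = (\<Sum>i\<le>Suc (degree p). scaleC_op (coeff (pCons a p) i) (op_power A i))"
    by (rule poly_op_le) (rule degree_pCons_le)
  also have "\<dots> = scaleC_op a id_blinfun + (\<Sum>i\<le>degree p. scaleC_op (coeff p i) (op_power A (Suc i)))"
    by (subst sum.atMost_Suc_shift) simp
  also have "(\<Sum>i\<le>degree p. scaleC_op (coeff p i) (op_power A (Suc i))) = A o\<^sub>L poly_op p A"
    using assms by (simp add: poly_op_def comp_sum_right op_power_Suc scaleC_comp_right)
  finally show ?thesis .
qed

lemma poly_op_mult:
  assumes "complex_linear_op A"
  shows "poly_op (p * r) A = poly_op p A o\<^sub>L poly_op r A"
proof (induction p)
  case (pCons a p)
  have "pCons a p * r = smult a r + pCons 0 (p * r)"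
    by simp
  then show ?case
    using pCons
    by (simp add: poly_op_add poly_op_smult poly_op_pCons[OF assms] comp_add_left scaleC_comp_left comp_assoc)
qed simp

lemma poly_op_const: "poly_op [:a:] A = scaleC_op a id_blinfun"
  by (simp add: poly_op_def)

lemma poly_op_X: "complex_linear_op A \<Longrightarrow> poly_op [:0, 1:] A = A"
  by (simp add: poly_op_pCons)

lemma poly_op_pCons2:
  assumes "complex_linear_op A"
  shows "poly_op (pCons a p) A = scaleC_op a id_blinfun + (poly_op p A o\<^sub>L A)"
proof -
  have "pCons a p = [:a:] + p * [:0, 1:]"
    by simp
  then show ?thesis
    by (simp only: poly_op_add poly_op_mult[OF assms] poly_op_const poly_op_X[OF assms])
qed

lemma poly_op_monom: "complex_linear_op A \<Longrightarrow> poly_op (monom 1 n) A = op_power A n"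
  by (induction n) (simp_all add: monom_0 monom_Suc poly_op_pCons op_power_Suc poly_op_const)

lemma poly_op_at_0: "poly_op p 0 = scaleC_op (poly p 0) id_blinfun"
proof -
  have "complex_linear_op (0 :: 'a \<Rightarrow>\<^sub>L 'a)"
    using complex_linear_scaleC[OF complex_linear_id, of 0] by simp
  then show ?thesis
    by (induction p) (simp_all add: poly_op_pCons)
qed

section \<open>A square root by iteration\<close>

text \<open>The fixed-point equation says that \<open>1 - Y\<close> is a square root of \<open>1 - X\<close>. The iteration converges because
the norms of its steps are dominated by the steps of the scalar iteration \<open>z \<mapsto> (1 + z\<^sup>2)/2\<close>,
which increases to 1. The last clause transfers to \<open>Y\<close> every closed property that is kept by
the iteration, such as self-adjointness or commuting with a given operator.\<close>
lemma op_sqrt_iteration: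
  fixes X :: "'a::banach \<Rightarrow>\<^sub>L 'a"
  assumes X: "norm X \<le> 1"
  obtains Y where "norm Y \<le> 1" "Y = (1/2) *\<^sub>R (X + (Y o\<^sub>L Y))"
    "\<And>P. closed P \<Longrightarrow> 0 \<in> P \<Longrightarrow> (\<And>Z. Z \<in> P \<Longrightarrow> (1/2) *\<^sub>R (X + (Z o\<^sub>L Z)) \<in> P) \<Longrightarrow> Y \<in> P"
proof -
  define F where "F Z = (1/2) *\<^sub>R (X + (Z o\<^sub>L Z))" for Z
  define f where "f z = (1/2) * (1 + z * z)" for z :: real
  define Y where "Y n = (F ^^ n) 0" for n
  define y where "y n = (f ^^ n) 0" for n
  have Y: "Y 0 = 0" "Y (Suc n) = F (Y n)" and y: "y 0 = 0" "y (Suc n) = f (y n)" for n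
    by (simp_all add: Y_def y_def)
  have y01: "0 \<le> y n \<and> y n \<le> 1" for n
  proof (induction n)
    case (Suc n)
    then have "y n * y n \<le> 1"
      by (intro mult_le_one) auto
    then show ?case
      by (simp add: y f_def)
  qed (simp add: y)
  have Yy: "norm (Y n) \<le> y n" for n
  proof (induction n)
    case (Suc n)
    have "norm (X + (Y n o\<^sub>L Y n)) \<le> 1 + y n * y n"
      using Suc X norm_triangle_ineq[of X "Y n o\<^sub>L Y n"] norm_blinfun_compose[of "Y n" "Y n"]
        mult_mono[OF Suc Suc] y01[of n] by simp
    then show ?case
      by (simp add: Y y F_def f_def)
  qed (simp add: Y y)
  have step: "norm (Y (Suc n) - Y n) \<le> y (Suc n) - y n" for n
  proof (induction n)
    case 0
    show ?case
      using X by (simp add: Y y F_def f_def)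
  next
    case (Suc n)
    let ?Z = "Y (Suc n)" and ?W = "Y n" and ?z = "y (Suc n)" and ?w = "y n"
    have "F Z - F W = (1/2) *\<^sub>R ((Z o\<^sub>L Z) - (W o\<^sub>L W))" for Z W
      by (simp add: F_def algebra_simps)
    then have "Y (Suc (Suc n)) - Y (Suc n) = (1/2) *\<^sub>R ((?Z o\<^sub>L ?Z) - (?W o\<^sub>L ?W))"
      by (metis Y(2))
    also have "(?Z o\<^sub>L ?Z) - (?W o\<^sub>L ?W) = (?Z o\<^sub>L (?Z - ?W)) + ((?Z - ?W) o\<^sub>L ?W)"
      by (simp add: comp_diff_left comp_diff_right)
    finally have "norm (Y (Suc (Suc n)) - Y (Suc n)) \<le>
        (1/2) * (norm ?Z * norm (?Z - ?W) + norm (?Z - ?W) * norm ?W)"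
      using norm_triangle_ineq[of "?Z o\<^sub>L (?Z - ?W)" "(?Z - ?W) o\<^sub>L ?W"]
        norm_blinfun_compose[of ?Z "?Z - ?W"] norm_blinfun_compose[of "?Z - ?W" ?W] by simp
    also have "\<dots> \<le> (1/2) * (?z * (?z - ?w) + (?z - ?w) * ?w)"
      using Suc Yy[of n] Yy[of "Suc n"] y01[of n] y01[of "Suc n"] order_trans[OF norm_ge_zero Suc]
      by (intro mult_left_mono add_mono mult_mono) simp_all
    also have "\<dots> = f ?z - f ?w"
      by (simp add: f_def algebra_simps)
    also have "\<dots> = y (Suc (Suc n)) - y (Suc n)"
      by (simp only: y(2))
    finally show ?case .
  qed
  have diff: "norm (Y (n + k) - Y n) \<le> y (n + k) - y n" for n k
  proof (induction k)
    case (Suc k)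
    then show ?case
      using step[of "n + k"] norm_triangle_ineq[of "Y (Suc (n + k)) - Y (n + k)" "Y (n + k) - Y n"]
      by simp
  qed simp
  have "incseq y"
  proof (rule incseq_SucI)
    show "y n \<le> y (Suc n)" for n
      using order_trans[OF norm_ge_zero step[of n]] by simp
  qed
  then obtain l where "y \<longlonglongrightarrow> l"
    using y01 by (auto elim: incseq_convergent[of y 1])
  then have "convergent y"
    by (rule convergentI)
  then have "Cauchy y"
    by (simp add: Cauchy_convergent_iff)
  have "Cauchy Y"
  proof (rule metric_CauchyI)
    fix e :: real assume "0 < e"
    then obtain N where N: "\<And>m n. m \<ge> N \<Longrightarrow> n \<ge> N \<Longrightarrow> dist (y m) (y n) < e"
      using \<open>Cauchy y\<close> metric_CauchyD by blast
    have le: "dist (Y m) (Y n) < e" if "N \<le> n" "n \<le> m" for m n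
      using diff[of n "m - n"] N[of m n] that by (simp add: dist_norm)
    have "dist (Y m) (Y n) < e" if "N \<le> m" "N \<le> n" for m n
      using le[of n m] le[of m n] that by (cases "n \<le> m") (simp_all add: dist_commute)
    then show "\<exists>M. \<forall>m\<ge>M. \<forall>n\<ge>M. dist (Y m) (Y n) < e"
      by blast
  qed
  then obtain L where L: "Y \<longlonglongrightarrow> L"
    by (auto simp: Cauchy_convergent_iff convergent_def)
  show thesis
  proof
    have "norm (Y n) \<le> 1" for n
      using Yy[of n] y01[of n] by linarith
    then show "norm L \<le> 1"
      by (intro LIMSEQ_le_const2[OF tendsto_norm[OF L]]) blast
    have "(\<lambda>n. F (Y n)) \<longlonglongrightarrow> F L"
      unfolding F_def by (intro tendsto_intros L)
    then have "(\<lambda>n. Y (Suc n)) \<longlonglongrightarrow> F L"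
      by (simp add: Y)
    then have "L = F L"
      by (rule LIMSEQ_unique[OF LIMSEQ_Suc[OF L]])
    then show "L = (1/2) *\<^sub>R (X + (L o\<^sub>L L))"
      unfolding F_def .
    fix P assume P: "closed P" "0 \<in> P" "\<And>Z. Z \<in> P \<Longrightarrow> (1/2) *\<^sub>R (X + (Z o\<^sub>L Z)) \<in> P"
    have "Y n \<in> P" for n
      using P by (induction n) (simp_all add: Y F_def)
    then show "L \<in> P"
      by (rule closed_sequentially[OF P(1) _ L])
  qed
qed

section \<open>Norms from moments\<close>

lemma commute_square:
  assumes "B o\<^sub>L Z = Z o\<^sub>L B"
  shows "B o\<^sub>L (Z o\<^sub>L Z) = (Z o\<^sub>L Z) o\<^sub>L B"
proof -
  have "B (Z x) = Z (B x)" for x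
    using arg_cong[OF assms, of "\<lambda>T. blinfun_apply T x"] by simp
  then show ?thesis
    by (intro blinfun_eqI) simp
qed

lemma commute_power:
  assumes "A o\<^sub>L K = K o\<^sub>L A"
  shows "op_power A n o\<^sub>L K = K o\<^sub>L op_power A n"
proof (induction n)
  case (Suc n)
  have "A (K x) = K (A x)" "op_power A n (K x) = K (op_power A n x)" for x
    using arg_cong[OF assms, of "\<lambda>T. blinfun_apply T x"] arg_cong[OF Suc, of "\<lambda>T. blinfun_apply T x"]
    by simp_all
  then show ?case
    by (intro blinfun_eqI) (simp add: op_power_Suc)
qed simp

locale commutant_state =
  fixes C :: "('h::complex_hilbert_space \<Rightarrow>\<^sub>L 'h) set"
    and E :: "('h \<Rightarrow>\<^sub>L 'h) \<Rightarrow> complex"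
  assumes linear_C: "\<And>B. B \<in> C \<Longrightarrow> complex_linear_op B"
    and state: "state_on (commutant C) E"
begin

abbreviation "M \<equiv> commutant C"

lemma M_linear: "A \<in> M \<Longrightarrow> complex_linear_op A"
  by (simp add: commutant_def)

lemma M_scaleC: "A \<in> M \<Longrightarrow> scaleC_op c A \<in> M"
  using linear_C by (intro commutant_scaleC) auto

lemma M_scaleR: "A \<in> M \<Longrightarrow> r *\<^sub>R A \<in> M"
  using M_scaleC[of A "complex_of_real r"] by (simp add: scaleC_scaleR)

lemma M_zero: "0 \<in> M"
  using M_scaleR[OF commutant_id, of 0] by simp

lemma M_diff: "A \<in> M \<Longrightarrow> B \<in> M \<Longrightarrow> A - B \<in> M"
  using commutant_add[of A C "(-1) *\<^sub>R B"] M_scaleR[of B "-1"] by simp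

lemma M_sum: "(\<And>i. i \<in> I \<Longrightarrow> A i \<in> M) \<Longrightarrow> (\<Sum>i\<in>I. A i) \<in> M"
  by (induction I rule: infinite_finite_induct) (simp_all add: M_zero commutant_add)

lemma M_power: "A \<in> M \<Longrightarrow> op_power A n \<in> M"
  by (induction n) (simp_all add: op_power_Suc commutant_id commutant_comp)

lemmas M_intros = commutant_id commutant_comp commutant_add M_scaleC M_scaleR M_zero M_diff M_sum M_power

lemma E_add: "A \<in> M \<Longrightarrow> B \<in> M \<Longrightarrow> E (A + B) = E A + E B"
  and E_scaleC: "A \<in> M \<Longrightarrow> E (scaleC_op c A) = c * E A"
  and E_id: "E id_blinfun = 1"
  and E_positive: "A \<in> M \<Longrightarrow> positive_op A \<Longrightarrow> E A \<in> \<real>\<^sub>\<ge>\<^sub>0"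
  using state by (simp_all add: state_on_def)

lemma E_scaleR: "A \<in> M \<Longrightarrow> E (r *\<^sub>R A) = r * E A"
  using E_scaleC[of A "complex_of_real r"] by (simp add: scaleC_scaleR)

lemma E_zero: "E 0 = 0"
  using E_scaleR[OF M_zero, of 0] by simp

lemma E_diff: "A \<in> M \<Longrightarrow> B \<in> M \<Longrightarrow> E (A - B) = E A - E B"
  using E_add[of A "(-1) *\<^sub>R B"] E_scaleR[of B "-1"] M_scaleR[of B "-1"] by simp

lemma E_sum: "(\<And>i. i \<in> I \<Longrightarrow> A i \<in> M) \<Longrightarrow> E (\<Sum>i\<in>I. A i) = (\<Sum>i\<in>I. E (A i))"
  by (induction I rule: infinite_finite_induct) (simp_all add: E_zero E_add M_sum)

text \<open>A self-adjoint operator is a difference of two positive ones: \<open>norm A\<close> times the identity, and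
\<open>norm A - A\<close>.\<close>
lemma E_selfadjoint_real:
  assumes A: "A \<in> M" "is_adjoint A A"
  shows "E A \<in> \<real>"
proof -
  have "positive_op (norm A *\<^sub>R id_blinfun - A)"
  proof (rule positive_opI)
    show "complex_linear_op (norm A *\<^sub>R id_blinfun - A)"
      using A by (intro M_linear M_intros)
    then show "is_adjoint (norm A *\<^sub>R id_blinfun - A) (norm A *\<^sub>R id_blinfun - A)"
      using is_adjoint_inner[OF A(2)]
      by (intro is_adjointI) (auto simp: blinfun.diff_left blinfun.scaleR_left inner_diff_left inner_diff_right)
    fix x
    have "x \<bullet> A x \<le> norm x * (norm A * norm x)"
      by (intro order_trans[OF norm_cauchy_schwarz] mult_left_mono norm_blinfun) simp
    then show "0 \<le> x \<bullet> (norm A *\<^sub>R id_blinfun - A) x"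
      by (simp add: blinfun.diff_left blinfun.scaleR_left inner_diff_right mult_ac
          power2_norm_eq_inner flip: power2_eq_square)
        (simp add: power2_eq_square mult_ac flip: power2_norm_eq_inner)
  qed
  then have "E (norm A *\<^sub>R id_blinfun - A) \<in> \<real>\<^sub>\<ge>\<^sub>0"
    using A by (intro E_positive M_diff M_scaleR commutant_id)
  then have "E (norm A *\<^sub>R id_blinfun - A) \<in> \<real>"
    using nonneg_Reals_subset_Reals by (rule rev_subsetD)
  moreover have "E A = norm A - E (norm A *\<^sub>R id_blinfun - A)"
    using A by (simp add: E_diff E_scaleR E_id M_intros)
  ultimately show ?thesis
    by (metis Reals_diff Reals_of_real)
qed

lemma E_adjoint:
  assumes "A \<in> M" "B \<in> M" and AB: "is_adjoint A B"
  shows "E B = cnj (E A)"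
proof -
  have "is_adjoint (A + B) (A + B)"
    using is_adjoint_add[OF AB is_adjoint_sym[OF AB]] by (simp add: add.commute)
  then have 1: "E A + E B \<in> \<real>"
    using E_selfadjoint_real[of "A + B"] assms by (simp add: E_add M_intros)
  have "is_adjoint (scaleC_op \<i> A + scaleC_op (-\<i>) B) (scaleC_op \<i> A + scaleC_op (-\<i>) B)"
    using is_adjoint_add[OF is_adjoint_scaleC[OF AB, of \<i>] is_adjoint_scaleC[OF is_adjoint_sym[OF AB], of "-\<i>"]]
    by (simp add: add.commute)
  then have "\<i> * E A - \<i> * E B \<in> \<real>"
    using E_selfadjoint_real[of "scaleC_op \<i> A + scaleC_op (-\<i>) B"] assms
    by (simp add: E_add E_scaleC M_intros)
  with 1 show ?thesis
    by (simp add: complex_is_Real_iff complex_eq_iff)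
qed

lemma E_square:
  assumes "A \<in> M" "B \<in> M" and AB: "is_adjoint A B"
  shows "0 \<le> Re (E (B o\<^sub>L A))" "Im (E (B o\<^sub>L A)) = 0"
proof -
  have "positive_op (B o\<^sub>L A)"
    using assms by (intro positive_adjoint_comp M_linear)
  then have "E (B o\<^sub>L A) \<in> \<real>\<^sub>\<ge>\<^sub>0"
    using assms by (intro E_positive commutant_comp)
  then show "0 \<le> Re (E (B o\<^sub>L A))" "Im (E (B o\<^sub>L A)) = 0"
    by (simp_all add: complex_nonneg_Reals_iff)
qed

text \<open>The hypothesis makes \<open>c\<^sup>2 B' B - A' A\<close> a positive operator.\<close>
lemma E_square_mono:
  assumes A: "A \<in> M" "A' \<in> M" "is_adjoint A A'" and B: "B \<in> M" "B' \<in> M" "is_adjoint B B'"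
    and le: "\<And>x. norm (A x) \<le> c * norm (B x)" and "0 \<le> c"
  shows "Re (E (A' o\<^sub>L A)) \<le> c\<^sup>2 * Re (E (B' o\<^sub>L B))"
proof -
  define D where "D = c\<^sup>2 *\<^sub>R (B' o\<^sub>L B) - (A' o\<^sub>L A)"
  have DM: "D \<in> M"
    using A B unfolding D_def by (intro M_intros)
  have AA: "x \<bullet> A' (A y) = A x \<bullet> A y" "x \<bullet> B' (B y) = B x \<bullet> B y" for x y
    using A(3) B(3) by (simp_all add: is_adjoint_inner)
  have "positive_op D"
  proof (rule positive_opI)
    show "complex_linear_op D"
      using DM by (rule M_linear)
    then show "is_adjoint D D"
    proof (rule is_adjointI)
      show "D x \<bullet> y = x \<bullet> D y" for x y
        by (simp add: D_def blinfun.diff_left blinfun.scaleR_left inner_diff_left inner_diff_right AA)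
          (simp add: inner_commute[of _ y] AA inner_commute[of "A y"] inner_commute[of "B y"])
    qed
    show "0 \<le> x \<bullet> D x" for x
      using power_mono[OF le[of x], of 2]
      by (simp add: D_def blinfun.diff_left blinfun.scaleR_left inner_diff_right AA
          power_mult_distrib power2_norm_eq_inner)
  qed
  then have "0 \<le> Re (E D)"
    using E_positive[OF DM] by (simp add: complex_nonneg_Reals_iff)
  then show ?thesis
    using A B by (simp add: D_def E_diff E_scaleR M_intros)
qed

lemma E_square_le_norm:
  assumes A: "A \<in> M" "A' \<in> M" "is_adjoint A A'"
  shows "Re (E (A' o\<^sub>L A)) \<le> (norm A)\<^sup>2"
  using E_square_mono[OF A commutant_id commutant_id is_adjoint_id, of "norm A"]
  by (simp add: norm_blinfun E_id)

text \<open>The parallelogram law, which serves as a substitute for the triangle inequality of the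
\<open>L\<^sup>2\<close> norm.\<close>
lemma E_square_add:
  assumes A: "A \<in> M" "A' \<in> M" "is_adjoint A A'" and B: "B \<in> M" "B' \<in> M" "is_adjoint B B'"
  shows "Re (E ((A' + B') o\<^sub>L (A + B))) \<le> 2 * Re (E (A' o\<^sub>L A)) + 2 * Re (E (B' o\<^sub>L B))"
proof -
  have "is_adjoint (A - B) (A' - B')"
    using is_adjoint_add[OF A(3) is_adjoint_scaleC[OF B(3), of "-1"]]
      scaleC_scaleR[of "-1" B] scaleC_scaleR[of "-1" B'] by simp
  then have "0 \<le> Re (E ((A' - B') o\<^sub>L (A - B)))"
    using A B by (intro E_square M_diff)
  moreover have "((A' + B') o\<^sub>L (A + B)) + ((A' - B') o\<^sub>L (A - B)) =
      2 *\<^sub>R (A' o\<^sub>L A) + 2 *\<^sub>R (B' o\<^sub>L B)"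
    by (simp add: comp_add_left comp_add_right comp_diff_left comp_diff_right scaleR_2)
  from arg_cong[OF this, of E]
  have "E ((A' + B') o\<^sub>L (A + B)) + E ((A' - B') o\<^sub>L (A - B)) =
      2 * E (A' o\<^sub>L A) + 2 * E (B' o\<^sub>L B)"
    using A B by (simp add: E_add E_scaleR commutant_comp commutant_add M_diff M_scaleR)
  from arg_cong[OF this, of Re]
  have "Re (E ((A' + B') o\<^sub>L (A + B))) + Re (E ((A' - B') o\<^sub>L (A - B))) =
      2 * Re (E (A' o\<^sub>L A)) + 2 * Re (E (B' o\<^sub>L B))"
    by simp
  ultimately show ?thesis
    by linarith
qed

text \<open>Let \<open>R\<^sup>2 < c\<close>, and let \<open>K\<close> be (up to a scalar) the positive part of \<open>A\<^sup>2 - c\<close>. On the range of \<open>K\<close> the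
operator \<open>A\<^sup>2\<close> is at least \<open>c\<close>, hence \<open>c^n E(K\<^sup>2) \<le> E(K A^(2n) K) \<le> (norm K)\<^sup>2 R^(2n)\<close> for all \<open>n\<close>. This
forces \<open>E(K\<^sup>2) = 0\<close>, so \<open>K = 0\<close> since \<open>E\<close> is faithful, which means \<open>A\<^sup>2 \<le> c\<close>. The positive part
is \<open>(\<bar>D'\<bar> + D')/2\<close> for a multiple \<open>D'\<close> of \<open>A\<^sup>2 - c\<close>; the absolute value \<open>G = \<bar>D'\<bar>\<close> is the square root of
\<open>D'\<^sup>2\<close> given by \<open>op_sqrt_iteration\<close>.\<close>
theorem norm_le_of_moments:
  assumes faithful: "faithful_on M E"
    and A: "A \<in> M" "is_adjoint A A"
    and R: "0 \<le> R" "\<And>n. Re (E (op_power A (2 * n))) \<le> R ^ (2 * n)"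
  shows "norm A \<le> R"
proof -
  have bound: "norm (A x) \<le> sqrt c * norm x" if c: "R\<^sup>2 < c" for c x
  proof -
    have "0 < c"
      using c zero_le_power2[of R] by linarith
    define D where "D = (A o\<^sub>L A) - c *\<^sub>R id_blinfun"
    define N where "N = norm D + 1"
    have N: "0 < N" by (simp add: N_def add_nonneg_pos)
    \<comment> \<open>scaled to a contraction, as the square root iteration requires\<close>
    define D' where "D' = (1 / N) *\<^sub>R D"
    have D'1: "norm D' \<le> 1"
      using N by (simp add: D'_def N_def)
    have D'M: "D' \<in> M"
      using A unfolding D'_def D_def by (intro M_intros)
    have D'sa: "D' x \<bullet> y = x \<bullet> D' y" for x y
      using is_adjoint_inner[OF A(2)]
      by (simp add: D'_def D_def blinfun.diff_left blinfun.scaleR_left inner_diff_left inner_diff_right)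
    have AA: "(A o\<^sub>L A) = c *\<^sub>R id_blinfun + N *\<^sub>R D'"
      using N by (simp add: D'_def D_def)
    have AD': "A o\<^sub>L D' = D' o\<^sub>L A"
      by (simp add: D'_def D_def comp_scaleR_left comp_scaleR_right comp_diff_left comp_diff_right comp_assoc)
    \<comment> \<open>so that \<open>1 - X = D'\<^sup>2\<close>\<close>
    define X where "X = id_blinfun - (D' o\<^sub>L D')"
    have "norm X \<le> 1"
    proof (rule norm_blinfun_bound)
      fix x
      have le: "norm (D' z) \<le> norm z" for z
        using norm_blinfun[of D' z] mult_right_mono[OF D'1, of "norm z"] by simp
      have "(norm (X x))\<^sup>2 = (norm x)\<^sup>2 - 2 * (norm (D' x))\<^sup>2 + (norm (D' (D' x)))\<^sup>2"
        using D'sa[of "D' x" x] D'sa[of x "D' x"]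
        by (simp add: X_def blinfun.diff_left power2_norm_eq_inner inner_diff_left inner_diff_right)
      moreover have "(norm (D' (D' x)))\<^sup>2 \<le> (norm (D' x))\<^sup>2"
        by (rule power_mono[OF le norm_ge_zero])
      moreover have "0 \<le> (norm (D' x))\<^sup>2"
        by simp
      ultimately have "(norm (X x))\<^sup>2 \<le> (norm x)\<^sup>2"
        by linarith
      then show "norm (X x) \<le> 1 * norm x"
        by (simp add: power2_le_iff_abs_le)
    qed simp
    then obtain Y where Y: "norm Y \<le> 1" "Y = (1/2) *\<^sub>R (X + (Y o\<^sub>L Y))"
      and closure: "\<And>P. closed P \<Longrightarrow> 0 \<in> P \<Longrightarrow>
        (\<And>Z. Z \<in> P \<Longrightarrow> (1/2) *\<^sub>R (X + (Z o\<^sub>L Z)) \<in> P) \<Longrightarrow> Y \<in> P"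
      by (rule op_sqrt_iteration) blast
    have XM: "X \<in> M"
      using D'M unfolding X_def by (intro M_intros)
    have YM: "Y \<in> M"
      using XM by (intro closure closed_commutant M_intros)
    have Ycomm: "B o\<^sub>L Y = Y o\<^sub>L B" if B: "B o\<^sub>L X = X o\<^sub>L B" for B
    proof -
      have "closed {Z. B o\<^sub>L Z = Z o\<^sub>L B}"
        by (intro closed_Collect_eq continuous_intros)
      moreover note commute_square[of B]
      ultimately have "Y \<in> {Z. B o\<^sub>L Z = Z o\<^sub>L B}"
        using B by (intro closure)
          (simp_all add: comp_scaleR_left comp_scaleR_right comp_add_left comp_add_right)
      then show ?thesis by simp
    qed
    have Ysa: "Y x \<bullet> y = x \<bullet> Y y" for x y
    proof -
      have "closed {Z. \<forall>x y. blinfun_apply Z x \<bullet> y = x \<bullet> blinfun_apply Z y}"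
        unfolding Collect_all_eq by (intro closed_INT ballI closed_Collect_eq continuous_intros)
      then have "Y \<in> {Z. \<forall>x y. blinfun_apply Z x \<bullet> y = x \<bullet> blinfun_apply Z y}"
        by (intro closure) (auto simp: X_def blinfun.add_left blinfun.diff_left blinfun.scaleR_left
            inner_add_left inner_add_right inner_diff_left inner_diff_right D'sa)
      then show ?thesis by blast
    qed
    define G where "G = id_blinfun - Y"
    have GM: "G \<in> M"
      using YM unfolding G_def by (intro M_intros)
    have Gsa: "G x \<bullet> y = x \<bullet> G y" for x y
      by (simp add: G_def blinfun.diff_left inner_diff_left inner_diff_right Ysa)
    have Gpos: "0 \<le> x \<bullet> G x" for x
    proof -
      have "x \<bullet> Y x \<le> norm x * (norm Y * norm x)"
        by (intro order_trans[OF norm_cauchy_schwarz] mult_left_mono norm_blinfun) simp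
      also have "\<dots> \<le> norm x * (1 * norm x)"
        using Y(1) by (intro mult_left_mono mult_right_mono) simp_all
      finally show ?thesis
        by (simp add: G_def blinfun.diff_left inner_diff_right flip: power2_eq_square power2_norm_eq_inner)
    qed
    have GG: "G o\<^sub>L G = D' o\<^sub>L D'"
    proof -
      have "2 *\<^sub>R Y = X + (Y o\<^sub>L Y)"
        using arg_cong[OF Y(2), of "(*\<^sub>R) 2"] by simp
      moreover have "G o\<^sub>L G = id_blinfun - 2 *\<^sub>R Y + (Y o\<^sub>L Y)"
        by (simp add: G_def comp_diff_left comp_diff_right scaleR_2)
      ultimately show ?thesis
        by (simp add: X_def)
    qed
    have commG: "B o\<^sub>L G = G o\<^sub>L B" if "B o\<^sub>L D' = D' o\<^sub>L B" for B
    proof -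
      note commute_square[OF that]
      then have "B o\<^sub>L X = X o\<^sub>L B"
        by (simp add: X_def comp_diff_left comp_diff_right)
      from Ycomm[OF this] show ?thesis
        by (simp add: G_def comp_diff_left comp_diff_right)
    qed
    define K where "K = G + D'"
    have KM: "K \<in> M"
      using GM D'M unfolding K_def by (intro M_intros)
    have Ksa: "is_adjoint K K"
      using M_linear[OF KM] Gsa D'sa
      by (intro is_adjointI) (simp_all add: K_def blinfun.add_left inner_add_left inner_add_right)
    \<comment> \<open>on the positive part \<open>D'\<close> and its absolute value agree: \<open>D' K = \<bar>D'\<bar> K\<close>\<close>
    have D'K: "D' o\<^sub>L K = G o\<^sub>L K"
      using GG commG[of D'] by (simp add: K_def comp_add_right)
    have AK: "A o\<^sub>L K = K o\<^sub>L A"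
      using AD' commG[OF AD'] by (simp add: K_def comp_add_left comp_add_right)
    define P where "P n = op_power A n o\<^sub>L K" for n
    define P' where "P' n = K o\<^sub>L op_power A n" for n
    have PP': "P n = P' n" for n
      unfolding P_def P'_def using AK by (rule commute_power)
    have PM: "P n \<in> M" "P' n \<in> M" for n
      using A KM unfolding P_def P'_def by (auto intro: M_intros)
    have powsa: "is_adjoint (op_power A n) (op_power A n)" for n
    proof (induction n)
      case (Suc n)
      then show ?case
        using is_adjoint_comp[OF A(2) Suc] by (simp add: op_power_Suc op_power_Suc2[symmetric])
    qed (simp add: is_adjoint_id)
    have Padj: "is_adjoint (P n) (P' n)" for n
      unfolding P_def P'_def by (intro is_adjoint_comp powsa Ksa)
    have AAP: "(A o\<^sub>L A) o\<^sub>L P n = c *\<^sub>R P n + N *\<^sub>R (G o\<^sub>L P n)" for n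
    proof -
      have "D' o\<^sub>L P n = G o\<^sub>L P n"
        unfolding PP' P'_def using D'K by (simp flip: comp_assoc)
      then show ?thesis
        by (simp add: AA comp_add_left comp_scaleR_left)
    qed
    \<comment> \<open>the defect in this inequality is \<open>N E(P' G P)\<close>, which is not negative since \<open>G \<ge> 0\<close>\<close>
    have step: "c * Re (E (P' n o\<^sub>L P n)) \<le> Re (E (P' (Suc n) o\<^sub>L P (Suc n)))" for n
    proof -
      have "P' (Suc n) o\<^sub>L P (Suc n) = P' n o\<^sub>L ((A o\<^sub>L A) o\<^sub>L P n)"
        unfolding P_def P'_def op_power_Suc
        by (subst (1) op_power_Suc[symmetric], subst op_power_Suc2) (simp only: comp_assoc)
      also have "\<dots> = c *\<^sub>R (P' n o\<^sub>L P n) + N *\<^sub>R (P' n o\<^sub>L (G o\<^sub>L P n))"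
        by (simp add: AAP comp_add_right comp_scaleR_right)
      finally have eq: "E (P' (Suc n) o\<^sub>L P (Suc n)) =
          c * E (P' n o\<^sub>L P n) + N * E (P' n o\<^sub>L (G o\<^sub>L P n))"
        using PM GM by (simp add: E_add E_scaleR M_intros)
      have "positive_op (P' n o\<^sub>L (G o\<^sub>L P n))"
      proof (rule positive_opI)
        show "complex_linear_op (P' n o\<^sub>L (G o\<^sub>L P n))"
          using PM GM by (intro M_linear M_intros)
        then show "is_adjoint (P' n o\<^sub>L (G o\<^sub>L P n)) (P' n o\<^sub>L (G o\<^sub>L P n))"
        proof (rule is_adjointI)
          fix x y
          show "(P' n o\<^sub>L (G o\<^sub>L P n)) x \<bullet> y = x \<bullet> (P' n o\<^sub>L (G o\<^sub>L P n)) y"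
            using is_adjoint_inner[OF Padj, of n x] is_adjoint_inner[OF is_adjoint_sym[OF Padj], of n]
            by (simp add: Gsa)
        qed
        show "0 \<le> x \<bullet> (P' n o\<^sub>L (G o\<^sub>L P n)) x" for x
          using Gpos[of "P n x"] is_adjoint_inner[OF Padj, of n x] by simp
      qed
      then have "0 \<le> Re (E (P' n o\<^sub>L (G o\<^sub>L P n)))"
        using E_positive[of "P' n o\<^sub>L (G o\<^sub>L P n)"] PM GM
        by (simp add: M_intros complex_nonneg_Reals_iff)
      then show ?thesis
        using N by (simp add: eq)
    qed
    have lower: "c ^ n * Re (E (K o\<^sub>L K)) \<le> Re (E (P' n o\<^sub>L P n))" for n
    proof (induction n)
      case (Suc n)
      have "c ^ Suc n * Re (E (K o\<^sub>L K)) = c * (c ^ n * Re (E (K o\<^sub>L K)))"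
        by simp
      also have "\<dots> \<le> c * Re (E (P' n o\<^sub>L P n))"
        using Suc \<open>0 < c\<close> by (intro mult_left_mono) simp_all
      also have "\<dots> \<le> Re (E (P' (Suc n) o\<^sub>L P (Suc n)))"
        by (rule step)
      finally show ?case .
    qed (simp add: P_def P'_def)
    have upper: "Re (E (P' n o\<^sub>L P n)) \<le> (norm K)\<^sup>2 * (R\<^sup>2) ^ n" for n
    proof -
      have "Re (E (P' n o\<^sub>L P n)) \<le> (norm K)\<^sup>2 * Re (E (op_power A n o\<^sub>L op_power A n))"
        using A by (intro E_square_mono PM Padj powsa M_intros) (simp_all add: PP' P'_def norm_blinfun)
      also have "op_power A n o\<^sub>L op_power A n = op_power A (2 * n)"
        by (simp add: mult_2 op_power_add)
      also have "(norm K)\<^sup>2 * Re (E (op_power A (2 * n))) \<le> (norm K)\<^sup>2 * (R\<^sup>2) ^ n"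
        using R(2)[of n] by (intro mult_left_mono) (simp_all add: power_mult)
      finally show ?thesis .
    qed
    have "Re (E (K o\<^sub>L K)) \<le> (norm K)\<^sup>2 * (R\<^sup>2 / c) ^ n" for n
      using order_trans[OF lower upper, of n] \<open>0 < c\<close> by (simp add: power_divide field_simps)
    moreover have "(\<lambda>n. (norm K)\<^sup>2 * (R\<^sup>2 / c) ^ n) \<longlonglongrightarrow> (norm K)\<^sup>2 * 0"
      using c \<open>0 < c\<close> by (intro tendsto_mult_left LIMSEQ_realpow_zero) simp_all
    ultimately have "Re (E (K o\<^sub>L K)) \<le> (norm K)\<^sup>2 * 0"
      by (intro LIMSEQ_le_const) auto
    then have "E (K o\<^sub>L K) = 0"
      using E_square[OF KM KM Ksa] by (simp add: complex_eq_iff)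
    then have "K o\<^sub>L K = 0"
      using faithful positive_adjoint_comp[OF Ksa] KM
      by (simp add: faithful_on_def M_linear M_intros)
    have "K x = 0"
    proof -
      have "K x \<bullet> K x = x \<bullet> (K o\<^sub>L K) x"
        using is_adjoint_inner[OF Ksa, of x "K x"] by simp
      then show ?thesis
        by (simp add: \<open>K o\<^sub>L K = 0\<close>)
    qed
    then have "D' x = - G x"
      by (simp add: K_def blinfun.add_left eq_neg_iff_add_eq_0 add.commute)
    then have "x \<bullet> D' x \<le> 0"
      using Gpos[of x] by simp
    then have "N * (x \<bullet> D' x) \<le> 0"
      using N by (simp add: mult_le_0_iff)
    moreover have "(norm (A x))\<^sup>2 = x \<bullet> (A o\<^sub>L A) x"
      using is_adjoint_inner[OF A(2), of x "A x"] by (simp add: power2_norm_eq_inner)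
    ultimately have "(norm (A x))\<^sup>2 \<le> c * (norm x)\<^sup>2"
      by (simp add: AA blinfun.add_left blinfun.scaleR_left inner_add_right power2_norm_eq_inner
          del: blinfun_apply_blinfun_compose)
    then have "sqrt ((norm (A x))\<^sup>2) \<le> sqrt (c * (norm x)\<^sup>2)"
      by (rule real_sqrt_le_mono)
    then show ?thesis
      by (simp add: real_sqrt_mult)
  qed
  have "(norm A)\<^sup>2 \<le> R\<^sup>2 + e" if "0 < e" for e
  proof -
    have "0 \<le> R\<^sup>2 + e" using that by simp
    have "norm A \<le> sqrt (R\<^sup>2 + e)"
      using that bound[of "R\<^sup>2 + e"] by (intro norm_blinfun_bound) auto
    from power_mono[OF this norm_ge_zero, of 2] show ?thesis
      using \<open>0 \<le> R\<^sup>2 + e\<close> by simp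
  qed
  then have "(norm A)\<^sup>2 \<le> R\<^sup>2"
    by (rule field_le_epsilon)
  then show ?thesis
    using R(1) by (simp add: power2_le_iff_abs_le)
qed

end

section \<open>q-Hermite polynomials\<close>

text \<open>The label \<open>(a, b)\<close> stands for the increment \<open>X b - X a\<close>, and the covariance is the bilinear extension
of \<open>min\<close>. For two intervals it is the length of their intersection.\<close>
definition interval_cov :: "real \<times> real \<Rightarrow> real \<times> real \<Rightarrow> real" where
  "interval_cov x y = min (snd x) (snd y) - min (fst x) (snd y) - min (snd x) (fst y) + min (fst x) (fst y)"

lemma op_prod_diff:
  "op_prod (As @ (A - B) # Bs) = op_prod (As @ A # Bs) - op_prod (As @ B # Bs)"
  unfolding op_prod_append by (simp add: op_prod_def comp_diff_left comp_diff_right)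

lemma norm_op_power_le: "norm (op_power A n) \<le> norm A ^ n"
proof (induction n)
  case 0
  show ?case by (simp add: norm_blinfun_id_le)
next
  case (Suc n)
  have "norm (A o\<^sub>L op_power A n) \<le> norm A * norm (op_power A n)"
    by (rule norm_blinfun_compose)
  also have "\<dots> \<le> norm A * norm A ^ n"
    using Suc by (intro mult_left_mono) simp_all
  finally show ?case by (simp add: op_power_Suc)
qed

lemma is_adjoint_power: "is_adjoint A A \<Longrightarrow> is_adjoint (op_power A n) (op_power A n)"
proof (induction n)
  case (Suc n)
  then show ?case
    using is_adjoint_comp[of A A "op_power A n" "op_power A n"]
    by (simp add: op_power_Suc op_power_Suc2[symmetric])
qed (simp add: is_adjoint_id)

fun hermite_poly :: "real \<Rightarrow> real \<Rightarrow> nat \<Rightarrow> complex poly" where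
  "hermite_poly q s 0 = 1"
| "hermite_poly q s (Suc 0) = [:0, 1:]"
| "hermite_poly q s (Suc (Suc n)) =
     pCons 0 (hermite_poly q s (Suc n)) - smult (of_real (q_int q (Suc n) * s)) (hermite_poly q s n)"

text \<open>The coefficients of \<open>y^b\<close> in the basis of \<open>q\<close>-Hermite polynomials; the recursion is multiplication by
\<open>y\<close>.\<close>
fun hermite_coeff :: "real \<Rightarrow> real \<Rightarrow> nat \<Rightarrow> nat \<Rightarrow> real" where
  "hermite_coeff q s 0 n = (if n = 0 then 1 else 0)"
| "hermite_coeff q s (Suc b) n =
     (if n = 0 then 0 else hermite_coeff q s b (n - 1)) + q_int q (Suc n) * s * hermite_coeff q s b (Suc n)"

lemma hermite_coeff_eq_0: "b < n \<Longrightarrow> hermite_coeff q s b n = 0"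
  by (induction b arbitrary: n) simp_all

lemma hermite_recurrence:
  "pCons 0 (hermite_poly q s n) =
     hermite_poly q s (Suc n) + smult (of_real (q_int q n * s)) (hermite_poly q s (n - 1))"
proof (cases n)
  case 0
  then show ?thesis by (simp add: q_int_def one_pCons)
qed simp

lemma monom_hermite_expansion:
  "monom 1 b = (\<Sum>n\<le>b. smult (of_real (hermite_coeff q s b n)) (hermite_poly q s n))"
proof (induction b)
  case 0
  show ?case by (simp add: monom_0 one_pCons)
next
  case (Suc b)
  let ?H = "hermite_poly q s" and ?a = "\<lambda>n. of_real (hermite_coeff q s b n) :: complex"
  have pCons_sum: "pCons 0 (sum g A) = (\<Sum>n\<in>A. pCons 0 (g n))" for g :: "nat \<Rightarrow> complex poly" and A
  proof -
    have X: "pCons 0 p = monom 1 (Suc 0) * p" for p :: "complex poly"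
      by (simp add: monom_Suc monom_0)
    show ?thesis
      by (simp only: X sum_distrib_left)
  qed
  have "monom 1 (Suc b) = (\<Sum>n\<le>b. smult (?a n) (pCons 0 (?H n)))"
    by (simp only: monom_Suc Suc pCons_sum smult_pCons mult_zero_right)
  also have "\<dots> = (\<Sum>n\<le>b. smult (?a n) (?H (Suc n)))
      + (\<Sum>n\<le>b. smult (?a n * of_real (q_int q n * s)) (?H (n - 1)))"
    by (simp only: hermite_recurrence smult_add_right sum.distrib smult_smult)
  also have "(\<Sum>n\<le>b. smult (?a n) (?H (Suc n))) =
      (\<Sum>n\<le>Suc b. smult (if n = 0 then 0 else ?a (n - 1)) (?H n))"
    by (subst sum.atMost_Suc_shift) simp
  also have "(\<Sum>n\<le>b. smult (?a n * of_real (q_int q n * s)) (?H (n - 1))) =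
      (\<Sum>n\<le>Suc (Suc b). smult (?a n * of_real (q_int q n * s)) (?H (n - 1)))"
    by (simp add: hermite_coeff_eq_0)
  also have "\<dots> = (\<Sum>n\<le>Suc b. smult (?a (Suc n) * of_real (q_int q (Suc n) * s)) (?H n))"
    by (subst sum.atMost_Suc_shift) (simp add: q_int_def)
  finally show ?case
    by (simp only: sum.distrib[symmetric] smult_add_left[symmetric])
      (intro sum.cong refl arg_cong2[where f = smult], auto simp: mult_ac)
qed

text \<open>The polynomial that represents \<open>x \<mapsto> \<integral> y^b \<Gamma>(x, dy)\<close> (see \<open>kernel_power\<close>). It makes sense for
\<open>s = 0\<close> too, and it depends continuously on \<open>s\<close>.\<close>
definition cond_power :: "real \<Rightarrow> real \<Rightarrow> nat \<Rightarrow> complex poly" where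
  "cond_power q s b = (\<Sum>n\<le>b. smult (of_real (hermite_coeff q s b n * q ^ n)) (hermite_poly q s n))"

text \<open>Likewise, the polynomial that represents \<open>x \<mapsto> \<integral> u(x, y) \<Gamma>(x, dy)\<close> (see \<open>kernel_poly2\<close>).\<close>
definition cond_integral :: "real \<Rightarrow> real \<Rightarrow> complex poly poly \<Rightarrow> complex poly" where
  "cond_integral q s u = (\<Sum>k\<le>degree u. coeff u k * cond_power q s k)"

lemma poly_op_sum: "poly_op (\<Sum>i\<in>I. p i) A = (\<Sum>i\<in>I. poly_op (p i) A)"
  by (induction I rule: infinite_finite_induct) (simp_all add: poly_op_add)

lemma poly_op_diff: "poly_op (p - r) A = poly_op p A - poly_op r A"
  using poly_op_add[of "p - r" r A] by simp

section \<open>Moments of the q-Brownian motion\<close>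

locale q_brownian =
  fixes q :: real
    and X :: "real \<Rightarrow> ('h::complex_hilbert_space \<Rightarrow>\<^sub>L 'h)"
    and E :: "('h \<Rightarrow>\<^sub>L 'h) \<Rightarrow> complex"
  assumes bm: "q_brownian_motion q X E"
begin

lemma X_linear: "0 \<le> t \<Longrightarrow> complex_linear_op (X t)"
  and X_selfadjoint: "0 \<le> t \<Longrightarrow> is_adjoint (X t) (X t)"
  and X_0: "X 0 = 0"
proof -
  have "\<forall>t\<ge>0. complex_linear_op (X t) \<and> selfadjoint_op (X t)"
    using bm unfolding q_brownian_motion_def by (elim conjE)
  moreover have "X 0 = 0"
    using bm unfolding q_brownian_motion_def by (elim conjE)
  ultimately show "0 \<le> t \<Longrightarrow> complex_linear_op (X t)" "0 \<le> t \<Longrightarrow> is_adjoint (X t) (X t)" "X 0 = 0"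
    by (simp_all add: selfadjoint_op_def)
qed

lemma state_X: "state_on (commutant (commutant (X ` {0..}))) E"
  using bm unfolding q_brownian_motion_def von_neumann_generated_def Let_def
  by (elim conjE)

lemma faithful_X: "faithful_on (commutant (commutant (X ` {0..}))) E"
  using bm unfolding q_brownian_motion_def von_neumann_generated_def Let_def
  by (elim conjE)

sublocale commutant_state "commutant (X ` {0..})" E
proof
  show "complex_linear_op B" if "B \<in> commutant (X ` {0..})" for B
    using that by (simp add: commutant_def)
  show "state_on (commutant (commutant (X ` {0..}))) E"
    by (rule state_X)
qed

lemma X_M:
  assumes "0 \<le> t"
  shows "X t \<in> M"
  using X_linear[OF assms] assms unfolding commutant_def by simp

sublocale fock q interval_cov .

lemma moment_times:
  assumes "\<And>r. r \<in> set rs \<Longrightarrow> 0 \<le> r"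
  shows "E (op_prod (map X rs)) = of_real (moment (map (Pair 0) rs))"
proof -
  define n where "n = length rs"
  define t where "t i = (if i \<in> {1..n} then rs ! (i - 1) else 0)" for i
  have t: "0 \<le> t i" for i
    using assms by (auto simp: t_def n_def)
  have rs: "map t [1..<Suc n] = rs"
    by (rule nth_equalityI) (simp_all add: t_def n_def del: upt_Suc)
  have "\<forall>n t. (\<forall>i\<in>{1..n}. 0 \<le> t i) \<longrightarrow>
      E (op_prod (map (\<lambda>i. X (t i)) [1..<Suc n])) =
      of_real (\<Sum>P\<in>pair_partitions {1..n}. q ^ crossings P * (\<Prod>B\<in>P. Min (t ` B)))"
    using bm unfolding q_brownian_motion_def by (elim conjE)
  from this[rule_format, of n t] t
  have "E (op_prod (map (\<lambda>i. X (t i)) [1..<Suc n])) =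
      of_real (\<Sum>P\<in>pair_partitions {1..n}. q ^ crossings P * (\<Prod>B\<in>P. Min (t ` B)))"
    by (simp only:)
  also have "(\<Sum>P\<in>pair_partitions {1..n}. q ^ crossings P * (\<Prod>B\<in>P. Min (t ` B))) =
      moment (map (\<lambda>i. (0, t i)) [1..<Suc n])"
    using t by (intro sum_pair_partitions) (simp add: interval_cov_def min_absorb1)
  also have "map (\<lambda>i. (0, t i)) [1..<Suc n] = map (Pair 0) (map t [1..<Suc n])"
    by simp
  also have "map (\<lambda>i. X (t i)) [1..<Suc n] = map X (map t [1..<Suc n])"
    by simp
  finally show ?thesis
    unfolding rs .
qed

definition increment :: "real \<times> real \<Rightarrow> ('h \<Rightarrow>\<^sub>L 'h)" where
  "increment x = X (snd x) - X (fst x)"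

lemma increment_word_M: "set u \<subseteq> {0..} \<times> {0..} \<Longrightarrow> op_prod (map increment u) \<in> M"
proof (induction u)
  case Nil
  show ?case by (simp add: op_prod_def commutant_id)
next
  case (Cons x u)
  then have "increment x \<in> M"
    unfolding increment_def by (intro M_diff X_M) auto
  with Cons show ?case
    by (simp add: op_prod_def commutant_comp)
qed

lemma increment_0: "increment (0, t) = X t"
  by (simp add: increment_def X_0)

text \<open>Both sides are linear in each letter, and for the letters \<open>X b = X b - X 0\<close> this is the moment
formula.\<close>
lemma moment_increments:
  assumes "set u \<subseteq> {0..} \<times> {0..}"
  shows "E (op_prod (map increment u)) = of_real (moment u)"
proof -
  have "E (op_prod (map increment (u @ map (Pair 0) rs))) = of_real (moment (u @ map (Pair 0) rs))"
    if "\<And>r. r \<in> set rs \<Longrightarrow> 0 \<le> r" for rs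
    using assms that
  proof (induction u arbitrary: rs rule: rev_induct)
    case Nil
    have "map increment ([] @ map (Pair 0) rs) = map X rs"
      by (simp add: increment_0)
    then show ?case
      by (simp only: moment_times[OF Nil(2)] append_Nil)
  next
    case (snoc x u)
    obtain a b where x: "x = (a, b)" by (cases x)
    have ab: "0 \<le> a" "0 \<le> b"
      using snoc.prems(1) by (simp_all add: x)
    have IH: "E (op_prod (map increment (u @ (0, r) # map (Pair 0) rs))) =
        of_real (moment (u @ (0, r) # map (Pair 0) rs))" if "0 \<le> r" for r
      using snoc.IH[of "r # rs"] snoc.prems that by auto
    have M: "op_prod (map increment (u @ (0, r) # map (Pair 0) rs)) \<in> M" if "0 \<le> r" for r
      using snoc.prems that by (intro increment_word_M) auto
    have "increment x = increment (0, b) - increment (0, a)"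
      by (simp add: x increment_def X_0)
    then have "op_prod (map increment (u @ x # map (Pair 0) rs)) =
        op_prod (map increment (u @ (0, b) # map (Pair 0) rs)) - op_prod (map increment (u @ (0, a) # map (Pair 0) rs))"
      by (simp add: op_prod_diff)
    then have "E (op_prod (map increment (u @ x # map (Pair 0) rs))) =
        of_real (moment (u @ (0, b) # map (Pair 0) rs) - moment (u @ (0, a) # map (Pair 0) rs))"
      using E_diff[OF M[OF ab(2)] M[OF ab(1)]] IH[OF ab(1)] IH[OF ab(2)] by simp
    also have "moment (u @ (0, b) # map (Pair 0) rs) - moment (u @ (0, a) # map (Pair 0) rs) =
        moment (u @ x # map (Pair 0) rs)"
      by (rule moment_splits[symmetric]) (simp_all add: x interval_cov_def)
    finally show ?case by simp
  qed
  from this[of "[]"] show ?thesis by simp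
qed

text \<open>The covariance of copies of the single label \<open>(a, b)\<close> is \<open>b - a\<close>. So the moments are those of \<open>X 1\<close>, with
\<open>sqrt (b - a)\<close> for each factor.\<close>
lemma power_moment:
  assumes "0 \<le> a" "a \<le> b"
  shows "E (op_power (X b - X a) n) =
    of_real (sqrt (b - a) ^ n * fock.apply_word q (\<lambda>_ _. 1) (replicate n ()) vacuum [])"
proof -
  have "op_power (X b - X a) n = op_prod (map increment (replicate n (a, b)))"
    by (simp add: op_power_def increment_def map_replicate)
  then have "E (op_power (X b - X a) n) = of_real (moment (replicate n (a, b)))"
    using moment_increments[of "replicate n (a, b)"] assms by (cases "n = 0") simp_all
  also have "moment (replicate n (a, b)) =
      apply_word (map (\<lambda>_. (a, b)) (replicate n ())) vacuum (map (\<lambda>_. (a, b)) ([] :: unit list))"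
    by (simp add: moment_def map_replicate)
  also have "\<dots> = sqrt (b - a) ^ n * fock.apply_word q (\<lambda>_ _. 1) (replicate n ()) vacuum []"
    using assms by (subst apply_word_map[where r = "sqrt (b - a)" and cc = "\<lambda>_ _. 1"])
      (simp_all add: interval_cov_def min_absorb1 min_absorb2)
  finally show ?thesis .
qed

text \<open>By scaling, the even moments of the increment are bounded by the powers of
\<open>sqrt (b - a) * norm (X 1)\<close>, because those of \<open>X 1\<close> are bounded by the powers of its norm.\<close>
lemma norm_increment_le:
  assumes "0 \<le> a" "a \<le> b"
  shows "norm (X b - X a) \<le> sqrt (b - a) * norm (X 1)"
proof (rule norm_le_of_moments[OF faithful_X])
  show "X b - X a \<in> M"
    using assms by (intro M_diff X_M) auto
  show "is_adjoint (X b - X a) (X b - X a)"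
    using assms is_adjoint_inner[OF X_selfadjoint] M_linear[OF \<open>X b - X a \<in> M\<close>]
    by (intro is_adjointI) (simp_all add: blinfun.diff_left inner_diff_left inner_diff_right)
  show "Re (E (op_power (X b - X a) (2 * n))) \<le> (sqrt (b - a) * norm (X 1)) ^ (2 * n)" for n
  proof -
    let ?m = "fock.apply_word q (\<lambda>_ _. 1) (replicate (2 * n) ()) vacuum []"
    have "?m = Re (E (op_power (X 1) n o\<^sub>L op_power (X 1) n))"
      using power_moment[of 0 1 "2 * n"] by (simp add: X_0 mult_2 op_power_add)
    also have "\<dots> \<le> (norm (op_power (X 1) n))\<^sup>2"
      by (intro E_square_le_norm M_power X_M is_adjoint_power X_selfadjoint) simp_all
    also have "\<dots> \<le> (norm (X 1) ^ n)\<^sup>2"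
      by (intro power_mono norm_op_power_le) simp
    finally have "?m \<le> norm (X 1) ^ (2 * n)"
      by (simp add: power_mult mult.commute flip: power_mult)
    then show ?thesis
      unfolding power_moment[OF assms] power_mult_distrib Re_complex_of_real
      using assms by (intro mult_left_mono) simp_all
  qed
qed (use assms in simp)

text \<open>The \<open>*\<close>-algebra of the past, not closed in any topology. As a linear span of words, it reduces
statements about the state to word moments.\<close>
inductive_set past :: "real \<Rightarrow> ('h \<Rightarrow>\<^sub>L 'h) set" for s where
  word: "set rs \<subseteq> {0..s} \<Longrightarrow> op_prod (map X rs) \<in> past s"
| add: "A \<in> past s \<Longrightarrow> B \<in> past s \<Longrightarrow> A + B \<in> past s"
| scaleC: "A \<in> past s \<Longrightarrow> scaleC_op c A \<in> past s"

lemma past_M: "A \<in> past s \<Longrightarrow> A \<in> M"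
proof (induction rule: past.induct)
  case (word rs)
  then show ?case
    by (induction rs) (simp_all add: op_prod_def commutant_id commutant_comp X_M)
qed (simp_all add: commutant_add M_scaleC)

lemma past_mono: "A \<in> past s \<Longrightarrow> s \<le> s' \<Longrightarrow> A \<in> past s'"
  by (induction rule: past.induct) (auto intro!: past.intros)

lemma past_comp:
  assumes "A \<in> past s" "B \<in> past s"
  shows "A o\<^sub>L B \<in> past s"
  using assms(1)
proof (induction rule: past.induct)
  case (word rs)
  have lin: "complex_linear_op (op_prod (map X rs))"
    using past_M[OF past.word[OF word]] by (rule M_linear)
  show ?case
    using assms(2)
  proof (induction rule: past.induct)
    case (word rs')
    then show ?case
      using past.word[of "rs @ rs'" s] \<open>set rs \<subseteq> {0..s}\<close> by (simp add: op_prod_append)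
  qed (simp_all add: comp_add_right scaleC_comp_right[OF lin] past.intros)
qed (simp_all add: comp_add_left scaleC_comp_left past.intros)

lemma past_id: "id_blinfun \<in> past s"
  using past.word[of "[]" s] by (simp add: op_prod_def)

lemma past_X: "0 \<le> r \<Longrightarrow> r \<le> s \<Longrightarrow> X r \<in> past s"
  using past.word[of "[r]" s] by (simp add: op_prod_def)

lemma past_zero: "0 \<in> past s"
  using past.scaleC[OF past_id, of 0] by simp

lemma past_diff: "A \<in> past s \<Longrightarrow> B \<in> past s \<Longrightarrow> A - B \<in> past s"
  using past.add[OF _ past.scaleC[of B s "-1"], of A] scaleC_scaleR[of "-1" B] by simp

lemma past_sum: "(\<And>i. i \<in> I \<Longrightarrow> A i \<in> past s) \<Longrightarrow> (\<Sum>i\<in>I. A i) \<in> past s"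
  by (induction I rule: infinite_finite_induct) (simp_all add: past_zero past.add)

lemma past_power: "A \<in> past s \<Longrightarrow> op_power A n \<in> past s"
  by (induction n) (simp_all add: op_power_Suc past_id past_comp)

lemma past_poly: "A \<in> past s \<Longrightarrow> poly_op p A \<in> past s"
  unfolding poly_op_def by (intro past_sum past.scaleC past_power)

lemma past_adjoint: "A \<in> past s \<Longrightarrow> \<exists>B\<in>past s. is_adjoint A B"
proof (induction rule: past.induct)
  case (word rs)
  then have "is_adjoint (op_prod (map X rs)) (op_prod (map X (rev rs)))"
  proof (induction rs)
    case Nil
    show ?case by (simp add: op_prod_def is_adjoint_id)
  next
    case (Cons r rs)
    then have "is_adjoint (X r o\<^sub>L op_prod (map X rs)) (op_prod (map X (rev rs)) o\<^sub>L X r)"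
      by (intro is_adjoint_comp X_selfadjoint) simp_all
    then show ?case
      by (simp add: op_prod_append) (simp add: op_prod_def)
  qed
  then show ?case
    using word past.word[of "rev rs" s] by auto
next
  case (add A B)
  then show ?case
    using is_adjoint_add past.add by meson
next
  case (scaleC A c)
  then show ?case
    using is_adjoint_scaleC past.scaleC by meson
qed

text \<open>Inside a word, the \<open>q\<close>-Hermite polynomial of \<open>X s\<close> acts as a Wick power. Both satisfy the same recurrence;
the induction moves a letter \<open>X s\<close> into the left word \<open>u\<close>.\<close>
lemma E_hermite:
  assumes u: "set u \<subseteq> {0..} \<times> {0..}" and v: "set v \<subseteq> {0..} \<times> {0..}" and s: "0 \<le> s"
  shows "E (op_prod (map increment u) o\<^sub>L (poly_op (hermite_poly q s n) (X s) o\<^sub>L op_prod (map increment v))) =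
     of_real (apply_word (rev v) (wick (0, s) n (apply_word (rev u) vacuum) 0) [])"
  using u
proof (induction n arbitrary: u rule: induct_nat_012)
  case 0
  have "wick (0, s) 0 (apply_word (rev u) vacuum) 0 = apply_word (rev u) vacuum"
    by (rule ext) simp
  moreover have "E (op_prod (map increment (u @ v))) = of_real (moment (u @ v))"
    using 0 v by (intro moment_increments) auto
  ultimately show ?case
    by (simp add: op_prod_append moment_def apply_word_append one_pCons poly_op_const)
next
  case 1
  have "wick (0, s) (Suc 0) (apply_word (rev u) vacuum) 0 = field_op (0, s) (apply_word (rev u) vacuum)"
    by (rule ext) (simp add: wick_field_op[of "(0, s)" 0 _ 0, simplified q_int_def, simplified] field_op_def
        wick.simps(1)[abs_def])
  moreover have "poly_op (hermite_poly q s (Suc 0)) (X s) = increment (0, s)"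
    using X_linear[OF s] by (simp add: poly_op_X increment_0)
  moreover have "op_prod (map increment u) o\<^sub>L (increment (0, s) o\<^sub>L op_prod (map increment v)) =
      op_prod (map increment (u @ (0, s) # v))"
    by (simp add: op_prod_append) (simp add: op_prod_def)
  moreover have "E (op_prod (map increment (u @ (0, s) # v))) = of_real (moment (u @ (0, s) # v))"
    using 1 v s by (intro moment_increments) auto
  ultimately show ?case
    by (simp add: moment_def apply_word_append del: map_append)
next
  case (ge2 n)
  let ?a = "(0, s)" and ?\<psi> = "apply_word (rev u) vacuum" and ?U = "op_prod (map increment u)"
    and ?V = "op_prod (map increment v)" and ?c = "q_int q (Suc n) * s"
  let ?H = "\<lambda>n. poly_op (hermite_poly q s n) (X s)"
  have "?H (Suc (Suc n)) = (increment ?a o\<^sub>L ?H (Suc n)) - ?c *\<^sub>R ?H n"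
    using X_linear[OF s]
    by (simp only: hermite_poly.simps poly_op_diff poly_op_pCons poly_op_smult scaleC_scaleR increment_0)
      simp
  moreover have "op_prod (map increment (u @ [?a])) = ?U o\<^sub>L increment ?a"
    by (simp add: op_prod_append) (simp add: op_prod_def)
  ultimately have "?U o\<^sub>L (?H (Suc (Suc n)) o\<^sub>L ?V) =
      (op_prod (map increment (u @ [?a])) o\<^sub>L (?H (Suc n) o\<^sub>L ?V)) - ?c *\<^sub>R (?U o\<^sub>L (?H n o\<^sub>L ?V))"
    by (simp add: comp_diff_left comp_diff_right comp_scaleR_left comp_scaleR_right comp_assoc)
  moreover have ua: "set (u @ [?a]) \<subseteq> {0..} \<times> {0..}"
    using ge2.prems s by auto
  moreover have HM: "?H m \<in> M" for m
    by (rule past_M[OF past_poly[OF past_X[OF s order_refl]]])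
  have "op_prod (map increment (u @ [?a])) o\<^sub>L (?H (Suc n) o\<^sub>L ?V) \<in> M"
    by (intro commutant_comp HM increment_word_M ua v)
  moreover have "?U o\<^sub>L (?H n o\<^sub>L ?V) \<in> M"
    by (intro commutant_comp HM increment_word_M ge2.prems v)
  ultimately have "E (?U o\<^sub>L (?H (Suc (Suc n)) o\<^sub>L ?V)) =
      E (op_prod (map increment (u @ [?a])) o\<^sub>L (?H (Suc n) o\<^sub>L ?V)) - ?c * E (?U o\<^sub>L (?H n o\<^sub>L ?V))"
    by (simp only: E_diff E_scaleR M_scaleR)
  also have "\<dots> = of_real (apply_word (rev v) (wick ?a (Suc n) (field_op ?a ?\<psi>) 0) []
      - ?c * apply_word (rev v) (wick ?a n ?\<psi> 0) [])"
    unfolding ge2.IH(1)[OF ge2.prems] ge2.IH(2)[OF ua] by simp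
  also have "apply_word (rev v) (wick ?a (Suc n) (field_op ?a ?\<psi>) 0) [] - ?c * apply_word (rev v) (wick ?a n ?\<psi> 0) [] =
      apply_word (rev v) (wick ?a (Suc (Suc n)) ?\<psi> 0) []"
  proof -
    have "wick ?a (Suc n) (field_op ?a ?\<psi>) 0 =
        (\<lambda>S. 1 * wick ?a (Suc (Suc n)) ?\<psi> 0 S + ?c * wick ?a n ?\<psi> 0 S)"
      using s by (intro ext) (simp add: wick_field_op interval_cov_def q_int_def[of q 0] del: wick.simps)
    then have "apply_word (rev v) (wick ?a (Suc n) (field_op ?a ?\<psi>) 0) [] =
        1 * apply_word (rev v) (wick ?a (Suc (Suc n)) ?\<psi> 0) [] + ?c * apply_word (rev v) (wick ?a n ?\<psi> 0) []"
      by (simp only: apply_word_linear)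
    then show ?thesis by simp
  qed
  finally show ?case .
qed

text \<open>Since \<open>D\<close> is orthogonal to the past, the right-hand factor \<open>D\<close> can only be created, and then it can only
be removed by the left-hand factor \<open>D\<close>. Between the two, \<open>wick_marked\<close> applies.\<close>
lemma E_sandwich_hermite_words:
  fixes n :: nat
  assumes rs: "set rs \<subseteq> {0..s}" "set rs' \<subseteq> {0..s}" and s: "0 \<le> s" "s \<le> s'"
  defines "D \<equiv> X s' - X s" and "U \<equiv> op_prod (map X rs)" and "V \<equiv> op_prod (map X rs')"
    and "H \<equiv> poly_op (hermite_poly q s n) (X s)"
  shows "E ((U o\<^sub>L D) o\<^sub>L (H o\<^sub>L (D o\<^sub>L V))) = of_real ((s' - s) * q ^ n) * E (U o\<^sub>L (H o\<^sub>L V))"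
proof -
  define u where "u = map (Pair (0::real)) rs"
  define v where "v = map (Pair (0::real)) rs'"
  define d where "d = (s, s')"
  define \<phi> where "\<phi> = apply_word (rev u) vacuum"
  have uv: "set u \<subseteq> {0..} \<times> {0..}" "set v \<subseteq> {0..} \<times> {0..}" "d \<in> {0..} \<times> {0..}"
    using rs s by (auto simp: u_def v_def d_def)
  have orth: "interval_cov d (0, r) = 0" "interval_cov (0, r) d = 0" if "0 \<le> r" "r \<le> s" for r
    using that s by (simp_all add: interval_cov_def d_def min_absorb1 min_absorb2)
  have dd: "interval_cov d d = s' - s"
    using s by (simp add: interval_cov_def d_def min_absorb1 min_absorb2)
  have U: "U = op_prod (map increment u)" and V: "V = op_prod (map increment v)"
    by (simp_all add: U_def V_def u_def v_def increment_0 comp_def)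
  have UD: "U o\<^sub>L D = op_prod (map increment (u @ [d]))" and DV: "D o\<^sub>L V = op_prod (map increment (d # v))"
    unfolding U V map_append op_prod_append by (simp_all add: op_prod_def D_def d_def increment_def)
  have "E ((U o\<^sub>L D) o\<^sub>L (H o\<^sub>L (D o\<^sub>L V))) =
      of_real (apply_word (rev (d # v)) (wick (0, s) n (apply_word (rev (u @ [d])) vacuum) 0) [])"
    unfolding UD DV H_def
  proof (rule E_hermite)
    show "set (u @ [d]) \<subseteq> {0..} \<times> {0..}" "set (d # v) \<subseteq> {0..} \<times> {0..}"
      using uv by simp_all
  qed (rule s(1))
  also have "apply_word (rev (d # v)) (wick (0, s) n (apply_word (rev (u @ [d])) vacuum) 0) [] =
      apply_word (rev v) (field_op d (wick (0, s) n (field_op d \<phi>) 0)) []"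
    by (simp add: apply_word_append \<phi>_def)
  also have "\<dots> = apply_word (rev v) (\<lambda>S. (s' - s) * q ^ n * wick (0, s) n \<phi> 0 S + 0 * \<phi> S) []"
  proof (rule apply_word_cong)
    show "set (rev v) \<subseteq> {y. interval_cov d y = 0}"
      using rs orth by (auto simp: v_def)
    fix S assume S: "set S \<subseteq> {y. interval_cov d y = 0}"
    then have "annihilate d (wick (0, s) n (field_op d \<phi>) 0) S = 0"
      by (intro annihilate_orthogonal) blast
    moreover have "kills d \<phi>"
      unfolding \<phi>_def using rs orth by (intro apply_word_kills kills_vacuum) (auto simp: u_def)
    then have "wick (0, s) n (field_op d \<phi>) 0 (d # S) = interval_cov d d * q ^ (n + 0) * wick (0, s) n \<phi> 0 S"
      using orth[of s] s S by (intro wick_marked) auto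
    ultimately show "field_op d (wick (0, s) n (field_op d \<phi>) 0) S =
        (s' - s) * q ^ n * wick (0, s) n \<phi> 0 S + 0 * \<phi> S"
      unfolding field_op_def[of d _ S] by (simp add: dd)
  qed simp
  also have "\<dots> = (s' - s) * q ^ n * apply_word (rev v) (wick (0, s) n \<phi> 0) []"
    by (subst apply_word_linear) simp
  also have "of_real \<dots> = of_real ((s' - s) * q ^ n) * E (U o\<^sub>L (H o\<^sub>L V))"
    unfolding U V H_def \<phi>_def using E_hermite[OF uv(1,2) s(1)] by simp
  finally show ?thesis .
qed

lemma E_sandwich_hermite:
  fixes n :: nat
  assumes U: "U \<in> past s" and V: "V \<in> past s" and s: "0 \<le> s" "s \<le> s'"
  defines "D \<equiv> X s' - X s" and "H \<equiv> poly_op (hermite_poly q s n) (X s)"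
  shows "E ((U o\<^sub>L D) o\<^sub>L (H o\<^sub>L (D o\<^sub>L V))) = of_real ((s' - s) * q ^ n) * E (U o\<^sub>L (H o\<^sub>L V))"
proof -
  have D: "D \<in> M" and H: "H \<in> M"
    using s unfolding D_def H_def
    by (auto intro!: M_diff X_M past_M[OF past_poly[OF past_X[OF s(1) order_refl]]])
  have lin: "complex_linear_op D" "complex_linear_op H"
    using D H by (auto intro: M_linear)
  show ?thesis
    using U
  proof (induction rule: past.induct)
    case (word rs)
    let ?U = "op_prod (map X rs)"
    have U: "?U \<in> M" using past_M[OF past.word[OF word]] .
    have Ulin: "complex_linear_op ?U" using U by (rule M_linear)
    show ?case
      using V
    proof (induction rule: past.induct)
      case (word rs')
      show ?case
        unfolding D_def H_def by (rule E_sandwich_hermite_words) (use word \<open>set rs \<subseteq> {0..s}\<close> s in auto)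
    next
      case (add A B)
      have "A \<in> M" "B \<in> M" using add past_M by auto
      then show ?case
        using add.IH D H U
        by (simp add: comp_add_right E_add commutant_comp distrib_left)
    next
      case (scaleC A c)
      have "A \<in> M" using scaleC past_M by auto
      then show ?case
        using scaleC.IH D H U
        by (simp add: scaleC_comp_right lin Ulin complex_linear_comp E_scaleC commutant_comp)
    qed
  next
    case (add A B)
    have "A \<in> M" "B \<in> M" "V \<in> M" using add V past_M by auto
    then show ?case
      using add.IH D H
      by (simp add: comp_add_left E_add commutant_comp distrib_left)
  next
    case (scaleC A c)
    have "A \<in> M" "V \<in> M" using scaleC V past_M by auto
    then show ?case
      using scaleC.IH D H
      by (simp add: scaleC_comp_left E_scaleC commutant_comp)
  qed
qed

text \<open>Thus, per unit of time, \<open>cond_integral\<close> is the conditional expectation of second-order terms given the past. The power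
\<open>A^k\<close> between the two factors \<open>D\<close> is expanded in \<open>q\<close>-Hermite polynomials, and the \<open>n\<close>-th one picks up \<open>q^n\<close>.\<close>
lemma E_sandwich:
  assumes U: "U \<in> past s" and V: "V \<in> past s" and s: "0 \<le> s" "s \<le> s'"
  defines "D \<equiv> X s' - X s"
  shows "E (U o\<^sub>L ((sharp_op w (X s) D o\<^sub>L D) o\<^sub>L V)) =
     of_real (s' - s) * E (U o\<^sub>L (poly_op (cond_integral q s w) (X s) o\<^sub>L V))"
proof -
  let ?P = "\<lambda>p. poly_op p (X s)"
  have P: "?P p \<in> past s" for p
    using s by (intro past_poly past_X) auto
  have D: "D \<in> M"
    using s unfolding D_def by (intro M_diff X_M) auto
  have UM: "U \<in> M" and VM: "V \<in> M" and PM: "?P p \<in> M" for p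
    using U V P past_M by auto
  have Xlin: "complex_linear_op (X s)"
    by (rule X_linear[OF s(1)])
  have power: "E ((U' o\<^sub>L D) o\<^sub>L (op_power (X s) k o\<^sub>L (D o\<^sub>L V))) =
      of_real (s' - s) * E (U' o\<^sub>L (?P (cond_power q s k) o\<^sub>L V))" if U': "U' \<in> past s" for U' k
  proof -
    have U'M: "U' \<in> M" using U' past_M by auto
    have lin: "complex_linear_op U'" "complex_linear_op D"
      using U'M D by (auto intro: M_linear)
    let ?H = "\<lambda>n. ?P (hermite_poly q s n)"
    have "op_power (X s) k = (\<Sum>n\<le>k. hermite_coeff q s k n *\<^sub>R ?H n)"
      unfolding poly_op_monom[OF Xlin, symmetric] monom_hermite_expansion[of k q s]
      by (simp add: poly_op_sum poly_op_smult scaleC_scaleR)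
    then have "E ((U' o\<^sub>L D) o\<^sub>L (op_power (X s) k o\<^sub>L (D o\<^sub>L V))) =
        (\<Sum>n\<le>k. hermite_coeff q s k n * E ((U' o\<^sub>L D) o\<^sub>L (?H n o\<^sub>L (D o\<^sub>L V))))"
      using U'M D VM PM
      by (simp add: comp_sum_left comp_sum_right comp_scaleR_left comp_scaleR_right
          E_sum E_scaleR commutant_comp M_scaleR)
    also have "\<dots> = (\<Sum>n\<le>k. of_real (s' - s) * (of_real (hermite_coeff q s k n * q ^ n) * E (U' o\<^sub>L (?H n o\<^sub>L V))))"
      unfolding D_def using E_sandwich_hermite[OF U' V s] by (simp add: mult_ac)
    also have "\<dots> = of_real (s' - s) * E (U' o\<^sub>L ((\<Sum>n\<le>k. (hermite_coeff q s k n * q ^ n) *\<^sub>R ?H n) o\<^sub>L V))"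
      using U'M VM PM
      by (simp add: comp_sum_left comp_sum_right comp_scaleR_left comp_scaleR_right
          E_sum E_scaleR commutant_comp M_scaleR sum_distrib_left)
    also have "(\<Sum>n\<le>k. (hermite_coeff q s k n * q ^ n) *\<^sub>R ?H n) = ?P (cond_power q s k)"
      by (simp add: cond_power_def poly_op_sum poly_op_smult flip: scaleC_scaleR)
    finally show ?thesis .
  qed
  have "U o\<^sub>L ((sharp_op w (X s) D o\<^sub>L D) o\<^sub>L V) =
      (\<Sum>k\<le>degree w. ((U o\<^sub>L ?P (coeff w k)) o\<^sub>L D) o\<^sub>L (op_power (X s) k o\<^sub>L (D o\<^sub>L V)))"
    by (simp add: sharp_op_def comp_sum_left comp_sum_right comp_assoc)
  then have "E (U o\<^sub>L ((sharp_op w (X s) D o\<^sub>L D) o\<^sub>L V)) =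
      (\<Sum>k\<le>degree w. E (((U o\<^sub>L ?P (coeff w k)) o\<^sub>L D) o\<^sub>L (op_power (X s) k o\<^sub>L (D o\<^sub>L V))))"
    using UM VM PM D X_M[OF s(1)] by (simp add: E_sum commutant_comp M_power)
  also have "\<dots> = (\<Sum>k\<le>degree w. of_real (s' - s) *
      E ((U o\<^sub>L ?P (coeff w k)) o\<^sub>L (?P (cond_power q s k) o\<^sub>L V)))"
    using power[OF past_comp[OF U P]] by simp
  also have "\<dots> = of_real (s' - s) *
      E (\<Sum>k\<le>degree w. (U o\<^sub>L ?P (coeff w k)) o\<^sub>L (?P (cond_power q s k) o\<^sub>L V))"
    using UM VM PM by (simp add: E_sum commutant_comp sum_distrib_left)
  also have "(\<Sum>k\<le>degree w. (U o\<^sub>L ?P (coeff w k)) o\<^sub>L (?P (cond_power q s k) o\<^sub>L V)) =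
      U o\<^sub>L (?P (cond_integral q s w) o\<^sub>L V)"
    by (simp add: cond_integral_def poly_op_sum poly_op_mult[OF Xlin] comp_sum_left comp_sum_right comp_assoc)
  finally show ?thesis .
qed

end

section \<open>The kernel and the drift polynomial\<close>

lemma cond_integral_le:
  assumes "degree u \<le> n"
  shows "cond_integral q s u = (\<Sum>k\<le>n. coeff u k * cond_power q s k)"
  unfolding cond_integral_def using assms
  by (intro sum.mono_neutral_left) (auto simp: coeff_eq_0)

lemma cond_integral_add: "cond_integral q s (u + v) = cond_integral q s u + cond_integral q s v"
proof -
  define n where "n = max (degree u) (degree v)"
  have "degree u \<le> n" "degree v \<le> n" "degree (u + v) \<le> n"
    by (auto simp: n_def intro: degree_add_le)
  then show ?thesis
    by (simp add: cond_integral_le distrib_right sum.distrib)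
qed

lemma cond_integral_smult: "cond_integral q s (smult p u) = p * cond_integral q s u"
  using cond_integral_le[OF degree_smult_le[of p u], of q s]
  by (simp add: cond_integral_def sum_distrib_left mult.assoc)

lemma poly_hermite_poly: "poly (hermite_poly q s n) (of_real x) = of_real (q_hermite q n x s)"
  by (induction q n x s rule: q_hermite.induct) simp_all

lemma power_hermite_expansion: "(x::real) ^ k = (\<Sum>n\<le>k. hermite_coeff q s k n * q_hermite q n x s)"
proof -
  have "complex_of_real (x ^ k) = poly (monom 1 k) (of_real x)"
    by (simp add: poly_monom)
  also have "\<dots> = of_real (\<Sum>n\<le>k. hermite_coeff q s k n * q_hermite q n x s)"
    unfolding monom_hermite_expansion[of k q s] by (simp add: poly_sum poly_hermite_poly)
  finally show ?thesis
    by (simp only: of_real_eq_iff)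
qed

definition pderiv_x :: "complex poly poly \<Rightarrow> complex poly poly" where
  "pderiv_x = map_poly pderiv"

text \<open>The polynomial that coincides with \<open>\<Delta> f\<close> on the interval when \<open>s > 0\<close> (see \<open>q_Delta_eq\<close>).\<close>
definition ito_poly :: "real \<Rightarrow> real \<Rightarrow> complex poly \<Rightarrow> complex poly" where
  "ito_poly q s f = cond_integral q s (pderiv_x (diff_quotient f))"

lemma coeff_pderiv_x: "coeff (pderiv_x u) k = pderiv (coeff u k)"
  by (simp add: pderiv_x_def coeff_map_poly)

lemma degree_pderiv_x: "degree (pderiv_x u) \<le> degree u"
  by (rule degree_le) (simp add: coeff_pderiv_x coeff_eq_0)

lemma deriv_poly2: "deriv (\<lambda>z. poly2 u z y) x = poly2 (pderiv_x u) x y"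
proof -
  have "((\<lambda>z. poly2 u z y) has_field_derivative
      (\<Sum>k\<le>degree u. poly (pderiv (coeff u k)) x * y ^ k)) (at x)"
    unfolding poly2_def by (intro DERIV_sum DERIV_cmult_right poly_DERIV)
  then have "deriv (\<lambda>z. poly2 u z y) x = (\<Sum>k\<le>degree u. poly (pderiv (coeff u k)) x * y ^ k)"
    by (rule DERIV_imp_deriv)
  also have "\<dots> = poly2 (pderiv_x u) x y"
    unfolding poly2_def coeff_pderiv_x[symmetric]
    using degree_pderiv_x[of u] by (intro sum.mono_neutral_right) (auto simp: coeff_eq_0)
  finally show ?thesis .
qed

context
  fixes q :: real and \<Gamma> :: "real \<Rightarrow> real \<Rightarrow> real measure" and s x :: real
  assumes kernel: "q_kernel q \<Gamma>" and s: "0 < s" and x: "x \<in> q_interval q s"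
begin

lemma kernel_props:
  "sets (\<Gamma> s x) = sets borel" "finite_measure (\<Gamma> s x)"
  "emeasure (\<Gamma> s x) (- q_interval q s) = 0"
  "(\<integral>y. q_hermite q n y s \<partial>\<Gamma> s x) = q ^ n * q_hermite q n x s"
  using kernel[unfolded q_kernel_def, rule_format, OF s x] by simp_all

lemma kernel_integrable:
  fixes h :: "real \<Rightarrow> real"
  assumes "continuous_on UNIV h"
  shows "integrable (\<Gamma> s x) h"
proof -
  interpret finite_measure "\<Gamma> s x" by (rule kernel_props)
  have "compact (h ` q_interval q s)"
    unfolding q_interval_def by (intro compact_continuous_image continuous_on_subset[OF assms]) auto
  then obtain B where B: "\<And>y. y \<in> q_interval q s \<Longrightarrow> norm (h y) \<le> B"
    by (metis bounded_iff compact_imp_bounded imageI)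
  have "AE y in \<Gamma> s x. y \<in> q_interval q s"
  proof (rule AE_I)
    show "{y \<in> space (\<Gamma> s x). y \<notin> q_interval q s} \<subseteq> - q_interval q s"
      by auto
    show "- q_interval q s \<in> sets (\<Gamma> s x)"
      unfolding kernel_props(1) q_interval_def by simp
  qed (rule kernel_props)
  then have "AE y in \<Gamma> s x. norm (h y) \<le> B"
    by eventually_elim (rule B)
  moreover have "h \<in> borel_measurable (\<Gamma> s x)"
    using borel_measurable_continuous_onI[OF assms] kernel_props(1) measurable_cong_sets by blast
  ultimately show ?thesis
    by (rule integrable_const_bound)
qed

lemma continuous_q_hermite: "continuous_on UNIV (\<lambda>y. q_hermite q n y s)"
  by (induction n rule: induct_nat_012) (auto intro!: continuous_intros)

text \<open>Integration multiplies the \<open>n\<close>-th \<open>q\<close>-Hermite polynomial by \<open>q^n\<close>, so it is computed in that basis.\<close>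
lemma kernel_power:
  "complex_of_real (\<integral>y. y ^ k \<partial>\<Gamma> s x) = poly (cond_power q s k) (of_real x)"
proof -
  have "(\<integral>y. y ^ k \<partial>\<Gamma> s x) = (\<integral>y. (\<Sum>n\<le>k. hermite_coeff q s k n * q_hermite q n y s) \<partial>\<Gamma> s x)"
    by (simp only: power_hermite_expansion[of _ k q s])
  also have "\<dots> = (\<Sum>n\<le>k. hermite_coeff q s k n * (\<integral>y. q_hermite q n y s \<partial>\<Gamma> s x))"
    using kernel_integrable[OF continuous_q_hermite] by simp
  also have "\<dots> = (\<Sum>n\<le>k. hermite_coeff q s k n * (q ^ n * q_hermite q n x s))"
    by (simp only: kernel_props)
  finally show ?thesis
    by (simp add: cond_power_def poly_sum poly_hermite_poly mult.assoc)
qed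

lemma kernel_poly2:
  "(\<integral>y. poly2 u (of_real x) (of_real y) \<partial>\<Gamma> s x) = poly (cond_integral q s u) (of_real x)"
proof -
  have int: "integrable (\<Gamma> s x) (\<lambda>y. complex_of_real (y ^ k))" for k
    using kernel_integrable[of "\<lambda>y. y ^ k"] by (intro integrable_of_real) (simp add: continuous_intros)
  have "(\<integral>y. poly2 u (of_real x) (of_real y) \<partial>\<Gamma> s x) =
      (\<integral>y. (\<Sum>k\<le>degree u. poly (coeff u k) (of_real x) * complex_of_real (y ^ k)) \<partial>\<Gamma> s x)"
    by (simp add: poly2_def)
  also have "\<dots> = (\<Sum>k\<le>degree u. poly (coeff u k) (of_real x) * (\<integral>y. complex_of_real (y ^ k) \<partial>\<Gamma> s x))"
    using int by (subst Bochner_Integration.integral_sum) (simp_all del: of_real_power)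
  also have "\<dots> = (\<Sum>k\<le>degree u. poly (coeff u k) (of_real x) * poly (cond_power q s k) (of_real x))"
    by (simp only: integral_complex_of_real kernel_power)
  finally show ?thesis
    by (simp add: cond_integral_def poly_sum)
qed

lemma q_Delta_eq: "q_Delta \<Gamma> s f x = poly (ito_poly q s f) (of_real x)"
  unfolding q_Delta_def deriv_poly2 kernel_poly2 ito_poly_def ..

end

text \<open>For \<open>s > 0\<close> the interval is infinite, so the polynomial is determined by its values there.\<close>
lemma apply_q_Delta:
  assumes kernel: "q_kernel q \<Gamma>" and q: "q < 1" and s: "0 < s"
  shows "apply_op (q_interval q s) (q_Delta \<Gamma> s f) A = poly_op (ito_poly q s f) A"
proof -
  have eq: "poly (ito_poly q s f) (of_real x) = q_Delta \<Gamma> s f x" if "x \<in> q_interval q s" for x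
    using q_Delta_eq[OF kernel s that] by simp
  have "0 < 2 * sqrt s / sqrt (1 - q)"
    using q s by simp
  then have inf: "infinite (complex_of_real ` q_interval q s)"
    unfolding q_interval_def by (subst finite_image_iff) (auto simp: inj_on_def infinite_Icc_iff)
  have "(THE p. \<forall>x\<in>q_interval q s. poly p (complex_of_real x) = q_Delta \<Gamma> s f x) = ito_poly q s f"
  proof (rule the_equality)
    fix p assume p: "\<forall>x\<in>q_interval q s. poly p (complex_of_real x) = q_Delta \<Gamma> s f x"
    have "complex_of_real ` q_interval q s \<subseteq> {z. poly (p - ito_poly q s f) z = 0}"
      using p eq by auto
    then have "p - ito_poly q s f = 0"
      using inf poly_roots_finite finite_subset by metis
    then show "p = ito_poly q s f" by simp
  qed (simp add: eq)
  then show ?thesis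
    by (simp add: apply_op_def)
qed

section \<open>Noncommutative Taylor expansion\<close>

lemma diff_quotient_0: "diff_quotient 0 = 0"
proof (rule poly2_eqI)
  fix x y :: complex assume "x \<noteq> y"
  then show "poly2 (diff_quotient 0) x y = poly2 0 x y"
    by (simp add: diff_quotient) (simp add: poly2_altdef)
qed

lemma poly2_pCons: "poly2 (pCons p u) x y = poly p x + y * poly2 u x y"
  by (simp add: poly2_altdef)

text \<open>The difference quotient of \<open>x f(x)\<close> is \<open>f(x) + y \<partial>f(x, y)\<close>, and also \<open>f(y) + x \<partial>f(x, y)\<close>. The first form
matches the expansion of operators multiplied on the right, the second one is suited to
the derivative in \<open>x\<close>.\<close>
lemma diff_quotient_pCons: "diff_quotient (pCons a f) = pCons f (diff_quotient f)"
proof (rule poly2_eqI)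
  fix x y :: complex assume "x \<noteq> y"
  then show "poly2 (diff_quotient (pCons a f)) x y = poly2 (pCons f (diff_quotient f)) x y"
    by (simp add: diff_quotient poly2_pCons) (simp add: field_simps)
qed

lemma diff_quotient_pCons2:
  "diff_quotient (pCons a f) = map_poly (\<lambda>c. [:c:]) f + smult [:0, 1:] (diff_quotient f)"
proof (rule poly2_eqI)
  fix x y :: complex assume "x \<noteq> y"
  have "poly (map_poly (\<lambda>c. [:c:]) f) [:y:] = [:poly f y:]"
    by (induction f) (simp_all add: map_poly_pCons)
  then have "poly2 (map_poly (\<lambda>c. [:c:]) f + smult [:0, 1:] (diff_quotient f)) x y =
      poly f y + x * poly2 (diff_quotient f) x y"
    by (simp add: poly2_altdef)
  with \<open>x \<noteq> y\<close> show "poly2 (diff_quotient (pCons a f)) x y =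
      poly2 (map_poly (\<lambda>c. [:c:]) f + smult [:0, 1:] (diff_quotient f)) x y"
    by (simp add: diff_quotient) (simp add: field_simps)
qed

lemma ito_poly_pCons:
  "ito_poly q s (pCons a f) = cond_integral q s (diff_quotient f) + pCons 0 (ito_poly q s f)"
proof -
  have "pderiv_x (diff_quotient (pCons a f)) =
      diff_quotient f + smult [:0, 1:] (pderiv_x (diff_quotient f))"
  proof (rule poly_eqI)
    fix k
    have "coeff (map_poly (\<lambda>c. [:c:]) f) k = [:coeff f k:]"
      by (simp add: coeff_map_poly)
    then show "coeff (pderiv_x (diff_quotient (pCons a f))) k =
        coeff (diff_quotient f + smult [:0, 1:] (pderiv_x (diff_quotient f))) k"
      by (simp add: coeff_pderiv_x diff_quotient_pCons2 pderiv_add pderiv_pCons)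
  qed
  then show ?thesis
    by (simp add: ito_poly_def cond_integral_add cond_integral_smult)
qed

lemma ito_poly_0: "ito_poly q s 0 = 0"
  by (simp add: ito_poly_def diff_quotient_0 pderiv_x_def cond_integral_def)

lemma sharp_op_0: "sharp_op 0 A D = 0"
  by (simp add: sharp_op_def)

lemma sharp_op_pCons: "sharp_op (pCons p u) A D = (poly_op p A o\<^sub>L D) + (sharp_op u A D o\<^sub>L A)"
proof -
  have "sharp_op (pCons p u) A D =
      (\<Sum>k\<le>Suc (degree u). poly_op (coeff (pCons p u) k) A o\<^sub>L D o\<^sub>L op_power A k)"
    unfolding sharp_op_def
    by (intro sum.mono_neutral_left) (auto simp: degree_pCons_le coeff_eq_0)
  also have "\<dots> = (poly_op p A o\<^sub>L D) +
      (\<Sum>k\<le>degree u. poly_op (coeff u k) A o\<^sub>L D o\<^sub>L op_power A (Suc k))"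
    by (subst sum.atMost_Suc_shift) simp
  also have "(\<Sum>k\<le>degree u. poly_op (coeff u k) A o\<^sub>L D o\<^sub>L op_power A (Suc k)) = sharp_op u A D o\<^sub>L A"
    by (simp add: sharp_op_def op_power_Suc2 comp_sum_left comp_assoc)
  finally show ?thesis .
qed

text \<open>The part of \<open>f (A + D)\<close> that is quadratic in \<open>D\<close>. If \<open>f\<close> is multiplied on the right by
\<open>A + D\<close>, quadratic terms arise from linear ones followed by \<open>D\<close> and from quadratic ones followed
by \<open>A\<close>; this gives a recursion on the coefficients.\<close>
fun second_variation_list ::
    "complex list \<Rightarrow> ('h::complex_hilbert_space \<Rightarrow>\<^sub>L 'h) \<Rightarrow> ('h \<Rightarrow>\<^sub>L 'h) \<Rightarrow> ('h \<Rightarrow>\<^sub>L 'h)" where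
  "second_variation_list [] A D = 0"
| "second_variation_list (c # cs) A D =
     (sharp_op (diff_quotient (Poly cs)) A D o\<^sub>L D) + (second_variation_list cs A D o\<^sub>L A)"

definition second_variation ::
    "complex poly \<Rightarrow> ('h::complex_hilbert_space \<Rightarrow>\<^sub>L 'h) \<Rightarrow> ('h \<Rightarrow>\<^sub>L 'h) \<Rightarrow> ('h \<Rightarrow>\<^sub>L 'h)" where
  "second_variation f = second_variation_list (coeffs f)"

lemma second_variation_0: "second_variation 0 A D = 0"
  by (simp add: second_variation_def)

lemma second_variation_pCons:
  "second_variation (pCons a f) A D =
     (sharp_op (diff_quotient f) A D o\<^sub>L D) + (second_variation f A D o\<^sub>L A)"
  by (cases "f = 0 \<and> a = 0")
    (auto simp: second_variation_def diff_quotient_0 sharp_op_0 cCons_def)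

lemma norm_comp_le: "norm A \<le> a \<Longrightarrow> norm B \<le> b \<Longrightarrow> norm (A o\<^sub>L B) \<le> a * b"
  by (rule order_trans[OF norm_blinfun_compose], rule mult_mono)
    (auto intro: order_trans[OF norm_ge_zero])

definition taylor_remainder ::
    "complex poly \<Rightarrow> ('h::complex_hilbert_space \<Rightarrow>\<^sub>L 'h) \<Rightarrow> ('h \<Rightarrow>\<^sub>L 'h) \<Rightarrow> ('h \<Rightarrow>\<^sub>L 'h)" where
  "taylor_remainder f A D =
     poly_op f (A + D) - poly_op f A - sharp_op (diff_quotient f) A D - second_variation f A D"

lemma taylor_remainder_pCons:
  assumes "complex_linear_op A" "complex_linear_op D"
  shows "taylor_remainder (pCons a f) A D =
    (second_variation f A D o\<^sub>L D) + (taylor_remainder f A D o\<^sub>L (A + D))"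
  using complex_linear_add[OF assms]
  by (simp add: taylor_remainder_def poly_op_pCons2 assms diff_quotient_pCons sharp_op_pCons
      second_variation_pCons comp_add_left comp_add_right comp_diff_left comp_diff_right)

text \<open>The induction on \<open>f\<close> passes bounds from each order of the expansion to the next, so it also has to
carry bounds of \<open>f A\<close> and of the first-order part.\<close>
theorem taylor_bounds:
  fixes f :: "complex poly"
  assumes "0 \<le> b"
  obtains C where "0 \<le> C"
    "\<And>A D :: 'h::complex_hilbert_space \<Rightarrow>\<^sub>L 'h. complex_linear_op A \<Longrightarrow> complex_linear_op D \<Longrightarrow>
      norm A \<le> b \<Longrightarrow> norm D \<le> b \<Longrightarrow>
      norm (second_variation f A D) \<le> C * norm D ^ 2 \<and> norm (taylor_remainder f A D) \<le> C * norm D ^ 3"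
proof -
  have "\<exists>C\<ge>0. \<forall>A D :: 'h \<Rightarrow>\<^sub>L 'h. complex_linear_op A \<longrightarrow> complex_linear_op D \<longrightarrow>
      norm A \<le> b \<longrightarrow> norm D \<le> b \<longrightarrow>
      norm (poly_op f A) \<le> C \<and> norm (sharp_op (diff_quotient f) A D) \<le> C * norm D \<and>
      norm (second_variation f A D) \<le> C * norm D ^ 2 \<and> norm (taylor_remainder f A D) \<le> C * norm D ^ 3"
  proof (induction f)
    case 0
    show ?case
      by (intro exI[of _ 0]) (simp add: diff_quotient_0 sharp_op_0 second_variation_0 taylor_remainder_def)
  next
    case (pCons a f)
    then obtain C where C: "0 \<le> C" and
      bounds: "\<And>A D :: 'h \<Rightarrow>\<^sub>L 'h. complex_linear_op A \<Longrightarrow> complex_linear_op D \<Longrightarrow>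
      norm A \<le> b \<Longrightarrow> norm D \<le> b \<Longrightarrow>
      norm (poly_op f A) \<le> C \<and> norm (sharp_op (diff_quotient f) A D) \<le> C * norm D \<and>
      norm (second_variation f A D) \<le> C * norm D ^ 2 \<and> norm (taylor_remainder f A D) \<le> C * norm D ^ 3"
      by blast
    define K where "K = cmod a + C * (1 + 2 * b)"
    have K: "C + C * b \<le> K" "C + C * (2 * b) \<le> K" "cmod a + C * b \<le> K" "0 \<le> K"
      using C assms by (auto simp: K_def algebra_simps)
    show ?case
    proof (intro exI[of _ K] conjI allI impI K(4))
      fix A D :: "'h \<Rightarrow>\<^sub>L 'h"
      assume A: "complex_linear_op A" "norm A \<le> b" and D: "complex_linear_op D" "norm D \<le> b"
      let ?S = "sharp_op (diff_quotient f) A D" and ?V = "second_variation f A D"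
        and ?R = "taylor_remainder f A D" and ?d = "norm D"
      have *: "norm (poly_op f A) \<le> C" "norm ?S \<le> C * ?d" "norm ?V \<le> C * ?d ^ 2" "norm ?R \<le> C * ?d ^ 3"
        using bounds[OF A(1) D(1) A(2) D(2)] by simp_all
      have AD: "norm (A + D) \<le> 2 * b"
        using norm_triangle_ineq[of A D] A D by simp
      have "norm (poly_op (pCons a f) A) \<le> cmod a * 1 + C * b"
        unfolding poly_op_pCons2[OF A(1)]
        by (intro norm_triangle_mono norm_comp_le * A order_trans[OF norm_scaleC_op] mult_left_mono
            norm_blinfun_id_le) simp
      then show "norm (poly_op (pCons a f) A) \<le> K"
        using K by simp
      have "norm (sharp_op (diff_quotient (pCons a f)) A D) \<le> C * ?d + (C * ?d) * b"
        unfolding diff_quotient_pCons sharp_op_pCons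
        by (intro norm_triangle_mono norm_comp_le * A order_refl)
      also have "\<dots> = (C + C * b) * ?d"
        by (simp add: algebra_simps)
      also have "\<dots> \<le> K * ?d"
        using K by (intro mult_right_mono) simp_all
      finally show "norm (sharp_op (diff_quotient (pCons a f)) A D) \<le> K * ?d" .
      have "norm (second_variation (pCons a f) A D) \<le> (C * ?d) * ?d + (C * ?d ^ 2) * b"
        unfolding second_variation_pCons
        by (intro norm_triangle_mono norm_comp_le * A order_refl)
      also have "\<dots> = (C + C * b) * ?d ^ 2"
        by (simp add: algebra_simps power2_eq_square)
      also have "\<dots> \<le> K * ?d ^ 2"
        using K by (intro mult_right_mono) simp_all
      finally show "norm (second_variation (pCons a f) A D) \<le> K * ?d ^ 2" .
      have "norm (taylor_remainder (pCons a f) A D) \<le> (C * ?d ^ 2) * ?d + (C * ?d ^ 3) * (2 * b)"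
        unfolding taylor_remainder_pCons[OF A(1) D(1)]
        by (intro norm_triangle_mono norm_comp_le * AD order_refl)
      also have "\<dots> = (C + C * (2 * b)) * ?d ^ 3"
        by (simp add: algebra_simps power2_eq_square power3_eq_cube)
      also have "\<dots> \<le> K * ?d ^ 3"
        using K by (intro mult_right_mono) simp_all
      finally show "norm (taylor_remainder (pCons a f) A D) \<le> K * ?d ^ 3" .
    qed
  qed
  then show thesis
    using that by blast
qed

context q_brownian
begin

lemma past_sharp: "A \<in> past s \<Longrightarrow> D \<in> past s \<Longrightarrow> sharp_op u A D \<in> past s"
  unfolding sharp_op_def by (intro past_sum past_comp past_poly past_power)

lemma past_second_variation: "A \<in> past s \<Longrightarrow> D \<in> past s \<Longrightarrow> second_variation f A D \<in> past s"
  by (induction f)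
    (simp_all add: second_variation_0 second_variation_pCons past_zero past.add past_comp past_sharp)

text \<open>The drift polynomial is, per unit of time, the conditional expectation of the second variation given
the past, because \<open>ito_poly_pCons\<close> is the same recursion as \<open>second_variation_pCons\<close>.\<close>
lemma E_second_variation:
  assumes U: "U \<in> past s" and V: "V \<in> past s" and s: "0 \<le> s" "s \<le> s'"
  shows "E (U o\<^sub>L (second_variation f (X s) (X s' - X s) o\<^sub>L V)) =
     of_real (s' - s) * E (U o\<^sub>L (poly_op (ito_poly q s f) (X s) o\<^sub>L V))"
  using V
proof (induction f arbitrary: V)
  case 0
  show ?case by (simp add: second_variation_0 ito_poly_0 E_zero)
next
  case (pCons a f)
  let ?A = "X s" and ?D = "X s' - X s"
  have Alin: "complex_linear_op ?A"
    by (rule X_linear[OF s(1)])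
  have A: "?A \<in> past s" "?A \<in> past s'" and D: "?D \<in> past s'"
    using s by (auto intro!: past_X past_diff)
  have AV: "?A o\<^sub>L V \<in> past s"
    by (rule past_comp[OF A(1) pCons.prems])
  have UM: "U \<in> M" and VM: "V \<in> M" "?A o\<^sub>L V \<in> M"
    and SM: "sharp_op (diff_quotient f) ?A ?D o\<^sub>L ?D \<in> M" "second_variation f ?A ?D \<in> M"
    and PM: "poly_op p ?A \<in> M" for p
    by (rule past_M[OF U] past_M[OF pCons.prems] past_M[OF AV] past_M[OF past_poly[OF A(1)]]
        past_M[OF past_comp[OF past_sharp[OF A(2) D] D]] past_M[OF past_second_variation[OF A(2) D]])+
  have "U o\<^sub>L (second_variation (pCons a f) ?A ?D o\<^sub>L V) =
      (U o\<^sub>L ((sharp_op (diff_quotient f) ?A ?D o\<^sub>L ?D) o\<^sub>L V)) +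
      (U o\<^sub>L (second_variation f ?A ?D o\<^sub>L (?A o\<^sub>L V)))"
    by (simp add: second_variation_pCons comp_add_left comp_add_right comp_assoc)
  then have "E (U o\<^sub>L (second_variation (pCons a f) ?A ?D o\<^sub>L V)) =
      E (U o\<^sub>L ((sharp_op (diff_quotient f) ?A ?D o\<^sub>L ?D) o\<^sub>L V)) +
      E (U o\<^sub>L (second_variation f ?A ?D o\<^sub>L (?A o\<^sub>L V)))"
    using UM VM SM by (simp only: E_add commutant_comp)
  also have "\<dots> = of_real (s' - s) * (E (U o\<^sub>L (poly_op (cond_integral q s (diff_quotient f)) ?A o\<^sub>L V))
      + E (U o\<^sub>L (poly_op (ito_poly q s f) ?A o\<^sub>L (?A o\<^sub>L V))))"
    unfolding E_sandwich[OF U pCons.prems s] pCons.IH[OF AV] by (simp only: distrib_left)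
  also have "E (U o\<^sub>L (poly_op (cond_integral q s (diff_quotient f)) ?A o\<^sub>L V))
      + E (U o\<^sub>L (poly_op (ito_poly q s f) ?A o\<^sub>L (?A o\<^sub>L V))) =
      E ((U o\<^sub>L (poly_op (cond_integral q s (diff_quotient f)) ?A o\<^sub>L V)) +
        (U o\<^sub>L (poly_op (ito_poly q s f) ?A o\<^sub>L (?A o\<^sub>L V))))"
    using UM VM PM by (simp only: E_add commutant_comp)
  also have "(U o\<^sub>L (poly_op (cond_integral q s (diff_quotient f)) ?A o\<^sub>L V)) +
        (U o\<^sub>L (poly_op (ito_poly q s f) ?A o\<^sub>L (?A o\<^sub>L V))) =
      U o\<^sub>L (poly_op (ito_poly q s (pCons a f)) ?A o\<^sub>L V)"
    by (simp add: ito_poly_pCons poly_op_add poly_op_pCons2[OF Alin] comp_add_left comp_add_right comp_assoc)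
  finally show ?case .
qed

end

section \<open>Integrals of operator-valued functions\<close>

lemma riemann_sum_partitions:
  fixes g :: "real \<Rightarrow> 'b::banach"
  assumes g: "continuous_on {0..t} g" and "0 < e"
  obtains d where "0 < d"
    "\<And>n \<tau>. \<tau> 0 = 0 \<Longrightarrow> \<tau> n = t \<Longrightarrow> (\<And>i. i < n \<Longrightarrow> \<tau> i < \<tau> (Suc i) \<and> \<tau> (Suc i) - \<tau> i < d) \<Longrightarrow>
      norm ((\<Sum>i<n. (\<tau> (Suc i) - \<tau> i) *\<^sub>R g (\<tau> i)) - integral {0..t} g) \<le> e * t"
proof -
  have "uniformly_continuous_on {0..t} g"
    by (rule compact_uniformly_continuous[OF g]) simp
  then obtain d where d: "0 < d"
    "\<And>x y. x \<in> {0..t} \<Longrightarrow> y \<in> {0..t} \<Longrightarrow> dist y x < d \<Longrightarrow> dist (g y) (g x) < e"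
    using \<open>0 < e\<close> unfolding uniformly_continuous_on_def by metis
  show thesis
  proof (rule that[OF d(1)])
    fix n and \<tau> :: "nat \<Rightarrow> real"
    assume \<tau>: "\<tau> 0 = 0" "\<tau> n = t" "\<And>i. i < n \<Longrightarrow> \<tau> i < \<tau> (Suc i) \<and> \<tau> (Suc i) - \<tau> i < d"
    have mono: "\<tau> i \<le> \<tau> j" if "i \<le> j" "j \<le> n" for i j
      using that
    proof (induction j rule: dec_induct)
      case (step k)
      then show ?case
        using \<tau>(3)[of k] by simp
    qed simp
    have "norm ((\<Sum>i<m. (\<tau> (Suc i) - \<tau> i) *\<^sub>R g (\<tau> i)) - integral {0..\<tau> m} g) \<le> e * \<tau> m"
      if "m \<le> n" for m
      using that
    proof (induction m)
      case 0
      then show ?case by (simp add: \<tau>(1))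
    next
      case (Suc m)
      let ?a = "\<tau> m" and ?b = "\<tau> (Suc m)"
      have ab: "0 \<le> ?a" "?a \<le> ?b" "?b \<le> t" "?b - ?a < d"
        using mono[of 0 m] mono[of m "Suc m"] mono[of "Suc m" n] \<tau> Suc.prems by auto
      have int: "g integrable_on {x..y}" if "0 \<le> x" "y \<le> t" for x y
        using that by (intro integrable_continuous_real continuous_on_subset[OF g]) auto
      have split: "integral {0..?a} g + integral {?a..?b} g = integral {0..?b} g"
        using ab int[of 0 ?b] by (intro Henstock_Kurzweil_Integration.integral_combine) auto
      have "((\<lambda>x. g x - g ?a) has_integral (integral {?a..?b} g - (?b - ?a) *\<^sub>R g ?a)) {?a..?b}"
        using ab has_integral_const_real[of "g ?a" ?a ?b]
        by (intro has_integral_diff integrable_integral int) simp_all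
      then have "norm (integral {?a..?b} g - (?b - ?a) *\<^sub>R g ?a) \<le> e * Henstock_Kurzweil_Integration.content {?a..?b}"
      proof (rule has_integral_bound_real[rotated 2])
        show "0 \<le> e" using \<open>0 < e\<close> by simp
        fix x assume "x \<in> {?a..?b} - {}"
        then have "dist (g x) (g ?a) < e"
          using ab by (intro d) (auto simp: dist_real_def)
        then show "norm (g x - g ?a) \<le> e"
          by (simp add: dist_norm)
      qed simp
      then have "norm (integral {?a..?b} g - (?b - ?a) *\<^sub>R g ?a) \<le> e * (?b - ?a)"
        using ab by simp
      moreover have "(\<Sum>i<Suc m. (\<tau> (Suc i) - \<tau> i) *\<^sub>R g (\<tau> i)) - integral {0..?b} g =
          ((\<Sum>i<m. (\<tau> (Suc i) - \<tau> i) *\<^sub>R g (\<tau> i)) - integral {0..?a} g)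
          - (integral {?a..?b} g - (?b - ?a) *\<^sub>R g ?a)"
        unfolding split[symmetric] by simp
      moreover have "norm ((\<Sum>i<m. (\<tau> (Suc i) - \<tau> i) *\<^sub>R g (\<tau> i)) - integral {0..?a} g) \<le> e * ?a"
        using Suc.IH Suc.prems by simp
      ultimately have "norm ((\<Sum>i<Suc m. (\<tau> (Suc i) - \<tau> i) *\<^sub>R g (\<tau> i)) - integral {0..?b} g) \<le>
          e * ?a + e * (?b - ?a)"
        by (simp only: order_trans[OF norm_triangle_ineq4 add_mono])
      then show ?case
        by (simp add: algebra_simps)
    qed
    from this[of n] show "norm ((\<Sum>i<n. (\<tau> (Suc i) - \<tau> i) *\<^sub>R g (\<tau> i)) - integral {0..t} g) \<le> e * t"
      by (simp add: \<tau>(2))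
  qed
qed

lemma is_adjoint_diff: "is_adjoint A A' \<Longrightarrow> is_adjoint B B' \<Longrightarrow> is_adjoint (A - B) (A' - B')"
  using is_adjoint_add[of A A' "(-1) *\<^sub>R B" "(-1) *\<^sub>R B'"] is_adjoint_scaleC[of B B' "-1"]
    scaleC_scaleR[of "-1" B] scaleC_scaleR[of "-1" B'] by simp

lemma is_adjoint_integral:
  fixes g g' :: "real \<Rightarrow> ('h::complex_hilbert_space \<Rightarrow>\<^sub>L 'h)"
  assumes g: "(g has_integral J) {0..t}" and g': "(g' has_integral J') {0..t}"
    and adj: "\<And>s. s \<in> {0..t} \<Longrightarrow> is_adjoint (g s) (g' s)" and J: "complex_linear_op J"
  shows "is_adjoint J J'"
proof (rule is_adjointI[OF J])
  fix x y
  have "bounded_linear (\<lambda>A :: 'h \<Rightarrow>\<^sub>L 'h. A x \<bullet> y)" "bounded_linear (\<lambda>A :: 'h \<Rightarrow>\<^sub>L 'h. x \<bullet> A y)"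
    by (intro bounded_linear_compose[OF bounded_linear_inner_left]
        bounded_linear_compose[OF bounded_linear_inner_right] bounded_linear_apply_blinfun)+
  then have "((\<lambda>s. g s x \<bullet> y) has_integral (J x \<bullet> y)) {0..t}"
    "((\<lambda>s. x \<bullet> g' s y) has_integral (x \<bullet> J' y)) {0..t}"
    using has_integral_linear[OF g] has_integral_linear[OF g'] unfolding comp_def by blast+
  moreover have "((\<lambda>s. g s x \<bullet> y) has_integral (x \<bullet> J' y)) {0..t} \<longleftrightarrow>
      ((\<lambda>s. x \<bullet> g' s y) has_integral (x \<bullet> J' y)) {0..t}"
    using adj by (intro has_integral_cong is_adjoint_inner)
  ultimately show "J x \<bullet> y = x \<bullet> J' y"
    using has_integral_unique by blast
qed

text \<open>Composition with a fixed operator and evaluation at a vector are bounded linear, so they commute with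
the integral.\<close>
lemma integral_in_commutant:
  fixes g :: "real \<Rightarrow> ('h::complex_hilbert_space \<Rightarrow>\<^sub>L 'h)"
  assumes g: "(g has_integral J) {0..t}" and C: "\<And>s. s \<in> {0..t} \<Longrightarrow> g s \<in> commutant C"
  shows "J \<in> commutant C"
proof -
  have "complex_linear_op J"
    unfolding complex_linear_op_def
  proof (intro allI)
    fix c x
    have "bounded_linear (\<lambda>A :: 'h \<Rightarrow>\<^sub>L 'h. A (c *\<^sub>C x))"
      "bounded_linear (\<lambda>A :: 'h \<Rightarrow>\<^sub>L 'h. scaleC_op c id_blinfun (A x))"
      by (intro bounded_linear_compose[OF blinfun.bounded_linear_right] bounded_linear_apply_blinfun)+
    from has_integral_linear[OF g this(1)] has_integral_linear[OF g this(2)]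
    have "((\<lambda>s. g s (c *\<^sub>C x)) has_integral J (c *\<^sub>C x)) {0..t}"
      "((\<lambda>s. c *\<^sub>C g s x) has_integral (c *\<^sub>C J x)) {0..t}"
      by (simp_all add: comp_def)
    moreover have "((\<lambda>s. g s (c *\<^sub>C x)) has_integral (c *\<^sub>C J x)) {0..t} \<longleftrightarrow>
      ((\<lambda>s. c *\<^sub>C g s x) has_integral (c *\<^sub>C J x)) {0..t}"
      using C by (intro has_integral_cong) (simp add: commutant_def complex_linear_op_def)
    ultimately show "J (c *\<^sub>C x) = c *\<^sub>C J x"
      using has_integral_unique by blast
  qed
  moreover have "J o\<^sub>L B = B o\<^sub>L J" if "B \<in> C" for B
  proof -
    have "bounded_linear (\<lambda>A :: 'h \<Rightarrow>\<^sub>L 'h. A o\<^sub>L B)" "bounded_linear (\<lambda>A :: 'h \<Rightarrow>\<^sub>L 'h. B o\<^sub>L A)"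
      by (rule bounded_bilinear.bounded_linear_left[OF bounded_bilinear_blinfun_compose]
          bounded_bilinear.bounded_linear_right[OF bounded_bilinear_blinfun_compose])+
    from has_integral_linear[OF g this(1)] has_integral_linear[OF g this(2)]
    have "((\<lambda>s. g s o\<^sub>L B) has_integral (J o\<^sub>L B)) {0..t}"
      "((\<lambda>s. B o\<^sub>L g s) has_integral (B o\<^sub>L J)) {0..t}"
      by (simp_all add: comp_def)
    moreover have "((\<lambda>s. g s o\<^sub>L B) has_integral (B o\<^sub>L J)) {0..t} \<longleftrightarrow>
        ((\<lambda>s. B o\<^sub>L g s) has_integral (B o\<^sub>L J)) {0..t}"
      using C that by (intro has_integral_cong) (simp add: commutant_def)
    ultimately show ?thesis
      using has_integral_unique by blast
  qed
  ultimately show ?thesis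
    by (simp add: commutant_def)
qed

section \<open>Ito's formula\<close>

context q_brownian
begin

lemma continuous_X: "continuous_on {0..t} X"
proof (rule continuous_onI)
  fix s e :: real assume s: "s \<in> {0..t}" and "0 < e"
  define c where "c = norm (X 1) + 1"
  have c: "0 < c" by (simp add: c_def add_nonneg_pos)
  have le: "dist (X r) (X s) \<le> sqrt \<bar>r - s\<bar> * c" if "r \<in> {0..t}" for r
  proof -
    have "dist (X r) (X s) \<le> sqrt \<bar>r - s\<bar> * norm (X 1)"
      using norm_increment_le[of r s] norm_increment_le[of s r] that s
      by (cases "r \<le> s") (simp_all add: dist_norm norm_minus_commute)
    also have "\<dots> \<le> sqrt \<bar>r - s\<bar> * c"
      by (intro mult_left_mono) (simp_all add: c_def)
    finally show ?thesis .
  qed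
  show "\<exists>d>0. \<forall>r\<in>{0..t}. dist r s < d \<longrightarrow> dist (X r) (X s) \<le> e"
  proof (intro exI[of _ "(e / c)\<^sup>2"] conjI ballI impI)
    show "0 < (e / c)\<^sup>2" using c \<open>0 < e\<close> by simp
    fix r assume r: "r \<in> {0..t}" "dist r s < (e / c)\<^sup>2"
    then have "sqrt \<bar>r - s\<bar> \<le> sqrt ((e / c)\<^sup>2)"
      by (simp add: dist_real_def del: real_sqrt_abs)
    then have "sqrt \<bar>r - s\<bar> \<le> e / c"
      using c \<open>0 < e\<close> by simp
    then have "sqrt \<bar>r - s\<bar> * c \<le> e"
      using c by (simp add: field_simps)
    then show "dist (X r) (X s) \<le> e"
      using le[OF r(1)] by simp
  qed
qed

lemma continuous_poly_op: "continuous_on {0..t} (\<lambda>s. poly_op p (X s))"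
proof (induction p)
  case (pCons a p)
  have "continuous_on {0..t} (\<lambda>s. scaleC_op a id_blinfun + (X s o\<^sub>L poly_op p (X s)))"
    by (intro continuous_intros continuous_X pCons.IH)
  then show ?case
    by (rule continuous_on_eq) (simp add: poly_op_pCons X_linear)
qed simp

lemma continuous_hermite: "continuous_on {0..t} (\<lambda>s. poly_op (hermite_poly q s n) (X s))"
proof (induction n rule: induct_nat_012)
  case 0
  then show ?case using continuous_poly_op[of t 1] by simp
next
  case 1
  then show ?case using continuous_poly_op[of t "[:0, 1:]"] by simp
next
  case (ge2 n)
  have "continuous_on {0..t} (\<lambda>s. (X s o\<^sub>L poly_op (hermite_poly q s (Suc n)) (X s))
      - (q_int q (Suc n) * s) *\<^sub>R poly_op (hermite_poly q s n) (X s))"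
    by (intro continuous_intros continuous_X ge2.IH)
  then show ?case
  proof (rule continuous_on_eq)
    fix s assume "s \<in> {0..t}"
    then have "complex_linear_op (X s)"
      by (simp add: X_linear)
    then show "(X s o\<^sub>L poly_op (hermite_poly q s (Suc n)) (X s))
      - (q_int q (Suc n) * s) *\<^sub>R poly_op (hermite_poly q s n) (X s) =
      poly_op (hermite_poly q s (Suc (Suc n))) (X s)"
      by (simp only: hermite_poly.simps poly_op_diff poly_op_pCons poly_op_smult scaleC_scaleR) simp
  qed
qed

lemma continuous_hermite_coeff: "continuous_on S (\<lambda>s. hermite_coeff q s b n)"
proof (induction b arbitrary: n)
  case (Suc b)
  then show ?case
    by (cases n) (auto intro!: continuous_intros)
qed (simp add: continuous_on_const)

lemma continuous_ito: "continuous_on {0..t} (\<lambda>s. poly_op (ito_poly q s f) (X s))"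
proof -
  have "continuous_on {0..t} (\<lambda>s. poly_op (cond_power q s k) (X s))" for k
    unfolding cond_power_def poly_op_sum poly_op_smult scaleC_scaleR
    by (intro continuous_intros continuous_hermite_coeff continuous_hermite)
  then have "continuous_on {0..t} (\<lambda>s. \<Sum>k\<le>degree u. poly_op (coeff u k) (X s) o\<^sub>L poly_op (cond_power q s k) (X s))"
    for u :: "complex poly poly"
    by (intro continuous_intros continuous_poly_op)
  then show ?thesis
    unfolding ito_poly_def cond_integral_def poly_op_sum
    by (rule continuous_on_eq) (simp add: poly_op_mult X_linear)
qed

text \<open>Pythagoras for martingale differences: the partial sum \<open>T\<close> belongs to the past of the next
term, so the mixed terms vanish, one of them by the hypothesis and the other one because it is its
complex conjugate.\<close>
lemma orthogonal_sum:
  fixes \<tau> :: "nat \<Rightarrow> real"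
  assumes mono: "\<And>i j. i \<le> j \<Longrightarrow> j \<le> n \<Longrightarrow> \<tau> i \<le> \<tau> j"
    and past: "\<And>i. i < n \<Longrightarrow> Z i \<in> past (\<tau> (Suc i))"
    and centred: "\<And>i U. i < n \<Longrightarrow> U \<in> past (\<tau> i) \<Longrightarrow> E (U o\<^sub>L Z i) = 0"
  obtains S' where "S' \<in> past (\<tau> n)" "is_adjoint (\<Sum>i<n. Z i) S'"
    "Re (E (S' o\<^sub>L (\<Sum>i<n. Z i))) \<le> (\<Sum>i<n. (norm (Z i))\<^sup>2)"
proof -
  have S: "(\<Sum>i<m. Z i) \<in> past (\<tau> m)" if "m \<le> n" for m
  proof (rule past_sum)
    fix i assume "i \<in> {..<m}"
    then show "Z i \<in> past (\<tau> m)"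
      using that past_mono[OF past[of i] mono[of "Suc i" m]] by simp
  qed
  have "\<exists>S'\<in>past (\<tau> m). is_adjoint (\<Sum>i<m. Z i) S' \<and>
      Re (E (S' o\<^sub>L (\<Sum>i<m. Z i))) \<le> (\<Sum>i<m. (norm (Z i))\<^sup>2)" if "m \<le> n" for m
    using that
  proof (induction m)
    case 0
    show ?case
      using past_zero is_adjoint_scaleC[OF is_adjoint_id, of 0]
      by (intro bexI[of _ 0]) (simp_all add: E_zero)
  next
    case (Suc m)
    define T where "T = (\<Sum>i<m. Z i)"
    obtain T' where T': "T' \<in> past (\<tau> m)" "is_adjoint T T'"
      "Re (E (T' o\<^sub>L T)) \<le> (\<Sum>i<m. (norm (Z i))\<^sup>2)"
      using Suc by (auto simp: T_def)
    have T: "T \<in> past (\<tau> m)"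
      using S[of m] Suc.prems by (simp add: T_def)
    have Z: "Z m \<in> past (\<tau> (Suc m))"
      using past Suc.prems by simp
    obtain Z' where Z': "Z' \<in> past (\<tau> (Suc m))" "is_adjoint (Z m) Z'"
      using past_adjoint[OF Z] by blast
    have M: "T \<in> M" "T' \<in> M" "Z m \<in> M" "Z' \<in> M"
      by (rule past_M[OF T] past_M[OF T'(1)] past_M[OF Z] past_M[OF Z'(1)])+
    have TZ: "E (T' o\<^sub>L Z m) = 0"
      using centred T'(1) Suc.prems by simp
    have ZT: "E (Z' o\<^sub>L T) = 0"
      using E_adjoint[OF _ _ is_adjoint_comp[OF is_adjoint_sym[OF T'(2)] Z'(2)]] M TZ
      by (simp add: commutant_comp)
    have "(T' + Z') o\<^sub>L (T + Z m) = ((T' o\<^sub>L T) + (T' o\<^sub>L Z m)) + ((Z' o\<^sub>L T) + (Z' o\<^sub>L Z m))"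
      by (simp add: comp_add_left comp_add_right)
    then have "E ((T' + Z') o\<^sub>L (T + Z m)) = E (T' o\<^sub>L T) + E (Z' o\<^sub>L Z m)"
      using M TZ ZT by (simp add: E_add commutant_comp commutant_add)
    moreover have "Re (E (Z' o\<^sub>L Z m)) \<le> (norm (Z m))\<^sup>2"
      by (rule E_square_le_norm[OF M(3,4) Z'(2)])
    ultimately have "Re (E ((T' + Z') o\<^sub>L (T + Z m))) \<le> (\<Sum>i<Suc m. (norm (Z i))\<^sup>2)"
      using T'(3) by simp
    moreover have "T' + Z' \<in> past (\<tau> (Suc m))"
      using past_mono[OF T'(1) mono[of m "Suc m"]] Z'(1) Suc.prems by (intro past.add) simp_all
    moreover have "is_adjoint (T + Z m) (T' + Z')"
      by (rule is_adjoint_add[OF T'(2) Z'(2)])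
    ultimately show ?case
      by (intro bexI[of _ "T' + Z'"]) (simp_all add: T_def)
  qed
  then show thesis
    using that by blast
qed

text \<open>The Riemann sum minus the candidate for the stochastic integral is \<open>S + Y\<close>, where \<open>S\<close> is the sum of the
martingale differences \<open>Z i\<close> (step times drift, minus second variation), and \<open>Y\<close> consists of the error
of the Riemann sum of the drift and of the Taylor remainders. The first is small in \<open>L\<^sup>2\<close> by
\<open>orthogonal_sum\<close>, the second one in operator norm.\<close>
theorem ito_formula:
  fixes f :: "complex poly"
  assumes "0 \<le> t"
  defines "J \<equiv> integral {0..t} (\<lambda>s. poly_op (ito_poly q s f) (X s))"
  shows "has_stochastic_integral E X (diff_quotient f) t (poly_op f (X t) - scaleC_op (poly f 0) id_blinfun - J)"
proof -
  define g where "g s = poly_op (ito_poly q s f) (X s)" for s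
  define I where "I = poly_op f (X t) - scaleC_op (poly f 0) id_blinfun - J"
  define x where "x = norm (X 1)"
  have g_cont: "continuous_on {0..t} g"
    unfolding g_def by (rule continuous_ito)
  have J: "(g has_integral J) {0..t}"
    unfolding J_def g_def[symmetric]
    by (intro integrable_integral integrable_continuous_real g_cont)
  have g_past: "g s \<in> past s" if "0 \<le> s" for s
    unfolding g_def using that by (intro past_poly past_X) simp_all
  have JM: "J \<in> M"
    using past_M[OF g_past] by (intro integral_in_commutant[OF J]) simp
  \<comment> \<open>the \<open>L\<^sup>2\<close> norm involves the adjoint of \<open>J\<close>, which is the integral of the adjoints of the drift\<close>
  have "\<exists>B\<in>past s. is_adjoint (g s) B" if "s \<in> {0..t}" for s
    using that past_adjoint[OF g_past] by simp
  then obtain g' where g': "\<And>s. s \<in> {0..t} \<Longrightarrow> g' s \<in> past s" "\<And>s. s \<in> {0..t} \<Longrightarrow> is_adjoint (g s) (g' s)"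
    by metis
  have "continuous_on {0..t} g'"
    unfolding continuous_on_iff
  proof (intro ballI allI impI)
    fix s e :: real assume s: "s \<in> {0..t}" and "0 < e"
    then obtain d where d: "0 < d" "\<And>r. r \<in> {0..t} \<Longrightarrow> dist r s < d \<Longrightarrow> dist (g r) (g s) < e"
      using g_cont unfolding continuous_on_iff by meson
    have "dist (g' r) (g' s) = dist (g r) (g s)" if "r \<in> {0..t}" for r
      unfolding dist_norm using norm_adjoint[OF is_adjoint_diff[OF g'(2) g'(2)]] that s by simp
    then show "\<exists>d>0. \<forall>r\<in>{0..t}. dist r s < d \<longrightarrow> dist (g' r) (g' s) < e"
      using d by (intro exI[of _ d]) simp
  qed
  then obtain J' where J': "(g' has_integral J') {0..t}"
    using integrable_continuous_real integrable_on_def by blast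
  have J'M: "J' \<in> M"
    using past_M[OF g'(1)] by (intro integral_in_commutant[OF J']) simp
  have JJ': "is_adjoint J J'"
    using g'(2) by (intro is_adjoint_integral[OF J J'] M_linear[OF JM])
  have PM: "poly_op p (X t) \<in> past t" for p
    using assms(1) by (intro past_poly past_X) simp_all
  have IM: "I \<in> M"
    unfolding I_def using past_M[OF PM] JM by (intro M_diff M_scaleC commutant_id)
  have Xle: "norm (X s) \<le> sqrt t * x" and Dle: "norm (X s - X r) \<le> sqrt t * x"
    and D_le: "norm (X s - X r) \<le> sqrt (s - r) * x"
    if "0 \<le> r" "r \<le> s" "s \<le> t" for r s
  proof -
    have x0: "0 \<le> x" by (simp add: x_def)
    show D: "norm (X s - X r) \<le> sqrt (s - r) * x"
      unfolding x_def using that by (intro norm_increment_le)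
    also have "\<dots> \<le> sqrt t * x"
      using that x0 by (intro mult_right_mono) simp_all
    finally show "norm (X s - X r) \<le> sqrt t * x" .
    have "norm (X s) \<le> sqrt s * x"
      using norm_increment_le[of 0 s] that by (simp add: X_0 x_def)
    also have "\<dots> \<le> sqrt t * x"
      using that x0 by (intro mult_right_mono) simp_all
    finally show "norm (X s) \<le> sqrt t * x" .
  qed
  have "0 \<le> sqrt t * x"
    using assms(1) by (simp add: x_def)
  then obtain C where C: "0 \<le> C" and taylor: "\<And>A D :: 'h \<Rightarrow>\<^sub>L 'h. complex_linear_op A \<Longrightarrow> complex_linear_op D \<Longrightarrow>
      norm A \<le> sqrt t * x \<Longrightarrow> norm D \<le> sqrt t * x \<Longrightarrow>
      norm (second_variation f A D) \<le> C * norm D ^ 2 \<and> norm (taylor_remainder f A D) \<le> C * norm D ^ 3"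
    by (rule taylor_bounds) blast
  have "compact (g ` {0..t})"
    by (intro compact_continuous_image g_cont) simp
  then obtain G where G: "0 < G" "\<And>s. s \<in> {0..t} \<Longrightarrow> norm (g s) \<le> G"
    using compact_imp_bounded bounded_pos by (metis imageI)
  \<comment> \<open>bounds: \<open>(norm (Z i))\<^sup>2 \<le> K h\<^sup>2\<close> and \<open>norm (R i) \<le> L h sqrt h\<close> for a step of length \<open>h\<close>\<close>
  define K where "K = (C * x\<^sup>2 + G)\<^sup>2"
  define L where "L = C * x ^ 3"
  have KL: "0 \<le> K" "0 \<le> L"
    using C by (simp_all add: K_def L_def x_def)
  have "\<exists>\<delta>>0. \<forall>n \<tau>. \<tau> 0 = 0 \<and> \<tau> n = t \<and> (\<forall>i<n. \<tau> i < \<tau> (Suc i) \<and> \<tau> (Suc i) - \<tau> i < \<delta>) \<longrightarrow>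
        L2_norm E ((\<Sum>i<n. sharp_op (diff_quotient f) (X (\<tau> i)) (X (\<tau> (Suc i)) - X (\<tau> i))) - I) < \<epsilon>"
    if "0 < \<epsilon>" for \<epsilon>
  proof -
    \<comment> \<open>with these choices \<open>Re (E (S' S)) \<le> \<epsilon>\<^sup>2/8\<close> and \<open>norm Y \<le> \<epsilon>/4\<close>, so the square of the \<open>L\<^sup>2\<close> norm is at most \<open>\<epsilon>\<^sup>2/4 + \<epsilon>\<^sup>2/8\<close>\<close>
    define e where "e = \<epsilon> / (8 * (t + 1))"
    have e: "0 < e" "e * t \<le> \<epsilon> / 8"
      using \<open>0 < \<epsilon>\<close> assms(1) by (simp_all add: e_def field_simps)
    obtain d where d: "0 < d"
      "\<And>n \<tau>. \<tau> 0 = 0 \<Longrightarrow> \<tau> n = t \<Longrightarrow> (\<And>i. i < n \<Longrightarrow> \<tau> i < \<tau> (Suc i) \<and> \<tau> (Suc i) - \<tau> i < d) \<Longrightarrow>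
      norm ((\<Sum>i<n. (\<tau> (Suc i) - \<tau> i) *\<^sub>R g (\<tau> i)) - integral {0..t} g) \<le> e * t"
      using riemann_sum_partitions[OF g_cont e(1)] by blast
    define d1 where "d1 = \<epsilon>\<^sup>2 / (8 * (K * t + 1))"
    define d2 where "d2 = \<epsilon> / (8 * (L * t + 1))"
    have Kt: "0 \<le> K * t" and Lt: "0 \<le> L * t"
      using KL assms(1) by simp_all
    have d12: "0 < d1" "0 < d2" "K * t * d1 \<le> \<epsilon>\<^sup>2 / 8" "L * t * d2 \<le> \<epsilon> / 8"
      using \<open>0 < \<epsilon>\<close> Kt Lt by (simp_all add: d1_def d2_def field_simps add_pos_nonneg)
    define \<delta> where "\<delta> = min d (min d1 (d2\<^sup>2))"
    have \<delta>: "0 < \<delta>" "\<delta> \<le> d" "\<delta> \<le> d1" "\<delta> \<le> d2\<^sup>2"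
      using d(1) d12 by (simp_all add: \<delta>_def)
    have "L2_norm E ((\<Sum>i<n. sharp_op (diff_quotient f) (X (\<tau> i)) (X (\<tau> (Suc i)) - X (\<tau> i))) - I) < \<epsilon>"
      if \<tau>: "\<tau> 0 = 0" "\<tau> n = t" "\<And>i. i < n \<Longrightarrow> \<tau> i < \<tau> (Suc i) \<and> \<tau> (Suc i) - \<tau> i < \<delta>"
      for n and \<tau> :: "nat \<Rightarrow> real"
    proof -
      have mono: "\<tau> i \<le> \<tau> j" if "i \<le> j" "j \<le> n" for i j
        using that
      proof (induction j rule: dec_induct)
        case (step k)
        then show ?case
          using \<tau>(3)[of k] by simp
      qed simp
      have bounds: "0 \<le> \<tau> i" "\<tau> i \<le> \<tau> (Suc i)" "\<tau> (Suc i) \<le> t" "\<tau> i \<le> t" if "i < n" for i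
        using mono[of 0 i] mono[of i "Suc i"] mono[of "Suc i" n] mono[of i n] \<tau>(1,2) that by simp_all
      define h where "h i = \<tau> (Suc i) - \<tau> i" for i
      have h: "0 \<le> h i" "h i \<le> d1" "sqrt (h i) \<le> d2" if "i < n" for i
      proof -
        show "0 \<le> h i" "h i \<le> d1"
          using \<tau>(3)[OF that] \<delta> by (simp_all add: h_def)
        have "sqrt (h i) \<le> sqrt (d2\<^sup>2)"
          using \<tau>(3)[OF that] \<delta> by (intro real_sqrt_le_mono) (simp add: h_def)
        then show "sqrt (h i) \<le> d2"
          using d12 by simp
      qed
      have sum_h: "(\<Sum>i<n. h i) = t"
        unfolding h_def using sum_lessThan_telescope[of \<tau> n] \<tau>(1,2) by simp
      define A where "A i = X (\<tau> i)" for i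
      define D where "D i = X (\<tau> (Suc i)) - X (\<tau> i)" for i
      define V where "V i = second_variation f (A i) (D i)" for i
      define R where "R i = taylor_remainder f (A i) (D i)" for i
      define Z where "Z i = h i *\<^sub>R g (\<tau> i) - V i" for i
      have A: "A i \<in> past (\<tau> i)" "A i \<in> past (\<tau> (Suc i))" and D: "D i \<in> past (\<tau> (Suc i))" if "i < n" for i
        unfolding A_def D_def using bounds[OF that] by (auto intro!: past_X past_diff)
      have lin: "complex_linear_op (A i)" "complex_linear_op (D i)" if "i < n" for i
        by (rule M_linear[OF past_M[OF A(1)[OF that]]], rule M_linear[OF past_M[OF D[OF that]]])
      have normD: "norm (D i) \<le> sqrt (h i) * x" if "i < n" for i
        unfolding D_def h_def using bounds[OF that] by (intro D_le)
      have VR: "norm (V i) \<le> C * norm (D i) ^ 2" "norm (R i) \<le> C * norm (D i) ^ 3" if "i < n" for i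
      proof -
        have "norm (A i) \<le> sqrt t * x" "norm (D i) \<le> sqrt t * x"
          unfolding A_def D_def using bounds[OF that] by (auto intro!: Xle[of "\<tau> i"] Dle)
        from taylor[OF lin[OF that] this]
        show "norm (V i) \<le> C * norm (D i) ^ 2" "norm (R i) \<le> C * norm (D i) ^ 3"
          by (simp_all add: V_def R_def)
      qed
      have normV: "norm (V i) \<le> C * x\<^sup>2 * h i" if "i < n" for i
      proof -
        have "norm (D i) ^ 2 \<le> (sqrt (h i) * x) ^ 2"
          using normD[OF that] by (intro power_mono) simp_all
        also have "\<dots> = h i * x\<^sup>2"
          using h[OF that] by (simp add: power_mult_distrib)
        finally have "C * norm (D i) ^ 2 \<le> C * (h i * x\<^sup>2)"
          using C by (intro mult_left_mono)
        with VR(1)[OF that] show ?thesis by (simp add: mult_ac)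
      qed
      have normR: "norm (R i) \<le> L * d2 * h i" if "i < n" for i
      proof -
        have "norm (D i) ^ 3 \<le> (sqrt (h i) * x) ^ 3"
          using normD[OF that] by (intro power_mono) simp_all
        also have "\<dots> = sqrt (h i) * (h i * x ^ 3)"
          using h[OF that] by (simp add: power_mult_distrib power3_eq_cube)
        also have "\<dots> \<le> d2 * (h i * x ^ 3)"
          using h[OF that] by (intro mult_right_mono) (simp_all add: x_def)
        finally have "C * norm (D i) ^ 3 \<le> C * (d2 * (h i * x ^ 3))"
          using C by (intro mult_left_mono)
        with VR(2)[OF that] show ?thesis by (simp add: mult_ac L_def)
      qed
      have normZ: "(norm (Z i))\<^sup>2 \<le> K * d1 * h i" if "i < n" for i
      proof -
        have "norm (Z i) \<le> norm (h i *\<^sub>R g (\<tau> i)) + norm (V i)"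
          unfolding Z_def by (rule norm_triangle_ineq4)
        also have "\<dots> \<le> h i * G + C * x\<^sup>2 * h i"
          using h[OF that] G(2)[of "\<tau> i"] bounds[OF that] normV[OF that]
          by (intro add_mono) (simp_all add: mult_left_mono)
        also have "\<dots> = (C * x\<^sup>2 + G) * h i"
          by (simp add: algebra_simps)
        finally have "(norm (Z i))\<^sup>2 \<le> ((C * x\<^sup>2 + G) * h i)\<^sup>2"
          by (intro power_mono) simp_all
        also have "\<dots> = K * h i * h i"
          by (simp add: K_def power2_eq_square mult_ac)
        also have "\<dots> \<le> K * d1 * h i"
          using h[OF that] KL by (intro mult_right_mono mult_left_mono) simp_all
        finally show ?thesis .
      qed
      have Vpast: "V i \<in> past (\<tau> (Suc i))" if "i < n" for i
        unfolding V_def by (rule past_second_variation[OF A(2)[OF that] D[OF that]])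
      have gpast: "g (\<tau> i) \<in> past (\<tau> i)" "g (\<tau> i) \<in> past (\<tau> (Suc i))" if "i < n" for i
        using g_past bounds[OF that] past_mono by blast+
      have past_scaleR: "B \<in> past s \<Longrightarrow> r *\<^sub>R B \<in> past s" for r s B
        using past.scaleC[of B s "of_real r"] by (simp add: scaleC_scaleR)
      have Zpast: "Z i \<in> past (\<tau> (Suc i))" if "i < n" for i
        unfolding Z_def by (intro past_diff past_scaleR gpast Vpast that)
      have centred: "E (U o\<^sub>L Z i) = 0" if "i < n" "U \<in> past (\<tau> i)" for i U
      proof -
        have "E (U o\<^sub>L V i) = of_real (h i) * E (U o\<^sub>L g (\<tau> i))"
          using E_second_variation[OF that(2) past_id bounds(1,2)[OF that(1)], of f]
          by (simp add: V_def A_def D_def h_def g_def)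
        moreover have "U o\<^sub>L Z i = h i *\<^sub>R (U o\<^sub>L g (\<tau> i)) - (U o\<^sub>L V i)"
          by (simp add: Z_def comp_diff_right comp_scaleR_right)
        moreover have "U o\<^sub>L g (\<tau> i) \<in> M" "U o\<^sub>L V i \<in> M"
          by (intro commutant_comp past_M[OF that(2)] past_M[OF gpast(1)[OF that(1)]] past_M[OF Vpast[OF that(1)]])+
        ultimately show ?thesis
          by (simp add: E_diff E_scaleR M_scaleR)
      qed
      define S where "S = (\<Sum>i<n. Z i)"
      obtain S' where S': "S' \<in> past t" "is_adjoint S S'" "Re (E (S' o\<^sub>L S)) \<le> (\<Sum>i<n. (norm (Z i))\<^sup>2)"
        using orthogonal_sum[of n \<tau> Z, OF mono Zpast centred] unfolding S_def \<tau>(2) by blast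
      have Spast: "S \<in> past t"
        unfolding S_def
      proof (rule past_sum)
        fix i assume "i \<in> {..<n}"
        then show "Z i \<in> past t"
          using past_mono[OF Zpast bounds(3)] by simp
      qed
      define W where "W = (\<Sum>i<n. h i *\<^sub>R g (\<tau> i)) + (\<Sum>i<n. R i)"
      define Y where "Y = J - W"
      have Wpast: "W \<in> past t"
        unfolding W_def
      proof (intro past.add past_sum)
        fix i assume "i \<in> {..<n}"
        then have i: "i < n" by simp
        show "h i *\<^sub>R g (\<tau> i) \<in> past t"
          by (rule past_mono[OF past_scaleR[OF gpast(1)[OF i]] bounds(4)[OF i]])
        have "R i \<in> past (\<tau> (Suc i))"
          unfolding R_def taylor_remainder_def
          by (intro past_diff past_poly past.add past_sharp past_second_variation A D i)
        then show "R i \<in> past t"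
          by (rule past_mono[OF _ bounds(3)[OF i]])
      qed
      obtain W' where W': "W' \<in> past t" "is_adjoint W W'"
        using past_adjoint[OF Wpast] by blast
      have YM: "Y \<in> M" "J' - W' \<in> M" and YY': "is_adjoint Y (J' - W')"
        unfolding Y_def using past_M[OF Wpast] past_M[OF W'(1)] JM J'M W'(2) JJ'
        by (auto intro: M_diff is_adjoint_diff)
      have SM: "S \<in> M" "S' \<in> M"
        by (rule past_M[OF Spast] past_M[OF S'(1)])+
      have "poly_op f (X t) - poly_op f (X 0) = (\<Sum>i<n. poly_op f (A i + D i) - poly_op f (A i))"
        using sum_lessThan_telescope[of "\<lambda>i. poly_op f (X (\<tau> i))" n] \<tau>(1,2) by (simp add: A_def D_def)
      also have "\<dots> = (\<Sum>i<n. sharp_op (diff_quotient f) (A i) (D i) + V i + R i)"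
        by (simp add: R_def V_def taylor_remainder_def)
      finally have "I = (\<Sum>i<n. sharp_op (diff_quotient f) (A i) (D i)) + (\<Sum>i<n. V i) + (\<Sum>i<n. R i) - J"
        by (simp add: I_def X_0 poly_op_at_0 sum.distrib)
      then have F: "(\<Sum>i<n. sharp_op (diff_quotient f) (X (\<tau> i)) (X (\<tau> (Suc i)) - X (\<tau> i))) - I = S + Y"
        by (simp add: S_def Y_def W_def Z_def sum_subtractf A_def D_def)
      have "adj_op (S + Y) = S' + (J' - W')"
        by (intro adj_op_eq is_adjoint_add S'(2) YY')
      then have "(L2_norm E (S + Y))\<^sup>2 = Re (E ((S' + (J' - W')) o\<^sub>L (S + Y)))"
        using E_square(1)[of "S + Y" "S' + (J' - W')"] is_adjoint_add[OF S'(2) YY'] SM YM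
        by (simp add: L2_norm_def commutant_add)
      also have "\<dots> \<le> 2 * Re (E (S' o\<^sub>L S)) + 2 * Re (E ((J' - W') o\<^sub>L Y))"
        by (rule E_square_add[OF SM S'(2) YM YY'])
      also have "\<dots> \<le> 2 * (\<epsilon>\<^sup>2 / 8) + 2 * (\<epsilon> / 4)\<^sup>2"
      proof -
        have "(\<Sum>i<n. (norm (Z i))\<^sup>2) \<le> (\<Sum>i<n. K * d1 * h i)"
          using normZ by (intro sum_mono) simp
        also have "\<dots> = K * t * d1"
          by (simp add: sum_h mult_ac flip: sum_distrib_left)
        finally have 1: "Re (E (S' o\<^sub>L S)) \<le> \<epsilon>\<^sup>2 / 8"
          using S'(3) d12(3) by linarith
        have "norm (\<Sum>i<n. R i) \<le> (\<Sum>i<n. L * d2 * h i)"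
          using normR by (intro sum_norm_le) simp
        also have "\<dots> = L * t * d2"
          by (simp add: sum_h mult_ac flip: sum_distrib_left)
        finally have 2: "norm (\<Sum>i<n. R i) \<le> \<epsilon> / 8"
          using d12(4) by linarith
        have "norm ((\<Sum>i<n. h i *\<^sub>R g (\<tau> i)) - J) \<le> e * t"
          unfolding h_def J_def g_def[symmetric]
        proof (rule d(2)[OF \<tau>(1,2)])
          show "\<tau> i < \<tau> (Suc i) \<and> \<tau> (Suc i) - \<tau> i < d" if "i < n" for i
            using \<tau>(3)[OF that] \<delta>(2) by simp
        qed
        moreover have "Y = - (((\<Sum>i<n. h i *\<^sub>R g (\<tau> i)) - J) + (\<Sum>i<n. R i))"
          by (simp add: Y_def W_def)
        then have "norm Y \<le> norm ((\<Sum>i<n. h i *\<^sub>R g (\<tau> i)) - J) + norm (\<Sum>i<n. R i)"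
          by (simp only: norm_minus_cancel norm_triangle_ineq)
        ultimately have "norm Y \<le> \<epsilon> / 4"
          using 2 e(2) by linarith
        then have "(norm Y)\<^sup>2 \<le> (\<epsilon> / 4)\<^sup>2"
          by (intro power_mono) simp_all
        then have "Re (E ((J' - W') o\<^sub>L Y)) \<le> (\<epsilon> / 4)\<^sup>2"
          using E_square_le_norm[OF YM YY'] by linarith
        with 1 show ?thesis by linarith
      qed
      also have "\<dots> < \<epsilon>\<^sup>2"
        using \<open>0 < \<epsilon>\<close> by (simp add: power_divide)
      finally have "(L2_norm E (S + Y))\<^sup>2 < \<epsilon>\<^sup>2" .
      then have "L2_norm E (S + Y) < \<epsilon>"
        using \<open>0 < \<epsilon>\<close> by (simp add: power2_less_imp_less)
      then show ?thesis
        by (simp only: F)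
    qed
    then show ?thesis
      using \<delta>(1) by (intro exI[of _ \<delta>] conjI allI impI) simp_all
  qed
  with IM show ?thesis
    by (simp add: has_stochastic_integral_def von_neumann_generated_def I_def)
qed

end

theorem proposition21:
  fixes q t :: real
    and X :: "real \<Rightarrow> ('h::complex_hilbert_space \<Rightarrow>\<^sub>L 'h)"
    and E :: "('h \<Rightarrow>\<^sub>L 'h) \<Rightarrow> complex"
    and \<Gamma> :: "real \<Rightarrow> real \<Rightarrow> real measure"
    and f :: "complex poly"
  assumes "-1 < q" "q < 1"
    and "q_brownian_motion q X E"
    and "q_kernel q \<Gamma>"
    and "0 \<le> t"
  shows "\<exists>I J. has_stochastic_integral E X (diff_quotient f) t I \<and>
           ((\<lambda>s. apply_op (q_interval q s) (q_Delta \<Gamma> s f) (X s)) has_integral J) {0..t} \<and>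
           poly_op f (X t) = scaleC_op (poly f 0) id_blinfun + I + J"
proof -
  interpret q_brownian q X E
    by (rule q_brownian.intro[OF assms(3)])
  define J where "J = integral {0..t} (\<lambda>s. poly_op (ito_poly q s f) (X s))"
  have "((\<lambda>s. poly_op (ito_poly q s f) (X s)) has_integral J) {0..t}"
    unfolding J_def by (intro integrable_integral integrable_continuous_real continuous_ito)
  then have "((\<lambda>s. apply_op (q_interval q s) (q_Delta \<Gamma> s f) (X s)) has_integral J) {0..t}"
  \<comment> \<open>at \<open>s = 0\<close> the interval is a single point and does not determine a polynomial, but one point does not affect the integral\<close>
  proof (rule has_integral_spike_finite[rotated 2])
    show "apply_op (q_interval q s) (q_Delta \<Gamma> s f) (X s) = poly_op (ito_poly q s f) (X s)"
      if "s \<in> {0..t} - {0}" for s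
      using that by (intro apply_q_Delta[OF assms(4,2)]) simp
  qed simp
  moreover have "has_stochastic_integral E X (diff_quotient f) t
      (poly_op f (X t) - scaleC_op (poly f 0) id_blinfun - J)"
    unfolding J_def by (rule ito_formula[OF assms(5)])
  ultimately show ?thesis
    by (intro exI[of _ "poly_op f (X t) - scaleC_op (poly f 0) id_blinfun - J"] exI[of _ J]) simp
qed

end
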